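(* Let $k$ be the moment parameter and let $R>0$. Let $\mathcal D$ be a distribution over $\mathbb R$ with mean $\mu \in [-R,R]$ and $k$-th central moment bounded by $1$, i.e. $\mathbb E_{X\sim\mathcal D}[|X-\mu|^k]\le 1$. Then for every $\alpha,\epsilon>0$ and $\beta\in(0,1)$ there exists a person-level $\epsilon$-differentially private mean estimation algorithm which, given $n$ people each holding $m$ i.i.d. samples from $\mathcal D$, where \[ n=\tilde O_k\left(\frac{1}{\alpha^2 m\beta}+\frac{\log(1/\beta)}{\alpha\sqrt m\,\epsilon}+\frac{\log(1/\beta)}{\alpha^{k/(k-1)} m\epsilon}+\frac{\log(Rm/\beta)}{\epsilon}\right), \] outputs an estimate $\hat\mu$ with $|\hat\mu-\mu|\le\alpha$ with probability at least $1-\beta$. Here $\tilde O_k$ hides multiplicative factors depending only on $k$ and lower-order logarithmic factors in $m$.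
   Context: A dataset consists of $n$ people, person $i$ holding $m$ samples $X^{(i)}=(X^{(i)}_1,\dots,X^{(i)}_m)$. Two datasets are neighboring if they differ in the entire sample set of at most one person. An algorithm $A$ is person-level $(\epsilon,\delta)$-differentially private if for all neighboring datasets $X,X'$ and all measurable sets $Y$ of outputs, $\Pr[A(X)\in Y]\le e^{\epsilon}\Pr[A(X')\in Y]+\delta$; $\epsilon$-DP means $\delta=0$. The bound $R$ on $|\mu|$ is known to the algorithm.
   Formalization: The moment parameter k, whose range is not given, is taken to be a real number k ≥ 2; for 1 < k < 2 the variance may be infinite and the stated bound fails for large ε, and at k = 1 the exponent k/(k-1) is undefined. *)

theory Defs
  imports "HOL-Probability.Probability"
begin

text \<open>A dataset of \<open>n\<close> people holding \<open>m\<close> real samples each is a function \<open>X\<close> with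
  \<open>X i j\<close> the \<open>j\<close>-th sample of person \<open>i\<close>, for \<open>i < n\<close> and \<open>j < m\<close>. It is undefined
  outside these ranges, as is usual for elements of a product space.\<close>

definition dataset_space :: "nat \<Rightarrow> nat \<Rightarrow> (nat \<Rightarrow> nat \<Rightarrow> real) measure" where
  "dataset_space n m = (\<Pi>\<^sub>M i\<in>{..<n}. \<Pi>\<^sub>M j\<in>{..<m}. borel)"

definition iid_dataset :: "nat \<Rightarrow> nat \<Rightarrow> real measure \<Rightarrow> (nat \<Rightarrow> nat \<Rightarrow> real) measure" where
  "iid_dataset n m D = (\<Pi>\<^sub>M i\<in>{..<n}. \<Pi>\<^sub>M j\<in>{..<m}. D)"

definition neighboring :: "nat \<Rightarrow> nat \<Rightarrow> (nat \<Rightarrow> nat \<Rightarrow> real) \<Rightarrow> (nat \<Rightarrow> nat \<Rightarrow> real) \<Rightarrow> bool" where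
  "neighboring n m X X' \<longleftrightarrow>
     X \<in> space (dataset_space n m) \<and> X' \<in> space (dataset_space n m) \<and>
     card {i\<in>{..<n}. X i \<noteq> X' i} \<le> 1"

text \<open>A randomized algorithm is a Markov kernel: \<open>A X\<close> is the law of the output on input \<open>X\<close>.\<close>

definition randomized_algorithm ::
    "nat \<Rightarrow> nat \<Rightarrow> ((nat \<Rightarrow> nat \<Rightarrow> real) \<Rightarrow> real measure) \<Rightarrow> bool" where
  "randomized_algorithm n m A \<longleftrightarrow> A \<in> dataset_space n m \<rightarrow>\<^sub>M prob_algebra borel"

definition person_level_DP ::
    "nat \<Rightarrow> nat \<Rightarrow> real \<Rightarrow> real \<Rightarrow> ((nat \<Rightarrow> nat \<Rightarrow> real) \<Rightarrow> real measure) \<Rightarrow> bool" where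
  "person_level_DP n m \<epsilon> \<delta> A \<longleftrightarrow>
     (\<forall>X X'. neighboring n m X X' \<longrightarrow>
        (\<forall>Y\<in>sets borel. measure (A X) Y \<le> exp \<epsilon> * measure (A X') Y + \<delta>))"

definition mean :: "real measure \<Rightarrow> real" where
  "mean D = (\<integral>x. x \<partial>D)"

text \<open>The integrability conjuncts are needed because the Bochner integral of a non-integrable
  function is \<open>0\<close>.\<close>

definition bounded_moment_distribution :: "real \<Rightarrow> real \<Rightarrow> real measure \<Rightarrow> bool" where
  "bounded_moment_distribution k R D \<longleftrightarrow>
     prob_space D \<and> sets D = sets borel \<and>
     integrable D (\<lambda>x. x) \<and> mean D \<in> {-R..R} \<and>
     integrable D (\<lambda>x. \<bar>x - mean D\<bar> powr k) \<and>
     (\<integral>x. \<bar>x - mean D\<bar> powr k \<partial>D) \<le> 1"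

text \<open>The probability is over both the
  i.i.d. dataset and the internal randomness of the algorithm.\<close>

definition accurate_for ::
    "nat \<Rightarrow> nat \<Rightarrow> real \<Rightarrow> real \<Rightarrow> real measure \<Rightarrow>
     ((nat \<Rightarrow> nat \<Rightarrow> real) \<Rightarrow> real measure) \<Rightarrow> bool" where
  "accurate_for n m \<alpha> \<beta> D A \<longleftrightarrow>
     measure (iid_dataset n m D \<bind> A) {y. \<bar>y - mean D\<bar> \<le> \<alpha>} \<ge> 1 - \<beta>"

definition sample_rate :: "real \<Rightarrow> real \<Rightarrow> nat \<Rightarrow> real \<Rightarrow> real \<Rightarrow> real \<Rightarrow> real" where
  "sample_rate k R m \<alpha> \<epsilon> \<beta> =
     1 / (\<alpha>\<^sup>2 * real m * \<beta>)
     + ln (1 / \<beta>) / (\<alpha> * sqrt (real m) * \<epsilon>)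
     + ln (1 / \<beta>) / (\<alpha> powr (k / (k - 1)) * real m * \<epsilon>)
     + ln (R * real m / \<beta>) / \<epsilon>"

end

theory Submission
  imports Defs
begin

text \<open>The estimator consists of two exponential mechanisms with finite output sets. The coarse one
  selects a point \<open>c\<close> of a grid of width about \<open>max (1 / \<surd>m) \<alpha>\<close> by counting the people whose mean
  lies nearby; most people's means are within this distance of \<open>\<mu>\<close> by Chebyshev's inequality. If
  \<open>\<alpha>\<close> is of smaller order than \<open>1 / \<surd>m\<close>, every sample is then clipped to distance \<open>b\<close> from \<open>c\<close>,
  every person's mean of clipped samples is clipped to distance \<open>\<tau>\<close> from \<open>c\<close>, and the average of
  the results, which has sensitivity \<open>2 \<tau> / n\<close>, is released with two-sided geometric noise on a
  lattice of width \<open>\<alpha> / 8\<close>. The sample clipping bias is at most \<open>(2 / b) powr (k - 1)\<close>, so \<open>b\<close> is of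
  order \<open>\<alpha> powr (- 1 / (k - 1)) + \<surd>m\<close>; since clipped samples are bounded by \<open>b\<close> with variance
  \<open>O(1)\<close>, a Bennett-type bound allows \<open>\<tau>\<close> of order \<open>(1 + ln m) b / m\<close>.

  When \<open>\<beta> > 1 / 2\<close>, the factor \<open>ln (1 / \<beta>)\<close> may be arbitrarily small. There one runs the algorithm with failure
  probability \<open>1 / 4\<close> and the coarser accuracy \<open>\<alpha> / (4 (1 - \<beta>))\<close> and then guesses the remaining
  offset at random.\<close>

section \<open>Sums of independent identically distributed functions\<close>

text \<open>Two clips are needed because a neighbor may replace all \<open>m\<close> samples of a
  person at once: clipping samples alone leaves that person's mean with range \<open>2 * b\<close>,
  whereas typical means concentrate at scale about \<open>b / m\<close> up to a logarithm, and the
  second clip exploits this.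

  The rate allows 1/\<beta> only in its variance term and a mere logarithm of 1/\<beta> in the noise
  terms. Sampling error across people can therefore be left to second moments, but the randomness of
  the mechanism needs exponential tails, and the clipping radii must not depend on \<beta>.

  A further obstacle is that \<open>sample_rate\<close> contains no positive constant:
  \<open>ln (1 / \<beta>)\<close> may vanish, and \<open>ln (R * m / \<beta>)\<close> may be
  negative. Fixed costs such as the logarithm of a grid size must be paid by the remaining terms.
  The inequality \<open>\<alpha> \<le> 4 * R * ln (1 / \<beta>)\<close> makes this possible; where
  it can fail, an answer that ignores the data is already good enough.

  Finite output sets reduce privacy to a ratio bound for single atoms and measurability to that of
  finitely many real functions.\<close>

context prob_space
begin

lemma product_prob_space_const: "product_prob_space (\<lambda>_. M)"
  by unfold_locales

lemma prob_space_iid: "prob_space (PiM I (\<lambda>_. M))"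
  by (intro prob_space_PiM prob_space_axioms)

lemma
  fixes f :: "'a \<Rightarrow> real"
  assumes "i \<in> I"
  shows integrable_iid_component: "integrable M f \<Longrightarrow> integrable (PiM I (\<lambda>_. M)) (\<lambda>x. f (x i))"
    and integral_iid_component: "f \<in> borel_measurable M \<Longrightarrow> (\<integral>x. f (x i) \<partial>PiM I (\<lambda>_. M)) = expectation f"
proof -
  have d: "distr (PiM I (\<lambda>_. M)) M (\<lambda>x. x i) = M"
    by (rule distr_PiM_component) (use assms prob_space_axioms in auto)
  have m: "(\<lambda>x. x i) \<in> PiM I (\<lambda>_. M) \<rightarrow>\<^sub>M M"
    using assms by simp
  show "integrable M f \<Longrightarrow> integrable (PiM I (\<lambda>_. M)) (\<lambda>x. f (x i))"
    using integrable_distr[OF m, of f] by (simp add: d)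
  show "f \<in> borel_measurable M \<Longrightarrow> (\<integral>x. f (x i) \<partial>PiM I (\<lambda>_. M)) = expectation f"
    using integral_distr[OF m, of f] by (simp add: d)
qed

lemma
  fixes f :: "'a \<Rightarrow> real"
  assumes "finite I" "i \<in> I" "j \<in> I" "i \<noteq> j" "integrable M f"
  shows integrable_iid_pair: "integrable (PiM I (\<lambda>_. M)) (\<lambda>x. f (x i) * f (x j))"
    and integral_iid_pair: "(\<integral>x. f (x i) * f (x j) \<partial>PiM I (\<lambda>_. M)) = (expectation f)\<^sup>2"
proof -
  interpret P: product_prob_space "\<lambda>_. M" by (rule product_prob_space_const)
  \<comment> \<open>Factors 1 outside \<open>{i, j}\<close> turn the pair into a product over all of
    \<open>I\<close>, to which the product formula for integrals applies.\<close>
  define g where "g = (\<lambda>l. if l \<in> {i, j} then f else (\<lambda>_. 1))"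
  have g: "integrable M (g l)" for l
    using assms by (auto simp: g_def)
  have eq: "(\<Prod>l\<in>I. g l (x l)) = f (x i) * f (x j)" for x
  proof -
    have "(\<Prod>l\<in>I. g l (x l)) = (\<Prod>l\<in>{i, j}. g l (x l))"
      using assms by (intro prod.mono_neutral_right) (auto simp: g_def)
    then show ?thesis using assms by (simp add: g_def)
  qed
  have eq': "(\<Prod>l\<in>I. expectation (g l)) = expectation f * expectation f"
  proof -
    have "(\<Prod>l\<in>I. expectation (g l)) = (\<Prod>l\<in>{i, j}. expectation (g l))"
      using assms by (intro prod.mono_neutral_right) (auto simp: g_def prob_space)
    then show ?thesis using assms by (simp add: g_def)
  qed
  show "integrable (PiM I (\<lambda>_. M)) (\<lambda>x. f (x i) * f (x j))"
    using P.product_integrable_prod[OF assms(1), of g] g by (simp add: eq)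
  show "(\<integral>x. f (x i) * f (x j) \<partial>PiM I (\<lambda>_. M)) = (expectation f)\<^sup>2"
    using P.product_integral_prod[OF assms(1), of g] g by (simp add: eq eq' power2_eq_square)
qed

lemma
  fixes f :: "'a \<Rightarrow> real"
  assumes I: "finite I" and f: "f \<in> borel_measurable M" "integrable M (\<lambda>x. (f x)\<^sup>2)"
    and zero: "expectation f = 0"
  shows integrable_iid_sum_square: "integrable (PiM I (\<lambda>_. M)) (\<lambda>x. (\<Sum>i\<in>I. f (x i))\<^sup>2)"
    and integral_iid_sum_square:
      "(\<integral>x. (\<Sum>i\<in>I. f (x i))\<^sup>2 \<partial>PiM I (\<lambda>_. M)) = card I * expectation (\<lambda>x. (f x)\<^sup>2)"
proof -
  have fi: "integrable M f"
    using f by (rule square_integrable_imp_integrable)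
  have eq: "(\<Sum>i\<in>I. f (x i))\<^sup>2 = (\<Sum>i\<in>I. \<Sum>j\<in>I. f (x i) * f (x j))" for x
    by (simp add: power2_eq_square sum_product)
  have int: "integrable (PiM I (\<lambda>_. M)) (\<lambda>x. f (x i) * f (x j))" if "i \<in> I" "j \<in> I" for i j
  proof (cases "i = j")
    case True
    then show ?thesis
      using integrable_iid_component[OF that(1) f(2)] by (simp add: power2_eq_square)
  qed (use integrable_iid_pair[OF I that _ fi] in auto)
  have val: "(\<integral>x. f (x i) * f (x j) \<partial>PiM I (\<lambda>_. M)) = (if i = j then expectation (\<lambda>x. (f x)\<^sup>2) else 0)"
    if "i \<in> I" "j \<in> I" for i j
  proof (cases "i = j")
    case True
    then show ?thesis
      using integral_iid_component[OF that(1), of "\<lambda>x. (f x)\<^sup>2"] f by (simp add: power2_eq_square)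
  qed (use integral_iid_pair[OF I that _ fi] zero in auto)
  show "integrable (PiM I (\<lambda>_. M)) (\<lambda>x. (\<Sum>i\<in>I. f (x i))\<^sup>2)"
    unfolding eq by (intro Bochner_Integration.integrable_sum int)
  have "(\<integral>x. (\<Sum>i\<in>I. f (x i))\<^sup>2 \<partial>PiM I (\<lambda>_. M)) =
        (\<Sum>i\<in>I. \<Sum>j\<in>I. (\<integral>x. f (x i) * f (x j) \<partial>PiM I (\<lambda>_. M)))"
    unfolding eq using int
    by (subst Bochner_Integration.integral_sum; (intro Bochner_Integration.integrable_sum)?)
       (auto intro!: sum.cong Bochner_Integration.integral_sum)
  also have "\<dots> = (\<Sum>i\<in>I. \<Sum>j\<in>I. if i = j then expectation (\<lambda>x. (f x)\<^sup>2) else 0)"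
    by (intro sum.cong refl val)
  also have "\<dots> = card I * expectation (\<lambda>x. (f x)\<^sup>2)"
    using I by (simp add: sum.delta)
  finally show "(\<integral>x. (\<Sum>i\<in>I. f (x i))\<^sup>2 \<partial>PiM I (\<lambda>_. M)) = card I * expectation (\<lambda>x. (f x)\<^sup>2)" .
qed

text \<open>The mean minimizes the second moment. With \<open>a\<close> free, integrability is
  checked about a convenient center such as \<mu>, although the deviation is measured from the mean
  of a clipped function.\<close>

lemma centered_second_moment_le:
  fixes f :: "'a \<Rightarrow> real"
  assumes "f \<in> borel_measurable M" "integrable M (\<lambda>x. (f x - a)\<^sup>2)"
  shows "integrable M f" "integrable M (\<lambda>x. (f x - expectation f)\<^sup>2)"
    and "expectation (\<lambda>x. (f x - expectation f)\<^sup>2) \<le> expectation (\<lambda>x. (f x - a)\<^sup>2)"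
proof -
  define g where "g = (\<lambda>x. f x - a)"
  have g: "integrable M g" "integrable M (\<lambda>x. (g x)\<^sup>2)"
    using square_integrable_imp_integrable[of g] assms by (auto simp: g_def)
  have "integrable M (\<lambda>x. g x + a)"
    using g by (intro Bochner_Integration.integrable_add) auto
  then show f: "integrable M f" by (simp add: g_def)
  have eg: "expectation g = expectation f - a"
    unfolding g_def using f by (simp add: prob_space)
  have eq: "(\<lambda>x. (f x - expectation f)\<^sup>2) = (\<lambda>x. (g x - expectation g)\<^sup>2)"
    by (rule ext) (simp add: eg, simp add: g_def)
  show "integrable M (\<lambda>x. (f x - expectation f)\<^sup>2)"
    unfolding eq unfolding power2_diff using g by (intro Bochner_Integration.integrable_add Bochner_Integration.integrable_diff) auto
  have v: "expectation (\<lambda>x. (f x - expectation f)\<^sup>2) = expectation (\<lambda>x. (g x)\<^sup>2) - (expectation f - a)\<^sup>2"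
    unfolding eq using variance_eq[OF g] by (metis eg)
  show "expectation (\<lambda>x. (f x - expectation f)\<^sup>2) \<le> expectation (\<lambda>x. (f x - a)\<^sup>2)"
    using v zero_le_power2[of "expectation f - a"] unfolding g_def by linarith
qed

lemma
  fixes f :: "'a \<Rightarrow> real"
  assumes I: "finite I" and f: "f \<in> borel_measurable M" "integrable M (\<lambda>x. (f x - a)\<^sup>2)"
  shows integrable_iid_sum_deviation:
      "integrable (PiM I (\<lambda>_. M)) (\<lambda>x. ((\<Sum>i\<in>I. f (x i)) - card I * expectation f)\<^sup>2)"
    and iid_sum_variance_le:
      "(\<integral>x. ((\<Sum>i\<in>I. f (x i)) - card I * expectation f)\<^sup>2 \<partial>PiM I (\<lambda>_. M))
        \<le> card I * expectation (\<lambda>x. (f x - a)\<^sup>2)"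
proof -
  note c = centered_second_moment_le[OF f]
  define g where "g = (\<lambda>x. f x - expectation f)"
  have g: "g \<in> borel_measurable M" "integrable M (\<lambda>x. (g x)\<^sup>2)" "expectation g = 0"
    unfolding g_def using f c(1,2) by (auto simp: prob_space)
  have eq: "(\<Sum>i\<in>I. f (x i)) - card I * expectation f = (\<Sum>i\<in>I. g (x i))" for x
    by (simp add: g_def sum_subtractf)
  show "integrable (PiM I (\<lambda>_. M)) (\<lambda>x. ((\<Sum>i\<in>I. f (x i)) - card I * expectation f)\<^sup>2)"
    unfolding eq by (rule integrable_iid_sum_square[OF I g])
  show "(\<integral>x. ((\<Sum>i\<in>I. f (x i)) - card I * expectation f)\<^sup>2 \<partial>PiM I (\<lambda>_. M))
        \<le> card I * expectation (\<lambda>x. (f x - a)\<^sup>2)"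
    unfolding eq integral_iid_sum_square[OF I g] using c(3)
    by (intro mult_left_mono) (auto simp: g_def)
qed

lemma iid_sum_Chebyshev:
  fixes f :: "'a \<Rightarrow> real"
  assumes I: "finite I" and f: "f \<in> borel_measurable M" "integrable M (\<lambda>x. (f x - a)\<^sup>2)" and t: "t > 0"
  shows "measure (PiM I (\<lambda>_. M))
      {x \<in> space (PiM I (\<lambda>_. M)). t \<le> \<bar>(\<Sum>i\<in>I. f (x i)) - card I * expectation f\<bar>}
      \<le> card I * expectation (\<lambda>x. (f x - a)\<^sup>2) / t\<^sup>2" (is "?l \<le> _")
proof -
  let ?u = "\<lambda>x. ((\<Sum>i\<in>I. f (x i)) - card I * expectation f)\<^sup>2"
  interpret P: prob_space "PiM I (\<lambda>_. M)" by (rule prob_space_iid)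
  have "?l = P.prob {x \<in> space (PiM I (\<lambda>_. M)). t\<^sup>2 \<le> ?u x}"
    using t by (intro arg_cong[where f = P.prob])
      (simp add: abs_le_square_iff[of t, symmetric])
  also have "\<dots> \<le> (\<integral>x. ?u x \<partial>PiM I (\<lambda>_. M)) / t\<^sup>2"
    using t by (intro integral_Markov_inequality_measure[where A="{}"] integrable_iid_sum_deviation[OF I f]) auto
  also have "\<dots> \<le> card I * expectation (\<lambda>x. (f x - a)\<^sup>2) / t\<^sup>2"
    by (intro divide_right_mono iid_sum_variance_le[OF I f]) auto
  finally show ?thesis .
qed

text \<open>Taylor expansion with Lagrange remainder; the crude factor
  \<open>exp \<bar>x\<bar>\<close> is affordable because the bound is applied to bounded
  summands.\<close>

lemma exp_le_quadratic:
  fixes x :: real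
  shows "exp x \<le> 1 + x + x\<^sup>2 * exp \<bar>x\<bar>"
proof -
  obtain t where t: "\<bar>t\<bar> \<le> \<bar>x\<bar>" "exp x = (\<Sum>m<2. (x ^ m) / fact m) + (exp t / fact 2) * x ^ 2"
    using Maclaurin_exp_le[of x 2] by blast
  have "exp t / 2 * x\<^sup>2 \<le> exp \<bar>x\<bar> * x\<^sup>2"
  proof (rule mult_right_mono)
    have "exp t \<le> exp \<bar>x\<bar>" using t(1) by simp
    then show "exp t / 2 \<le> exp \<bar>x\<bar>" using exp_gt_zero[of t] by linarith
  qed simp
  then show ?thesis using t(2) by (simp add: numeral_2_eq_2 mult.commute)
qed

text \<open>Bennett-type: the range \<open>b\<close> appears only inside the exponential factor,
  while the quadratic term carries the variance. A Hoeffding bound would put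
  \<open>b\<^sup>2\<close> in place of \<open>v\<close>, far too much for the clipping radius used
  later.\<close>

lemma iid_sum_mgf_le:
  fixes f :: "'a \<Rightarrow> real"
  assumes I: "finite I" and f: "f \<in> borel_measurable M" and zero: "expectation f = 0"
    and b: "\<And>x. x \<in> space M \<Longrightarrow> \<bar>f x\<bar> \<le> b" and v: "expectation (\<lambda>x. (f x)\<^sup>2) \<le> v"
  shows "integrable (PiM I (\<lambda>_. M)) (\<lambda>x. exp (l * (\<Sum>i\<in>I. f (x i))))"
    and "(\<integral>x. exp (l * (\<Sum>i\<in>I. f (x i))) \<partial>PiM I (\<lambda>_. M)) \<le> exp (card I * (v * l\<^sup>2 * exp (\<bar>l\<bar> * b)))"
proof -
  interpret P: product_prob_space "\<lambda>_. M" by (rule product_prob_space_const)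
  have bdd: "integrable M (\<lambda>x. exp (l * f x))"
  proof (rule integrable_const_bound)
    show "AE x in M. norm (exp (l * f x)) \<le> exp (\<bar>l\<bar> * b)"
    proof (rule AE_I2)
      fix x assume "x \<in> space M"
      then have "\<bar>l * f x\<bar> \<le> \<bar>l\<bar> * b"
        by (auto simp: abs_mult intro!: mult_left_mono b)
      then show "norm (exp (l * f x)) \<le> exp (\<bar>l\<bar> * b)" by auto
    qed
  qed (use f in simp)
  have fi: "integrable M f"
    by (rule integrable_const_bound[where B = b]) (use f b in auto)
  have f2: "integrable M (\<lambda>x. (f x)\<^sup>2)"
  proof (rule integrable_const_bound[where B = "b\<^sup>2"])
    show "AE x in M. norm ((f x)\<^sup>2) \<le> b\<^sup>2"
    proof (rule AE_I2)
      fix x assume "x \<in> space M"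
      then show "norm ((f x)\<^sup>2) \<le> b\<^sup>2"
        using power_mono[OF b, of x 2] by simp
    qed
  qed (use f in simp)
  have eq: "exp (l * (\<Sum>i\<in>I. f (x i))) = (\<Prod>i\<in>I. exp (l * f (x i)))" for x
    using I by (simp add: sum_distrib_left exp_sum)
  show "integrable (PiM I (\<lambda>_. M)) (\<lambda>x. exp (l * (\<Sum>i\<in>I. f (x i))))"
    unfolding eq by (rule P.product_integrable_prod[OF I bdd])
  have "expectation (\<lambda>x. exp (l * f x)) \<le> expectation (\<lambda>x. 1 + l * f x + l\<^sup>2 * exp (\<bar>l\<bar> * b) * (f x)\<^sup>2)"
  proof (rule integral_mono)
    fix x assume "x \<in> space M"
    then have "\<bar>l * f x\<bar> \<le> \<bar>l\<bar> * b"
      by (auto simp: abs_mult intro!: mult_left_mono b)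
    then have "(l * f x)\<^sup>2 * exp \<bar>l * f x\<bar> \<le> (l * f x)\<^sup>2 * exp (\<bar>l\<bar> * b)"
      by (intro mult_left_mono) auto
    then show "exp (l * f x) \<le> 1 + l * f x + l\<^sup>2 * exp (\<bar>l\<bar> * b) * (f x)\<^sup>2"
      using exp_le_quadratic[of "l * f x"] by (simp add: power_mult_distrib mult_ac)
  qed (use bdd fi f2 in auto)
  also have "\<dots> = 1 + l\<^sup>2 * exp (\<bar>l\<bar> * b) * expectation (\<lambda>x. (f x)\<^sup>2)"
    using fi f2 zero by (simp add: prob_space)
  also have "\<dots> \<le> 1 + v * l\<^sup>2 * exp (\<bar>l\<bar> * b)"
    using mult_right_mono[OF v, of "l\<^sup>2 * exp (\<bar>l\<bar> * b)"] by (simp add: mult_ac)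
  also have "\<dots> \<le> exp (v * l\<^sup>2 * exp (\<bar>l\<bar> * b))"
    by (rule exp_ge_add_one_self)
  finally have one: "expectation (\<lambda>x. exp (l * f x)) \<le> exp (v * l\<^sup>2 * exp (\<bar>l\<bar> * b))" .
  have "(\<integral>x. exp (l * (\<Sum>i\<in>I. f (x i))) \<partial>PiM I (\<lambda>_. M)) = expectation (\<lambda>x. exp (l * f x)) ^ card I"
    unfolding eq by (subst P.product_integral_prod[OF I bdd]) simp
  also have "\<dots> \<le> exp (v * l\<^sup>2 * exp (\<bar>l\<bar> * b)) ^ card I"
    by (intro power_mono one) simp
  also have "\<dots> = exp (card I * (v * l\<^sup>2 * exp (\<bar>l\<bar> * b)))"
    by (simp add: exp_of_nat_mult)
  finally show "(\<integral>x. exp (l * (\<Sum>i\<in>I. f (x i))) \<partial>PiM I (\<lambda>_. M)) \<le> exp (card I * (v * l\<^sup>2 * exp (\<bar>l\<bar> * b)))" .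
qed

end

section \<open>Mechanisms with finitely many outputs\<close>

text \<open>\<open>p X j\<close> is the probability of the index \<open>j\<close> on input \<open>X\<close>; the real outputs \<open>g j\<close> attached to the
  indices are kept separate, since privacy does not depend on them.\<close>

definition finite_mechanism ::
    "nat \<Rightarrow> nat \<Rightarrow> real \<Rightarrow> 'i set \<Rightarrow> ((nat \<Rightarrow> nat \<Rightarrow> real) \<Rightarrow> 'i \<Rightarrow> real) \<Rightarrow> bool" where
  "finite_mechanism n m \<epsilon> J p \<longleftrightarrow>
     finite J \<and> (\<forall>j\<in>J. (\<lambda>X. p X j) \<in> borel_measurable (dataset_space n m)) \<and>
     (\<forall>X. \<forall>j\<in>J. 0 \<le> p X j) \<and> (\<forall>X. (\<Sum>j\<in>J. p X j) = 1) \<and>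
     (\<forall>X X'. \<forall>j\<in>J. neighboring n m X X' \<longrightarrow> p X j \<le> exp \<epsilon> * p X' j)"

lemma finite_mechanism_mono:
  assumes "finite_mechanism n m \<epsilon> J p" "\<epsilon> \<le> \<epsilon>'"
  shows "finite_mechanism n m \<epsilon>' J p"
proof -
  have "p X j \<le> exp \<epsilon>' * p X' j" if "neighboring n m X X'" "j \<in> J" for X X' j
  proof -
    have "p X j \<le> exp \<epsilon> * p X' j" and "0 \<le> p X' j"
      using assms that by (auto simp: finite_mechanism_def)
    moreover have "exp \<epsilon> * p X' j \<le> exp \<epsilon>' * p X' j"
      using assms(2) \<open>0 \<le> p X' j\<close> by (intro mult_right_mono) auto
    ultimately show ?thesis by linarith
  qed
  then show ?thesis using assms(1) by (simp add: finite_mechanism_def)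
qed

text \<open>Adaptive sequential composition: the second mechanism may depend on the output
  \<open>j\<close> of the first, and both outputs are released. The ratio bounds of the two factors
  multiply.\<close>

lemma finite_mechanism_compose:
  assumes p: "finite_mechanism n m \<epsilon> J p" and r: "\<And>j. j \<in> J \<Longrightarrow> finite_mechanism n m \<epsilon>' T (r j)"
  shows "finite_mechanism n m (\<epsilon> + \<epsilon>') (J \<times> T) (\<lambda>X (j, t). p X j * r j X t)"
\<comment> \<open>Finiteness of \<open>T\<close> is read off from some \<open>r j\<close>. With
  \<open>J\<close> empty there is none, but then the total mass of \<open>p\<close> would be 0
  instead of 1.\<close>
proof (cases "J = {}")
  case True
  then show ?thesis using p by (auto simp: finite_mechanism_def)
next
  case False
  then have T: "finite T" using r by (auto simp: finite_mechanism_def)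
  have s: "(\<Sum>(j, t)\<in>J \<times> T. p X j * r j X t) = 1" for X
  proof -
    have "(\<Sum>(j, t)\<in>J \<times> T. p X j * r j X t) = (\<Sum>j\<in>J. p X j * (\<Sum>t\<in>T. r j X t))"
      by (simp add: sum.cartesian_product sum_distrib_left)
    also have "\<dots> = (\<Sum>j\<in>J. p X j)"
      using r by (intro sum.cong) (auto simp: finite_mechanism_def)
    finally show ?thesis using p by (simp add: finite_mechanism_def)
  qed
  have d: "p X j * r j X t \<le> exp (\<epsilon> + \<epsilon>') * (p X' j * r j X' t)"
    if "neighboring n m X X'" "j \<in> J" "t \<in> T" for X X' j t
  proof -
    have "p X j * r j X t \<le> (exp \<epsilon> * p X' j) * (exp \<epsilon>' * r j X' t)"
      using p r[OF \<open>j \<in> J\<close>] that by (intro mult_mono) (auto simp: finite_mechanism_def)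
    then show ?thesis by (simp add: exp_add mult_ac)
  qed
  show ?thesis
    unfolding finite_mechanism_def
    using p r T s d by (auto simp: finite_mechanism_def intro!: borel_measurable_times)
qed

text \<open>The kernel is the push-forward of the atomic law under \<open>g\<close>. The atomwise
  ratio bound sums over the preimage of any Borel set, so privacy is pure whatever \<open>g\<close>
  does, injective or not.\<close>

lemma finite_mechanism_algorithm:
  fixes g :: "'i \<Rightarrow> real"
  assumes "finite_mechanism n m \<epsilon> J p"
  obtains A where "randomized_algorithm n m A" "person_level_DP n m \<epsilon> 0 A"
    "\<And>X Y. Y \<in> sets borel \<Longrightarrow> measure (A X) Y = (\<Sum>j\<in>J. p X j * indicator Y (g j))"
proof -
  have J: "finite J" and nn: "\<And>X j. j \<in> J \<Longrightarrow> 0 \<le> p X j"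
    and s1: "\<And>X. (\<Sum>j\<in>J. p X j) = 1"
    and meas: "\<And>j. j \<in> J \<Longrightarrow> (\<lambda>X. p X j) \<in> borel_measurable (dataset_space n m)"
    and dp: "\<And>X X' j. j \<in> J \<Longrightarrow> neighboring n m X X' \<Longrightarrow> p X j \<le> exp \<epsilon> * p X' j"
    using assms by (auto simp: finite_mechanism_def)
  define A where "A X = distr (point_measure J (\<lambda>j. ennreal (p X j))) borel g" for X
  have gm: "g \<in> point_measure J f \<rightarrow>\<^sub>M borel" for f :: "'i \<Rightarrow> ennreal"
    by (simp add: measurable_point_measure_eq1 J)
  have em: "emeasure (A X) Y = ennreal (\<Sum>j\<in>J. p X j * indicator Y (g j))" if "Y \<in> sets borel" for X Y
  proof -
    have "emeasure (A X) Y = emeasure (point_measure J (\<lambda>j. ennreal (p X j))) (g -` Y \<inter> J)"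
      unfolding A_def using that by (subst emeasure_distr[OF gm]) (simp_all add: space_point_measure)
    also have "\<dots> = (\<Sum>j\<in>g -` Y \<inter> J. ennreal (p X j))"
      using J by (intro emeasure_point_measure_finite) auto
    also have "\<dots> = (\<Sum>j\<in>J. ennreal (p X j * indicator Y (g j)))"
      using J by (intro sum.mono_neutral_cong_left) (auto simp: indicator_def)
    also have "\<dots> = ennreal (\<Sum>j\<in>J. p X j * indicator Y (g j))"
      using nn by (intro sum_ennreal) auto
    finally show ?thesis .
  qed
  have me: "measure (A X) Y = (\<Sum>j\<in>J. p X j * indicator Y (g j))" if "Y \<in> sets borel" for X Y
    using em[OF that, of X] nn by (simp add: measure_def sum_nonneg)
  have ra: "randomized_algorithm n m A"
    unfolding randomized_algorithm_def
  proof (rule measurable_prob_algebra_generated[where \<Omega>=UNIV and G="sets borel"])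
    show "sets borel = sigma_sets UNIV (sets (borel :: real measure))"
      using sets.sigma_sets_eq[of "borel :: real measure"] by simp
    show "Int_stable (sets (borel :: real measure))" by (rule sets.Int_stable)
    show "prob_space (A X)" for X
      by (rule prob_spaceI) (simp add: A_def em[unfolded A_def] s1)
    show "(\<lambda>X. emeasure (A X) Y) \<in> borel_measurable (dataset_space n m)" if "Y \<in> sets borel" for Y
      unfolding em[OF that] using meas by (intro measurable_compose[OF _ measurable_ennreal]) simp
  qed (auto simp: A_def)
  have "person_level_DP n m \<epsilon> 0 A"
    unfolding person_level_DP_def
  proof (intro allI impI ballI)
    fix X X' and Y :: "real set" assume N: "neighboring n m X X'" and Y: "Y \<in> sets borel"
    have "(\<Sum>j\<in>J. p X j * indicator Y (g j)) \<le> (\<Sum>j\<in>J. exp \<epsilon> * p X' j * indicator Y (g j))"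
      using dp[OF _ N] by (intro sum_mono mult_right_mono) auto
    then show "measure (A X) Y \<le> exp \<epsilon> * measure (A X') Y + 0"
      by (simp add: me[OF Y] sum_distrib_left mult_ac)
  qed
  then show ?thesis using that ra me by blast
qed

section \<open>Accuracy of finite mechanisms on i.i.d. data\<close>

lemma sets_iid_dataset: "sets D = sets borel \<Longrightarrow> sets (iid_dataset n m D) = sets (dataset_space n m)"
  unfolding iid_dataset_def dataset_space_def by (intro sets_PiM_cong refl)

lemma prob_space_iid_dataset: "prob_space D \<Longrightarrow> prob_space (iid_dataset n m D)"
  unfolding iid_dataset_def by (intro prob_space_PiM)

lemma accurate_forI:
  assumes A: "randomized_algorithm n m A" and D: "prob_space D" "sets D = sets borel"
    and f: "f \<in> borel_measurable (dataset_space n m)" "\<And>X. 0 \<le> f X"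
    and le: "\<And>X. f X \<le> measure (A X) {y. \<bar>y - mean D\<bar> \<le> \<alpha>}"
    and int: "1 - \<beta> \<le> (\<integral>X. f X \<partial>iid_dataset n m D)"
  shows "accurate_for n m \<alpha> \<beta> D A"
proof -
  interpret P: prob_space "iid_dataset n m D" by (rule prob_space_iid_dataset[OF D(1)])
  let ?Y = "{y. \<bar>y - mean D\<bar> \<le> \<alpha>}"
  have Y: "?Y \<in> sets borel" by measurable
  have A': "A \<in> iid_dataset n m D \<rightarrow>\<^sub>M prob_algebra borel"
    using A unfolding randomized_algorithm_def
    by (subst measurable_cong_sets[OF sets_iid_dataset[OF D(2)] refl])
  have pr: "prob_space (A X)" if "X \<in> space (iid_dataset n m D)" for X
    using measurable_space[OF A' that] by (simp add: space_prob_algebra)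
  have inp: "iid_dataset n m D \<in> space (prob_algebra (iid_dataset n m D))"
    using P.prob_space_axioms by (simp add: space_prob_algebra)
  have f': "f \<in> borel_measurable (iid_dataset n m D)"
    using f(1) by (subst measurable_cong_sets[OF sets_iid_dataset[OF D(2)] refl])
  have f1: "f X \<le> 1" if "X \<in> space (iid_dataset n m D)" for X
    using le[of X] prob_space.prob_le_1[OF pr[OF that], of ?Y] by linarith
  have fi: "integrable (iid_dataset n m D) f"
    by (rule P.integrable_const_bound[where B=1]) (use f' f1 f(2) in auto)
  have "ennreal (1 - \<beta>) \<le> ennreal (\<integral>X. f X \<partial>iid_dataset n m D)"
    using int by (rule ennreal_leI)
  also have "\<dots> = (\<integral>\<^sup>+X. ennreal (f X) \<partial>iid_dataset n m D)"
    using fi f(2) by (simp add: nn_integral_eq_integral)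
  also have "\<dots> \<le> (\<integral>\<^sup>+X. emeasure (A X) ?Y \<partial>iid_dataset n m D)"
  proof (rule nn_integral_mono)
    fix X assume "X \<in> space (iid_dataset n m D)"
    then interpret AX: prob_space "A X" by (rule pr)
    show "ennreal (f X) \<le> emeasure (A X) ?Y"
      unfolding AX.emeasure_eq_measure using le by (rule ennreal_leI)
  qed
  also have "\<dots> = emeasure (iid_dataset n m D \<bind> A) ?Y"
    by (rule emeasure_bind_prob_algebra[OF inp A' Y, symmetric])
  finally have *: "ennreal (1 - \<beta>) \<le> emeasure (iid_dataset n m D \<bind> A) ?Y" .
  interpret B: prob_space "iid_dataset n m D \<bind> A"
    by (rule prob_space_bind'[OF inp A'])
  show ?thesis
    using * unfolding accurate_for_def B.emeasure_eq_measure by simp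
qed

text \<open>The success probability as a Bochner integral of a finite sum, so that the later
  analysis never meets the monadic bind.\<close>

definition success_prob ::
    "nat \<Rightarrow> nat \<Rightarrow> real measure \<Rightarrow> 'i set \<Rightarrow> ('i \<Rightarrow> real) \<Rightarrow> ((nat \<Rightarrow> nat \<Rightarrow> real) \<Rightarrow> 'i \<Rightarrow> real) \<Rightarrow> real \<Rightarrow> real" where
  "success_prob n m D J g p \<alpha> =
     (\<integral>X. (\<Sum>j\<in>J. p X j * indicator {y. \<bar>y - mean D\<bar> \<le> \<alpha>} (g j)) \<partial>iid_dataset n m D)"

lemma finite_mechanism_accurate:
  fixes g :: "'i \<Rightarrow> real"
  assumes p: "finite_mechanism n m \<epsilon> J p"
    and acc: "\<And>D. bounded_moment_distribution k R D \<Longrightarrow> 1 - \<beta> \<le> success_prob n m D J g p \<alpha>"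
  shows "\<exists>A. randomized_algorithm n m A \<and> person_level_DP n m \<epsilon> 0 A \<and>
           (\<forall>D. bounded_moment_distribution k R D \<longrightarrow> accurate_for n m \<alpha> \<beta> D A)"
proof -
  obtain A where A: "randomized_algorithm n m A" "person_level_DP n m \<epsilon> 0 A"
    "\<And>X Y. Y \<in> sets borel \<Longrightarrow> measure (A X) Y = (\<Sum>j\<in>J. p X j * indicator Y (g j))"
    using finite_mechanism_algorithm[OF p, of g] by blast
  have "accurate_for n m \<alpha> \<beta> D A" if D: "bounded_moment_distribution k R D" for D
  proof (rule accurate_forI[OF A(1)])
    let ?f = "\<lambda>X. (\<Sum>j\<in>J. p X j * indicator {y. \<bar>y - mean D\<bar> \<le> \<alpha>} (g j))"
    show "prob_space D" "sets D = sets borel"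
      using D by (auto simp: bounded_moment_distribution_def)
    show "?f \<in> borel_measurable (dataset_space n m)"
      using p by (intro borel_measurable_sum) (auto simp: finite_mechanism_def)
    show "0 \<le> ?f X" for X
      using p by (intro sum_nonneg) (auto simp: finite_mechanism_def)
    have Y: "{y. \<bar>y - mean D\<bar> \<le> \<alpha>} \<in> sets borel" by measurable
    show "?f X \<le> measure (A X) {y. \<bar>y - mean D\<bar> \<le> \<alpha>}" for X
      by (simp add: A(3)[OF Y])
    show "1 - \<beta> \<le> (\<integral>X. ?f X \<partial>iid_dataset n m D)"
      using acc[OF D] by (simp add: success_prob_def)
  qed
  then show ?thesis using A by blast
qed

lemma finite_mechanism_le_1:
  assumes "finite_mechanism n m \<epsilon> J p" "S \<subseteq> J"
  shows "(\<Sum>j\<in>S. p X j) \<le> 1"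
proof -
  have "(\<Sum>j\<in>S. p X j) \<le> (\<Sum>j\<in>J. p X j)"
    using assms by (intro sum_mono2) (auto simp: finite_mechanism_def)
  then show ?thesis using assms by (simp add: finite_mechanism_def)
qed

lemma integrable_finite_mechanism:
  assumes p: "finite_mechanism n m \<epsilon> J p" and D: "prob_space D" "sets D = sets borel" and S: "S \<subseteq> J"
  shows "integrable (iid_dataset n m D) (\<lambda>X. \<Sum>j\<in>S. p X j)"
proof -
  interpret P: prob_space "iid_dataset n m D" by (rule prob_space_iid_dataset[OF D(1)])
  have "(\<lambda>X. \<Sum>j\<in>S. p X j) \<in> borel_measurable (dataset_space n m)"
    using p S by (intro borel_measurable_sum) (auto simp: finite_mechanism_def)
  then have m: "(\<lambda>X. \<Sum>j\<in>S. p X j) \<in> borel_measurable (iid_dataset n m D)"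
    by (subst measurable_cong_sets[OF sets_iid_dataset[OF D(2)] refl])
  have nn: "0 \<le> (\<Sum>j\<in>S. p X j)" for X
    using p S by (intro sum_nonneg) (auto simp: finite_mechanism_def)
  show ?thesis
    by (rule P.integrable_const_bound[where B=1])
       (use m nn finite_mechanism_le_1[OF p S] in auto)
qed

lemma success_prob_eq:
  assumes "finite J"
  shows "success_prob n m D J g p \<alpha> =
    (\<integral>X. (\<Sum>j\<in>{j \<in> J. \<bar>g j - mean D\<bar> \<le> \<alpha>}. p X j) \<partial>iid_dataset n m D)"
  unfolding success_prob_def using assms
  by (intro Bochner_Integration.integral_cong refl sum.mono_neutral_cong_right) (auto simp: indicator_def)

text \<open>Failure is split into atypical data \<open>B\<close> and unlucky internal randomness
  \<open>c\<close>. Pointwise, the success mass dominates \<open>1 - c - indicator B X\<close>; on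
  \<open>B\<close> this is at most 0 because \<open>c\<close> is nonnegative.\<close>

lemma success_prob_ge:
  assumes p: "finite_mechanism n m \<epsilon> J p" and D: "prob_space D" "sets D = sets borel"
    and B: "B \<in> sets (iid_dataset n m D)" "measure (iid_dataset n m D) B \<le> b"
    and good: "\<And>X. X \<in> space (iid_dataset n m D) \<Longrightarrow> X \<notin> B \<Longrightarrow>
      (\<Sum>j\<in>{j \<in> J. \<alpha> < \<bar>g j - mean D\<bar>}. p X j) \<le> c"
    and c: "0 \<le> c"
  shows "1 - b - c \<le> success_prob n m D J g p \<alpha>"
proof -
  interpret P: prob_space "iid_dataset n m D" by (rule prob_space_iid_dataset[OF D(1)])
  have J: "finite J" using p by (simp add: finite_mechanism_def)
  let ?G = "{j \<in> J. \<bar>g j - mean D\<bar> \<le> \<alpha>}" and ?F = "{j \<in> J. \<alpha> < \<bar>g j - mean D\<bar>}"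
  have split: "(\<Sum>j\<in>?G. p X j) = 1 - (\<Sum>j\<in>?F. p X j)" for X
  proof -
    have "(\<Sum>j\<in>?G \<union> ?F. p X j) = (\<Sum>j\<in>?G. p X j) + (\<Sum>j\<in>?F. p X j)"
      using J by (intro sum.union_disjoint) auto
    moreover have "?G \<union> ?F = J" by auto
    ultimately show ?thesis using p by (simp add: finite_mechanism_def)
  qed
  have "1 - b - c \<le> 1 - c - P.prob B" using B by simp
  also have "\<dots> = (\<integral>X. 1 - c - indicator B X \<partial>iid_dataset n m D)"
    using B(1) by (subst Bochner_Integration.integral_diff)
      (auto simp: P.prob_space integrable_indicator_iff P.emeasure_eq_measure sets.Int_space_eq2)
  also have "\<dots> \<le> (\<integral>X. (\<Sum>j\<in>?G. p X j) \<partial>iid_dataset n m D)"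
  proof (rule integral_mono)
    show "integrable (iid_dataset n m D) (\<lambda>X. 1 - c - indicator B X)"
      using B(1) by (auto simp: integrable_indicator_iff P.emeasure_eq_measure)
    show "integrable (iid_dataset n m D) (\<lambda>X. \<Sum>j\<in>?G. p X j)"
      by (rule integrable_finite_mechanism[OF p D]) auto
    fix X assume X: "X \<in> space (iid_dataset n m D)"
    show "1 - c - indicator B X \<le> (\<Sum>j\<in>?G. p X j)"
    proof (cases "X \<in> B")
      case True
      have "0 \<le> (\<Sum>j\<in>?G. p X j)" using p by (intro sum_nonneg) (auto simp: finite_mechanism_def)
      then show ?thesis using True c by simp
    next
      case False
      then show ?thesis using good[OF X] split[of X] by simp
    qed
  qed
  finally show ?thesis by (simp add: success_prob_eq[OF J])
qed

text \<open>The offsets are the midpoints of \<open>N\<close> equal cells of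
  \<open>[-a', a']\<close>, each of half-length \<open>a' / N\<close>, which is at most
  \<open>a\<close>.\<close>

lemma offset_grid_covers:
  fixes a' a d :: real
  assumes N: "N \<ge> 1" "a' \<le> real N * a" and d: "\<bar>d\<bar> \<le> a'"
  shows "\<exists>t<N. \<bar>d - (- a' + (2 * real t + 1) * a' / real N)\<bar> \<le> a"
proof (cases "a' = 0")
  case True
  then have "0 \<le> a" using N by (simp add: zero_le_mult_iff)
  then show ?thesis using True d N by (intro exI[of _ 0]) auto
next
  case False
  then have a': "a' > 0" using d by linarith
  define u where "u = (d + a') * real N / (2 * a')"
  have u: "0 \<le> u" "u \<le> N"
    using d a' N by (auto simp: u_def divide_simps mult_ac intro!: mult_left_mono)
  \<comment> \<open>The minimum only acts at the right endpoint \<open>d = a'\<close>, where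
    \<open>u = N\<close> and the floor would name a cell that does not exist.\<close>
  define t where "t = min (nat \<lfloor>u\<rfloor>) (N - 1)"
  have fl: "real (nat \<lfloor>u\<rfloor>) \<le> u" "u < real (nat \<lfloor>u\<rfloor>) + 1"
    using u(1) by linarith+
  have tN: "t < N" using N by (auto simp: t_def)
  have t: "real t \<le> u" "u \<le> real t + 1"
  proof -
    show "real t \<le> u" using fl by (auto simp: t_def min_def)
    show "u \<le> real t + 1"
      using fl u N by (auto simp: t_def min_def of_nat_diff)
  qed
  have d_eq: "d = 2 * a' * u / N - a'"
    using a' N by (simp add: u_def field_simps)
  have "d - (- a' + (2 * real t + 1) * a' / real N) = (a' / N) * (2 * (u - t) - 1)"
    using N unfolding d_eq by (simp add: field_simps)
  then have "\<bar>d - (- a' + (2 * real t + 1) * a' / real N)\<bar> = (a' / N) * \<bar>2 * (u - t) - 1\<bar>"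
    using a' by (simp add: abs_mult)
  also have "\<dots> \<le> (a' / N) * 1"
    using a' t by (intro mult_left_mono) auto
  also have "\<dots> \<le> a" using N by (simp add: field_simps)
  finally show ?thesis using tN by blast
qed

text \<open>Guessing one of \<open>N\<close> offsets improves the accuracy by a factor \<open>N\<close> and costs a factor \<open>N\<close>
  in the success probability, which is affordable when \<open>\<beta>\<close> is close to \<open>1\<close>.\<close>

lemma finite_mechanism_guess_offset:
  fixes g :: "'i \<Rightarrow> real"
  assumes p: "finite_mechanism n m \<epsilon> J p" and N: "N \<ge> 1" "\<alpha>' \<le> real N * \<alpha>"
  defines "g' \<equiv> \<lambda>(j, t). g j + (- \<alpha>' + (2 * real t + 1) * \<alpha>' / real N)"
    and "p' \<equiv> \<lambda>X (j, t). p X j * (1 / real N)"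
  shows "finite_mechanism n m \<epsilon> (J \<times> {..<N}) p'"
    and "prob_space D \<Longrightarrow> sets D = sets borel \<Longrightarrow>
      success_prob n m D J g p \<alpha>' / N \<le> success_prob n m D (J \<times> {..<N}) g' p' \<alpha>"
proof -
  have u: "finite_mechanism n m 0 {..<N} (\<lambda>X t. 1 / real N)"
    using N by (auto simp: finite_mechanism_def)
  show p': "finite_mechanism n m \<epsilon> (J \<times> {..<N}) p'"
    unfolding p'_def using finite_mechanism_compose[OF p u] by simp
  assume D: "prob_space D" "sets D = sets borel"
  have J: "finite J" using p by (simp add: finite_mechanism_def)
  let ?G = "{j \<in> J. \<bar>g j - mean D\<bar> \<le> \<alpha>'}"
  let ?G' = "{x \<in> J \<times> {..<N}. \<bar>g' x - mean D\<bar> \<le> \<alpha>}"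
  have "\<forall>j\<in>?G. \<exists>t<N. \<bar>g' (j, t) - mean D\<bar> \<le> \<alpha>"
  proof
    fix j assume j: "j \<in> ?G"
    then have "\<bar>mean D - g j\<bar> \<le> \<alpha>'" by (simp add: abs_minus_commute)
    from offset_grid_covers[OF N this] show "\<exists>t<N. \<bar>g' (j, t) - mean D\<bar> \<le> \<alpha>"
      by (auto simp: g'_def abs_minus_commute algebra_simps)
  qed
  then obtain t where t: "\<And>j. j \<in> ?G \<Longrightarrow> t j < N \<and> \<bar>g' (j, t j) - mean D\<bar> \<le> \<alpha>"
    by metis
  have le: "(\<Sum>j\<in>?G. p X j) / N \<le> (\<Sum>x\<in>?G'. p' X x)" for X
  proof -
    have inj: "inj_on (\<lambda>j. (j, t j)) ?G" by (auto simp: inj_on_def)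
    have "(\<Sum>j\<in>?G. p X j) / N = (\<Sum>x\<in>(\<lambda>j. (j, t j)) ` ?G. p' X x)"
      by (subst sum.reindex[OF inj]) (simp add: p'_def sum_divide_distrib)
    also have "\<dots> \<le> (\<Sum>x\<in>?G'. p' X x)"
      using J t p by (intro sum_mono2) (auto simp: p'_def finite_mechanism_def)
    finally show ?thesis .
  qed
  have "(\<integral>X. (\<Sum>j\<in>?G. p X j) \<partial>iid_dataset n m D) / N = (\<integral>X. (\<Sum>j\<in>?G. p X j) / N \<partial>iid_dataset n m D)"
    by simp
  also have "\<dots> \<le> (\<integral>X. (\<Sum>x\<in>?G'. p' X x) \<partial>iid_dataset n m D)"
    using le by (intro integral_mono integrable_finite_mechanism[OF p' D]
        integrable_divide_zero integrable_finite_mechanism[OF p D]) auto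
  finally show "success_prob n m D J g p \<alpha>' / N \<le> success_prob n m D (J \<times> {..<N}) g' p' \<alpha>"
    using J by (simp add: success_prob_eq)
qed

text \<open>The output law of the exponential mechanism, with the privacy parameter already folded
  into the score \<open>q\<close>.\<close>

definition softmax :: "'i set \<Rightarrow> ('i \<Rightarrow> real) \<Rightarrow> 'i \<Rightarrow> real" where
  "softmax J q j = exp (q j) / (\<Sum>i\<in>J. exp (q i))"

text \<open>The factor 2 arises because the numerator and the normalizing sum can each change by a
  factor \<open>exp \<eta>\<close>, in opposite directions.\<close>

lemma softmax_mechanism:
  assumes J: "finite J" "J \<noteq> {}"
    and q: "\<And>j. j \<in> J \<Longrightarrow> (\<lambda>X. q X j) \<in> borel_measurable (dataset_space n m)"
    and s: "\<And>X X' j. neighboring n m X X' \<Longrightarrow> j \<in> J \<Longrightarrow> \<bar>q X j - q X' j\<bar> \<le> \<eta>"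
  shows "finite_mechanism n m (2 * \<eta>) J (\<lambda>X. softmax J (q X))"
proof -
  have W: "(\<Sum>i\<in>J. exp (q X i)) > 0" for X
    using J by (intro sum_pos) auto
  have "softmax J (q X) j \<le> exp (2 * \<eta>) * softmax J (q X') j"
    if N: "neighboring n m X X'" and j: "j \<in> J" for X X' j
  proof -
    have e: "exp (q X i) \<le> exp \<eta> * exp (q X' i)" "exp (q X' i) \<le> exp \<eta> * exp (q X i)" if "i \<in> J" for i
      using s[OF N that] by (auto simp: exp_add[symmetric])
    have "(\<Sum>i\<in>J. exp (q X' i)) \<le> exp \<eta> * (\<Sum>i\<in>J. exp (q X i))"
      unfolding sum_distrib_left by (intro sum_mono e)
    then have "exp (q X j) * (\<Sum>i\<in>J. exp (q X' i)) \<le> (exp \<eta> * exp (q X' j)) * (exp \<eta> * (\<Sum>i\<in>J. exp (q X i)))"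
      using W[of X'] by (intro mult_mono e j) auto
    also have "\<dots> = (exp \<eta> * exp \<eta>) * exp (q X' j) * (\<Sum>i\<in>J. exp (q X i))"
      by (simp only: mult_ac)
    also have "exp \<eta> * exp \<eta> = exp (2 * \<eta>)"
      unfolding exp_add[symmetric] by simp
    finally show ?thesis
      using W[of X] W[of X'] by (simp add: softmax_def divide_simps mult_ac)
  qed
  moreover have "(\<Sum>j\<in>J. softmax J (q X) j) = 1" for X
    using W[of X] by (simp add: softmax_def sum_divide_distrib[symmetric])
  moreover have "(\<lambda>X. softmax J (q X) j) \<in> borel_measurable (dataset_space n m)" if "j \<in> J" for j
    unfolding softmax_def using q that by (intro borel_measurable_divide borel_measurable_sum measurable_compose[OF _ borel_measurable_exp]) auto
  ultimately show ?thesis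
    using J W by (auto simp: finite_mechanism_def softmax_def less_imp_le)
qed

lemma neighboring_sum_le:
  fixes f :: "(nat \<Rightarrow> real) \<Rightarrow> real"
  assumes N: "neighboring n m X X'" and f: "\<And>x y. \<bar>f x - f y\<bar> \<le> b"
  shows "\<bar>(\<Sum>i<n. f (X i)) - (\<Sum>i<n. f (X' i))\<bar> \<le> b"
proof -
  have b: "0 \<le> b" using f[of undefined undefined] by simp
  let ?S = "{i\<in>{..<n}. X i \<noteq> X' i}"
  have "(\<Sum>i<n. f (X i)) - (\<Sum>i<n. f (X' i)) = (\<Sum>i<n. f (X i) - f (X' i))"
    by (simp add: sum_subtractf)
  also have "\<dots> = (\<Sum>i\<in>?S. f (X i) - f (X' i))"
    by (intro sum.mono_neutral_right) auto
  finally have "\<bar>(\<Sum>i<n. f (X i)) - (\<Sum>i<n. f (X' i))\<bar> \<le> (\<Sum>i\<in>?S. \<bar>f (X i) - f (X' i)\<bar>)"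
    by (simp add: sum_abs)
  also have "\<dots> \<le> of_nat (card ?S) * b"
    by (intro sum_bounded_above f)
  also have "\<dots> \<le> 1 * b"
    using N b by (intro mult_right_mono) (auto simp: neighboring_def)
  finally show ?thesis by simp
qed

section \<open>The coarse stage\<close>

text \<open>Keeping a single competitor \<open>i\<close> in the normalizing sum is enough: a bad
  output is compared with one known good output.\<close>

lemma softmax_le:
  assumes "finite J" "i \<in> J"
  shows "softmax J q j \<le> exp (q j - q i)"
proof -
  have "exp (q i) \<le> (\<Sum>i\<in>J. exp (q i))"
    using assms by (intro member_le_sum) auto
  then have "softmax J q j \<le> exp (q j) / exp (q i)"
    unfolding softmax_def by (intro divide_left_mono mult_pos_pos)
      (auto intro: less_le_trans[OF exp_gt_zero[of "q i"]])
  then show ?thesis by (simp add: exp_diff)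
qed

definition sample_avg :: "nat \<Rightarrow> (real \<Rightarrow> real) \<Rightarrow> (nat \<Rightarrow> real) \<Rightarrow> real" where
  "sample_avg m f x = (\<Sum>j<m. f (x j)) / real m"

lemma measurable_sample_avg:
  "f \<in> borel_measurable borel \<Longrightarrow> sample_avg m f \<in> borel_measurable (PiM {..<m} (\<lambda>_. borel))"
  unfolding sample_avg_def
  by (intro borel_measurable_divide borel_measurable_sum measurable_const
      measurable_compose[OF measurable_component_singleton]) auto

lemma measurable_person:
  assumes "f \<in> borel_measurable (PiM {..<m} (\<lambda>_. borel))" "i < n"
  shows "(\<lambda>X. f (X i)) \<in> borel_measurable (dataset_space n m)"
  unfolding dataset_space_def
  using measurable_compose[OF measurable_component_singleton[of i "{..<n}" "\<lambda>_. PiM {..<m} (\<lambda>_. borel)"] assms(1)]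
    assms(2) by simp

lemma measurable_person_sum:
  fixes f :: "(nat \<Rightarrow> real) \<Rightarrow> real"
  assumes "f \<in> borel_measurable (PiM {..<m} (\<lambda>_. borel))"
  shows "(\<lambda>X. \<Sum>i<n. f (X i)) \<in> borel_measurable (dataset_space n m)"
  by (intro borel_measurable_sum measurable_person[OF assms]) auto

definition coarse_grid :: "real \<Rightarrow> real \<Rightarrow> int set" where
  "coarse_grid R r = {- \<lceil>R / r\<rceil>..\<lceil>R / r\<rceil>}"

text \<open>One person's vote. With window \<open>2 * r\<close>, a person whose mean is within
  \<open>r\<close> of \<mu> supports every grid point within \<open>r\<close> of \<mu> and none
  farther than \<open>3 * r\<close> from it. The weight \<open>\<epsilon> / 4\<close> is the
  sensitivity and spends half of the privacy budget.\<close>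

definition coarse_score :: "real \<Rightarrow> real \<Rightarrow> (nat \<Rightarrow> real) \<Rightarrow> int \<Rightarrow> nat \<Rightarrow> real" where
  "coarse_score \<epsilon> r x j m = \<epsilon> / 4 * (if \<bar>sample_avg m (\<lambda>x. x) x - j * r\<bar> \<le> 2 * r then 1 else 0)"

definition coarse_prob ::
    "nat \<Rightarrow> nat \<Rightarrow> real \<Rightarrow> real \<Rightarrow> real \<Rightarrow> (nat \<Rightarrow> nat \<Rightarrow> real) \<Rightarrow> int \<Rightarrow> real" where
  "coarse_prob n m \<epsilon> R r X = softmax (coarse_grid R r) (\<lambda>j. \<Sum>i<n. coarse_score \<epsilon> r (X i) j m)"

lemma coarse_grid_ne: "0 < R \<Longrightarrow> 0 < r \<Longrightarrow> coarse_grid R r \<noteq> {}"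
proof -
  assume "0 < R" "0 < r"
  then have "0 \<le> \<lceil>R / r\<rceil>" by (simp add: ceiling_le_iff zero_le_ceiling order.strict_trans2[of _ 0])
  then show ?thesis by (auto simp: coarse_grid_def)
qed

lemma card_coarse_grid:
  assumes "0 < R" "0 < r"
  shows "card (coarse_grid R r) \<le> 2 * (R / r) + 3"
proof -
  have "0 \<le> R / r" using assms by simp
  then have "0 \<le> \<lceil>R / r\<rceil>" by linarith
  then have "real (nat (2 * \<lceil>R / r\<rceil> + 1)) = 2 * real_of_int \<lceil>R / r\<rceil> + 1" by simp
  also have "\<dots> \<le> 2 * (R / r + 1) + 1" by (intro add_right_mono mult_left_mono of_int_ceiling_le_add_one) simp
  finally have "real (nat (2 * \<lceil>R / r\<rceil> + 1)) \<le> 2 * (R / r + 1) + 1" .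
  then show ?thesis by (simp add: coarse_grid_def algebra_simps)
qed

lemma coarse_grid_covers:
  assumes "0 < r" "\<bar>\<mu>\<bar> \<le> R"
  shows "\<exists>j\<in>coarse_grid R r. \<bar>j * r - \<mu>\<bar> \<le> r"
proof
  let ?j = "\<lfloor>\<mu> / r\<rfloor>"
  have "- (R / r) \<le> \<mu> / r" "\<mu> / r \<le> R / r"
    using assms by (auto simp: divide_simps)
  then show "?j \<in> coarse_grid R r"
    unfolding coarse_grid_def by (auto intro: order_trans[OF floor_mono floor_le_ceiling] simp: ceiling_def; linarith)
  have "?j * r \<le> \<mu>" "\<mu> < (?j + 1) * r"
    using assms floor_divide_lower[of r \<mu>] floor_divide_upper[of r \<mu>] by (auto simp: mult_ac)
  then show "\<bar>?j * r - \<mu>\<bar> \<le> r" by (simp add: algebra_simps)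
qed

lemma finite_mechanism_coarse:
  assumes "0 < R" "0 < r" "0 < \<epsilon>"
  shows "finite_mechanism n m (\<epsilon> / 2) (coarse_grid R r) (coarse_prob n m \<epsilon> R r)"
proof -
  have "finite_mechanism n m (2 * (\<epsilon> / 4)) (coarse_grid R r)
      (\<lambda>X. softmax (coarse_grid R r) (\<lambda>j. \<Sum>i<n. coarse_score \<epsilon> r (X i) j m))"
  proof (rule softmax_mechanism)
    show "finite (coarse_grid R r)" by (simp add: coarse_grid_def)
    show "coarse_grid R r \<noteq> {}" using assms by (intro coarse_grid_ne)
    have [measurable]: "sample_avg m (\<lambda>x. x) \<in> borel_measurable (PiM {..<m} (\<lambda>_. borel))"
      by (rule measurable_sample_avg) simp
    show "(\<lambda>X. \<Sum>i<n. coarse_score \<epsilon> r (X i) j m) \<in> borel_measurable (dataset_space n m)" for j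
      by (rule measurable_person_sum) (simp add: coarse_score_def)
    show "\<bar>(\<Sum>i<n. coarse_score \<epsilon> r (X i) j m) - (\<Sum>i<n. coarse_score \<epsilon> r (X' i) j m)\<bar> \<le> \<epsilon> / 4"
      if "neighboring n m X X'" for X X' j
      using that by (rule neighboring_sum_le) (use assms in \<open>auto simp: coarse_score_def\<close>)
  qed
  then show ?thesis by (simp add: coarse_prob_def[abs_def])
qed

section \<open>Moments of one sample and of one person's average\<close>

locale bounded_moment =
  fixes k R :: real and D :: "real measure"
  assumes k: "2 \<le> k" and bounded_moment: "bounded_moment_distribution k R D"
begin

abbreviation \<mu> where "\<mu> \<equiv> mean D"

sublocale prob_space D
  using bounded_moment by (simp add: bounded_moment_distribution_def)

lemma sets_D [measurable_cong]: "sets D = sets borel"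
  using bounded_moment by (simp add: bounded_moment_distribution_def)

lemma space_D [simp]: "space D = UNIV"
  using sets_eq_imp_space_eq[OF sets_D] by simp

lemma prob_UNIV [simp]: "prob UNIV = 1"
  using prob_space by simp

lemma abs_mean_le: "\<bar>\<mu>\<bar> \<le> R"
  using bounded_moment by (auto simp: bounded_moment_distribution_def)

lemma
  shows integrable_id: "integrable D (\<lambda>x. x)"
    and integrable_moment: "integrable D (\<lambda>x. \<bar>x - \<mu>\<bar> powr k)"
    and moment_le: "expectation (\<lambda>x. \<bar>x - \<mu>\<bar> powr k) \<le> 1"
  using bounded_moment by (auto simp: bounded_moment_distribution_def)

lemma power2_le_moment: "(x - \<mu>)\<^sup>2 \<le> 1 + \<bar>x - \<mu>\<bar> powr k"
proof (cases "\<bar>x - \<mu>\<bar> \<le> 1")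
  case True
  then have "(x - \<mu>)\<^sup>2 \<le> 1" by (simp add: abs_square_le_1)
  then show ?thesis using powr_ge_zero[of "\<bar>x - \<mu>\<bar>" k] by linarith
next
  case False
  then have "(x - \<mu>)\<^sup>2 = \<bar>x - \<mu>\<bar> powr 2" by (subst powr_numeral) auto
  also have "\<dots> \<le> \<bar>x - \<mu>\<bar> powr k" using False k by (intro powr_mono) auto
  finally show ?thesis by simp
qed

text \<open>One statement serves both the identity and clipping to an interval that contains \<mu>:
  each moves no point away from \<mu>, so the variance bound 2 survives. It comes from
  \<open>k \<ge> 2\<close> via \<open>power2_le_moment\<close>.\<close>

lemma
  assumes f: "f \<in> borel_measurable borel" and le: "\<And>x. \<bar>f x - \<mu>\<bar> \<le> \<bar>x - \<mu>\<bar>"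
  shows integrable_contraction: "integrable D (\<lambda>x. (f x - \<mu>)\<^sup>2)"
    and second_moment_contraction: "expectation (\<lambda>x. (f x - \<mu>)\<^sup>2) \<le> 2"
proof -
  have b: "(f x - \<mu>)\<^sup>2 \<le> 1 + \<bar>x - \<mu>\<bar> powr k" for x
  proof -
    have "(f x - \<mu>)\<^sup>2 \<le> (x - \<mu>)\<^sup>2" using le[of x] by (simp only: abs_le_square_iff)
    then show ?thesis using power2_le_moment[of x] by linarith
  qed
  have i: "integrable D (\<lambda>x. 1 + \<bar>x - \<mu>\<bar> powr k)"
    using integrable_moment by simp
  show *: "integrable D (\<lambda>x. (f x - \<mu>)\<^sup>2)"
    by (rule Bochner_Integration.integrable_bound[OF i]) (use f b in \<open>auto intro!: AE_I2\<close>)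
  have "expectation (\<lambda>x. (f x - \<mu>)\<^sup>2) \<le> expectation (\<lambda>x. 1 + \<bar>x - \<mu>\<bar> powr k)"
    by (intro integral_mono * i b)
  also have "\<dots> \<le> 2" using integrable_moment moment_le by (simp add: prob_space)
  finally show "expectation (\<lambda>x. (f x - \<mu>)\<^sup>2) \<le> 2" .
qed

abbreviation person :: "nat \<Rightarrow> (nat \<Rightarrow> real) measure" where
  "person m \<equiv> PiM {..<m} (\<lambda>_. D)"

lemma sets_person: "sets (person m) = sets (PiM {..<m} (\<lambda>_. borel))"
  by (intro sets_PiM_cong refl sets_D)

lemma measurable_person_iff:
  "f \<in> borel_measurable (person m) \<longleftrightarrow> f \<in> borel_measurable (PiM {..<m} (\<lambda>_. borel))"
  by (rule measurable_cong_sets[THEN eqset_imp_iff, OF sets_person refl])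

lemma
  assumes f: "f \<in> borel_measurable borel" and le: "\<And>x. \<bar>f x - \<mu>\<bar> \<le> \<bar>x - \<mu>\<bar>" and m: "m \<ge> 1"
  shows integrable_sample_avg: "integrable (person m) (\<lambda>x. (sample_avg m f x - expectation f)\<^sup>2)"
    and variance_sample_avg: "(\<integral>x. (sample_avg m f x - expectation f)\<^sup>2 \<partial>person m) \<le> 2 / m"
proof -
  have f': "f \<in> borel_measurable D" using f by simp
  note i = integrable_contraction[OF f le]
  have eq: "(sample_avg m f x - expectation f)\<^sup>2
      = ((\<Sum>j<m. f (x j)) - card {..<m} * expectation f)\<^sup>2 / (real m)\<^sup>2" for x
    using m by (simp add: sample_avg_def power_divide[symmetric] diff_divide_distrib)
  show "integrable (person m) (\<lambda>x. (sample_avg m f x - expectation f)\<^sup>2)"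
    unfolding eq by (intro integrable_divide_zero integrable_iid_sum_deviation[OF _ f' i] finite_lessThan)
  have "(\<integral>x. (sample_avg m f x - expectation f)\<^sup>2 \<partial>person m)
      \<le> (card {..<m} * expectation (\<lambda>x. (f x - \<mu>)\<^sup>2)) / (real m)\<^sup>2"
    unfolding eq by (subst integral_divide_zero, intro divide_right_mono iid_sum_variance_le[OF _ f' i]) auto
  also have "\<dots> \<le> (real (card {..<m}) * 2) / (real m)\<^sup>2"
    using second_moment_contraction[OF f le] by (intro divide_right_mono mult_left_mono) auto
  also have "\<dots> = 2 / m" using m by (simp add: power2_eq_square)
  finally show "(\<integral>x. (sample_avg m f x - expectation f)\<^sup>2 \<partial>person m) \<le> 2 / m" .
qed

lemma iid_dataset_eq: "iid_dataset n m D = PiM {..<n} (\<lambda>_. person m)"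
  by (simp add: iid_dataset_def)

lemma person_sum_Chebyshev:
  fixes f :: "(nat \<Rightarrow> real) \<Rightarrow> real"
  assumes f: "f \<in> borel_measurable (PiM {..<m} (\<lambda>_. borel))" "integrable (person m) (\<lambda>x. (f x - a)\<^sup>2)"
    and v: "(\<integral>x. (f x - a)\<^sup>2 \<partial>person m) \<le> v" and t: "t > 0" and n: "n \<ge> 1"
  defines "B \<equiv> {X \<in> space (iid_dataset n m D). n * t \<le> \<bar>(\<Sum>i<n. f (X i)) - n * (\<integral>x. f x \<partial>person m)\<bar>}"
  shows "B \<in> sets (iid_dataset n m D)" and "measure (iid_dataset n m D) B \<le> v / (n * t\<^sup>2)"
proof -
  interpret Q: prob_space "person m" by (rule prob_space_iid)
  have "(\<lambda>X. \<Sum>i<n. f (X i)) \<in> borel_measurable (iid_dataset n m D)"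
    using measurable_person_sum[OF f(1)]
    by (subst measurable_cong_sets[OF sets_iid_dataset[OF sets_D] refl])
  then show "B \<in> sets (iid_dataset n m D)"
    unfolding B_def by measurable
  have f': "f \<in> borel_measurable (person m)" using f(1) by (simp add: measurable_person_iff)
  have "measure (iid_dataset n m D) B \<le> card {..<n} * (\<integral>x. (f x - a)\<^sup>2 \<partial>person m) / (n * t)\<^sup>2"
    using Q.iid_sum_Chebyshev[OF finite_lessThan f' f(2), of "n * t" n] n t
    by (simp add: B_def iid_dataset_eq)
  also have "\<dots> \<le> card {..<n} * v / (n * t)\<^sup>2"
    using v by (intro divide_right_mono mult_left_mono) auto
  also have "\<dots> = v / (n * t\<^sup>2)"
    using n by (simp add: power2_eq_square)
  finally show "measure (iid_dataset n m D) B \<le> v / (n * t\<^sup>2)" .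
qed

lemma expectation_id: "expectation (\<lambda>x. x) = \<mu>"
  by (simp add: mean_def)

lemma sample_avg_tail:
  assumes m: "m \<ge> 1" and r: "r > 0"
  shows "measure (person m) {x \<in> space (person m). r < \<bar>sample_avg m (\<lambda>x. x) x - \<mu>\<bar>} \<le> 2 / (m * r\<^sup>2)"
proof -
  interpret Q: prob_space "person m" by (rule prob_space_iid)
  let ?u = "\<lambda>x. (sample_avg m (\<lambda>x. x) x - \<mu>)\<^sup>2"
  have i: "integrable (person m) ?u"
    using integrable_sample_avg[of "\<lambda>x. x" m] m by (simp add: expectation_id)
  have v: "(\<integral>x. ?u x \<partial>person m) \<le> 2 / m"
    using variance_sample_avg[of "\<lambda>x. x" m] m by (simp add: expectation_id)
  have "Q.prob {x \<in> space (person m). r < \<bar>sample_avg m (\<lambda>x. x) x - \<mu>\<bar>}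
      \<le> Q.prob {x \<in> space (person m). r\<^sup>2 \<le> ?u x}"
  proof (rule Q.finite_measure_mono)
    show "{x \<in> space (person m). r < \<bar>sample_avg m (\<lambda>x. x) x - \<mu>\<bar>}
        \<subseteq> {x \<in> space (person m). r\<^sup>2 \<le> ?u x}"
      using r by (auto simp: abs_le_square_iff[symmetric])
    have "?u \<in> borel_measurable (person m)" using i by simp
    then show "{x \<in> space (person m). r\<^sup>2 \<le> ?u x} \<in> Q.events" by measurable
  qed
  also have "\<dots> \<le> (\<integral>x. ?u x \<partial>person m) / r\<^sup>2"
    using r by (intro integral_Markov_inequality_measure[where A="{}"] i) auto
  also have "\<dots> \<le> (2 / m) / r\<^sup>2" by (intro divide_right_mono v) simp
  finally show ?thesis by simp
qed

text \<open>Let \<open>f\<close> mark people whose mean is off by more than \<open>r\<close>. The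
  expected marked fraction is at most 1/8, so outside \<open>B\<close> at most \<open>n / 4\<close>
  people are marked; then a near point \<open>j0\<close> beats every far one by
  \<open>\<epsilon> * n / 8\<close> in score. The second moment of the 0/1 function \<open>f\<close>
  equals its mean, at most \<open>2 / (m * r\<^sup>2)\<close>, which puts
  \<open>m * r\<^sup>2\<close> into the bound for \<open>B\<close>, as the variance term of the rate
  demands.\<close>

lemma coarse_accuracy:
  assumes m: "m \<ge> 1" and r: "r > 0" "16 \<le> m * r\<^sup>2" and \<epsilon>: "\<epsilon> > 0" and n: "n \<ge> 1"
  shows "\<exists>B\<in>sets (iid_dataset n m D). measure (iid_dataset n m D) B \<le> 128 / (real n * real m * r\<^sup>2) \<and>
    (\<forall>X\<in>space (iid_dataset n m D) - B.
      (\<Sum>j\<in>{j \<in> coarse_grid R r. 3 * r < \<bar>j * r - \<mu>\<bar>}. coarse_prob n m \<epsilon> R r X j)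
        \<le> card (coarse_grid R r) * exp (- (\<epsilon> * n / 8)))"
proof -
  interpret Q: prob_space "person m" by (rule prob_space_iid)
  let ?Y = "sample_avg m (\<lambda>x. x)"
  define f where "f x = (if r < \<bar>?Y x - \<mu>\<bar> then 1 else 0 :: real)" for x
  have Y[measurable]: "?Y \<in> borel_measurable (PiM {..<m} (\<lambda>_. borel))"
    by (rule measurable_sample_avg) simp
  then have Y'[measurable]: "?Y \<in> borel_measurable (person m)" by (simp add: measurable_person_iff)
  have fm: "f \<in> borel_measurable (PiM {..<m} (\<lambda>_. borel))"
    unfolding f_def by measurable
  have f_ind: "f x = indicator {x \<in> space (person m). r < \<bar>?Y x - \<mu>\<bar>} x" if "x \<in> space (person m)" for x
    using that by (simp add: f_def)
  have ev: "{x \<in> space (person m). r < \<bar>?Y x - \<mu>\<bar>} \<in> Q.events" by measurable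
  have Ef: "(\<integral>x. f x \<partial>person m) = Q.prob {x \<in> space (person m). r < \<bar>?Y x - \<mu>\<bar>}"
    using ev by (subst Bochner_Integration.integral_cong[OF refl f_ind]) auto
  have f2: "(f x - 0)\<^sup>2 = f x" for x by (simp add: f_def)
  have fi: "integrable (person m) (\<lambda>x. (f x - 0)\<^sup>2)"
    unfolding f2 by (rule Q.integrable_const_bound[where B=1])
      (use fm in \<open>auto simp: f_def[abs_def] measurable_person_iff\<close>)
  have v: "(\<integral>x. (f x - 0)\<^sup>2 \<partial>person m) \<le> 2 / (m * r\<^sup>2)"
    unfolding f2 Ef by (rule sample_avg_tail[OF m r(1)])
  define B where "B = {X \<in> space (iid_dataset n m D).
    n * (1 / 8) \<le> \<bar>(\<Sum>i<n. f (X i)) - n * (\<integral>x. f x \<partial>person m)\<bar>}"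
  have "B \<in> sets (iid_dataset n m D)" "measure (iid_dataset n m D) B \<le> (2 / (m * r\<^sup>2)) / (n * (1 / 8)\<^sup>2)"
    unfolding B_def by (rule person_sum_Chebyshev[OF fm fi v _ n]; simp)+
  then have B: "B \<in> sets (iid_dataset n m D)" "measure (iid_dataset n m D) B \<le> 128 / (real n * real m * r\<^sup>2)"
    by (simp_all add: power2_eq_square mult_ac)
  obtain j0 where j0: "j0 \<in> coarse_grid R r" "\<bar>j0 * r - \<mu>\<bar> \<le> r"
    using coarse_grid_covers[OF r(1) abs_mean_le] by blast
  have fin: "finite (coarse_grid R r)" by (simp add: coarse_grid_def)
  have good: "(\<Sum>j\<in>{j \<in> coarse_grid R r. 3 * r < \<bar>j * r - \<mu>\<bar>}. coarse_prob n m \<epsilon> R r X j)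
        \<le> card (coarse_grid R r) * exp (- (\<epsilon> * n / 8))"
    if X: "X \<in> space (iid_dataset n m D)" "X \<notin> B" for X
  proof -
    have "Q.prob {x \<in> space (person m). r < \<bar>?Y x - \<mu>\<bar>} \<le> 1 / 8"
    proof -
      have "2 / (m * r\<^sup>2) \<le> 2 / 16" using r by (intro divide_left_mono) auto
      then show ?thesis using sample_avg_tail[OF m r(1)] by linarith
    qed
    then have "n * (\<integral>x. f x \<partial>person m) \<le> n * (1 / 8)"
      unfolding Ef by (intro mult_left_mono) auto
    moreover have "\<bar>(\<Sum>i<n. f (X i)) - n * (\<integral>x. f x \<partial>person m)\<bar> < n * (1 / 8)"
      using X by (auto simp: B_def)
    ultimately have few: "(\<Sum>i<n. f (X i)) \<le> n / 4"
      by linarith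
    have "coarse_prob n m \<epsilon> R r X j \<le> exp (- (\<epsilon> * n / 8))" if j: "3 * r < \<bar>j * r - \<mu>\<bar>" for j :: int
    proof -
      have 1: "(\<Sum>i<n. coarse_score \<epsilon> r (X i) j m) \<le> (\<Sum>i<n. \<epsilon> / 4 * f (X i))"
        using j \<epsilon> by (intro sum_mono) (auto simp: coarse_score_def f_def)
      have 2: "(\<Sum>i<n. \<epsilon> / 4 * (1 - f (X i))) \<le> (\<Sum>i<n. coarse_score \<epsilon> r (X i) j0 m)"
        using j0 \<epsilon> by (intro sum_mono) (auto simp: coarse_score_def f_def)
      have "coarse_prob n m \<epsilon> R r X j
          \<le> exp ((\<Sum>i<n. coarse_score \<epsilon> r (X i) j m) - (\<Sum>i<n. coarse_score \<epsilon> r (X i) j0 m))"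
        unfolding coarse_prob_def by (rule softmax_le[OF fin j0(1)])
      also have "\<dots> \<le> exp ((\<Sum>i<n. \<epsilon> / 4 * f (X i)) - (\<Sum>i<n. \<epsilon> / 4 * (1 - f (X i))))"
        using 1 2 by simp
      also have "(\<Sum>i<n. \<epsilon> / 4 * f (X i)) - (\<Sum>i<n. \<epsilon> / 4 * (1 - f (X i)))
          = \<epsilon> / 2 * (\<Sum>i<n. f (X i)) - \<epsilon> * n / 4"
        unfolding sum_distrib_left[symmetric] sum_subtractf by (simp add: field_simps)
      also have "exp \<dots> \<le> exp (- (\<epsilon> * n / 8))"
        using mult_left_mono[OF few, of "\<epsilon> / 2"] \<epsilon> by (simp add: field_simps)
      finally show ?thesis .
    qed
    then have "(\<Sum>j\<in>{j \<in> coarse_grid R r. 3 * r < \<bar>j * r - \<mu>\<bar>}. coarse_prob n m \<epsilon> R r X j)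
        \<le> of_nat (card {j \<in> coarse_grid R r. 3 * r < \<bar>j * r - \<mu>\<bar>}) * exp (- (\<epsilon> * n / 8))"
      by (intro sum_bounded_above) auto
    also have "\<dots> \<le> card (coarse_grid R r) * exp (- (\<epsilon> * n / 8))"
      using fin by (intro mult_right_mono) (auto intro!: card_mono)
    finally show ?thesis .
  qed
  show ?thesis
    by (intro bexI[of _ B] conjI ballI) (use B good in auto)
qed

end

section \<open>The fine stage\<close>

definition clip :: "real \<Rightarrow> real \<Rightarrow> real \<Rightarrow> real" where
  "clip c b x = max (c - b) (min (c + b) x)"

lemma measurable_clip [measurable]: "clip c b \<in> borel_measurable borel"
  unfolding clip_def by measurable

lemma abs_clip_center_le: "0 \<le> b \<Longrightarrow> \<bar>clip c b x - c\<bar> \<le> b"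
  by (auto simp: clip_def max_def min_def abs_if)

lemma clip_contraction: "\<bar>c - a\<bar> \<le> b \<Longrightarrow> \<bar>clip c b x - a\<bar> \<le> \<bar>x - a\<bar>"
  by (auto simp: clip_def max_def min_def abs_if split: if_splits)

lemma abs_clip_diff_le: "0 \<le> b \<Longrightarrow> \<bar>clip c b x - clip c b y\<bar> \<le> 2 * b"
  by (auto simp: clip_def max_def min_def abs_if)

lemma abs_clip_error: "0 \<le> b \<Longrightarrow> \<bar>clip c b x - x\<bar> = max 0 (\<bar>x - c\<bar> - b)"
  by (auto simp: clip_def max_def min_def abs_if)

definition person_stat :: "nat \<Rightarrow> real \<Rightarrow> real \<Rightarrow> real \<Rightarrow> (nat \<Rightarrow> real) \<Rightarrow> real" where
  "person_stat m c b \<tau> x = clip c \<tau> (sample_avg m (clip c b) x)"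

lemma measurable_person_stat: "person_stat m c b \<tau> \<in> borel_measurable (PiM {..<m} (\<lambda>_. borel))"
  unfolding person_stat_def[abs_def] by (rule measurable_compose[OF measurable_sample_avg measurable_clip]) measurable

definition fine_grid :: "real \<Rightarrow> real \<Rightarrow> int set" where
  "fine_grid \<tau> \<delta> = {- \<lceil>\<tau> / \<delta>\<rceil>..\<lceil>\<tau> / \<delta>\<rceil>}"

text \<open>A two-sided geometric law around the average, truncated to the lattice near
  \<open>c\<close>. The average has sensitivity \<open>2 * \<tau> / n\<close>, so the slope
  \<open>\<epsilon> * n / (8 * \<tau>)\<close> gives score sensitivity
  \<open>\<epsilon> / 4\<close>, hence privacy \<open>\<epsilon> / 2\<close>.\<close>

definition fine_prob ::
    "nat \<Rightarrow> nat \<Rightarrow> real \<Rightarrow> real \<Rightarrow> real \<Rightarrow> real \<Rightarrow> real \<Rightarrow> (nat \<Rightarrow> nat \<Rightarrow> real) \<Rightarrow> int \<Rightarrow> real" where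
  "fine_prob n m \<epsilon> b \<tau> \<delta> c X = softmax (fine_grid \<tau> \<delta>)
     (\<lambda>t. - (\<epsilon> * n / (8 * \<tau>)) * \<bar>c + t * \<delta> - (\<Sum>i<n. person_stat m c b \<tau> (X i)) / n\<bar>)"

lemma finite_mechanism_fine:
  assumes "0 < \<tau>" "0 < \<delta>" "0 < \<epsilon>" "n \<ge> 1"
  shows "finite_mechanism n m (\<epsilon> / 2) (fine_grid \<tau> \<delta>) (fine_prob n m \<epsilon> b \<tau> \<delta> c)"
proof -
  have "finite_mechanism n m (2 * (\<epsilon> / 4)) (fine_grid \<tau> \<delta>) (\<lambda>X. softmax (fine_grid \<tau> \<delta>)
     (\<lambda>t. - (\<epsilon> * n / (8 * \<tau>)) * \<bar>c + t * \<delta> - (\<Sum>i<n. person_stat m c b \<tau> (X i)) / n\<bar>))"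
  proof (rule softmax_mechanism)
    show "finite (fine_grid \<tau> \<delta>)" by (simp add: fine_grid_def)
    have "0 \<le> \<tau> / \<delta>" using assms by simp
    then have "0 \<le> \<lceil>\<tau> / \<delta>\<rceil>" by linarith
    then show "fine_grid \<tau> \<delta> \<noteq> {}" by (auto simp: fine_grid_def)
    have [measurable]: "(\<lambda>X. \<Sum>i<n. person_stat m c b \<tau> (X i)) \<in> borel_measurable (dataset_space n m)"
      by (rule measurable_person_sum[OF measurable_person_stat])
    show "(\<lambda>X. - (\<epsilon> * n / (8 * \<tau>)) * \<bar>c + real_of_int t * \<delta> - (\<Sum>i<n. person_stat m c b \<tau> (X i)) / n\<bar>)
        \<in> borel_measurable (dataset_space n m)" for t
      by measurable
    show "\<bar>- (\<epsilon> * n / (8 * \<tau>)) * \<bar>c + real_of_int t * \<delta> - (\<Sum>i<n. person_stat m c b \<tau> (X i)) / n\<bar>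
        - - (\<epsilon> * n / (8 * \<tau>)) * \<bar>c + real_of_int t * \<delta> - (\<Sum>i<n. person_stat m c b \<tau> (X' i)) / n\<bar>\<bar> \<le> \<epsilon> / 4"
      (is "\<bar>- ?\<kappa> * \<bar>?h - ?f / n\<bar> - - ?\<kappa> * \<bar>?h - ?f' / n\<bar>\<bar> \<le> _")
      if N: "neighboring n m X X'" for X X' t
    proof -
      have s: "\<bar>?f - ?f'\<bar> \<le> 2 * \<tau>"
        using N by (rule neighboring_sum_le)
          (use assms in \<open>auto simp: person_stat_def intro!: abs_clip_diff_le\<close>)
      have "\<bar>- ?\<kappa> * \<bar>?h - ?f / n\<bar> - - ?\<kappa> * \<bar>?h - ?f' / n\<bar>\<bar> = ?\<kappa> * \<bar>\<bar>?h - ?f' / n\<bar> - \<bar>?h - ?f / n\<bar>\<bar>"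
      proof -
        have aux: "\<bar>- K * a - - K * b\<bar> = K * \<bar>b - a\<bar>" if "0 \<le> K" for K a b :: real
        proof -
          have eq: "- K * a - - K * b = K * (b - a)" by (simp add: algebra_simps)
          show ?thesis unfolding eq abs_mult using that by simp
        qed
        show ?thesis by (rule aux) (use assms in simp)
      qed
      also have "\<dots> \<le> ?\<kappa> * \<bar>?f / n - ?f' / n\<bar>"
        using assms by (intro mult_left_mono) auto
      also have "\<dots> = ?\<kappa> * (\<bar>?f - ?f'\<bar> / n)"
        by (simp add: diff_divide_distrib[symmetric])
      also have "\<dots> \<le> ?\<kappa> * (2 * \<tau> / n)"
        using assms s by (intro mult_left_mono divide_right_mono) auto
      also have "\<dots> = \<epsilon> / 4" using assms by (simp add: field_simps)
      finally show ?thesis .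
    qed
  qed
  then show ?thesis by (simp add: fine_prob_def[abs_def])
qed

section \<open>Tails of the truncated geometric law\<close>

lemma geometric_tail_finite:
  fixes q :: real and S :: "nat set"
  assumes q: "0 \<le> q" "q \<le> 1 / 2" and S: "finite S" "\<And>d. d \<in> S \<Longrightarrow> 2 \<le> d"
  shows "(\<Sum>d\<in>S. q ^ d) \<le> 2 * q\<^sup>2"
proof -
  have inj: "inj_on (\<lambda>d. d - 2) S"
    using S by (auto simp: inj_on_def) (metis le_add_diff_inverse)
  have "(\<Sum>d\<in>S. q ^ d) = (\<Sum>d\<in>S. q\<^sup>2 * q ^ (d - 2))"
  proof (intro sum.cong refl)
    fix d assume "d \<in> S"
    then have "2 + (d - 2) = d" by (intro le_add_diff_inverse S(2))
    then show "q ^ d = q\<^sup>2 * q ^ (d - 2)"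
      using power_add[of q 2 "d - 2"] by metis
  qed
  also have "\<dots> = q\<^sup>2 * (\<Sum>d\<in>(\<lambda>d. d - 2) ` S. q ^ d)"
    by (simp add: sum.reindex[OF inj] sum_distrib_left)
  also have "(\<Sum>d\<in>(\<lambda>d. d - 2) ` S. q ^ d) \<le> (\<Sum>d. q ^ d)"
    using q S by (intro sum_le_suminf summable_geometric) auto
  also have "\<dots> = 1 / (1 - q)"
    using q by (intro suminf_geometric) auto
  also have "\<dots> \<le> 2" using q by (simp add: divide_simps)
  finally have "(\<Sum>d\<in>S. q ^ d) \<le> q\<^sup>2 * 2" by (simp add: mult_left_mono)
  then show ?thesis by (simp add: mult.commute)
qed

text \<open>On each side of \<open>t0\<close> the exponents are distinct and at least 2, so each
  side is a subsum of a geometric tail.\<close>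

lemma geometric_tail_int:
  fixes q :: real and S :: "int set"
  assumes q: "0 \<le> q" "q \<le> 1 / 2" and S: "finite S" "\<And>t. t \<in> S \<Longrightarrow> 4 \<le> \<bar>t - t0\<bar>"
  shows "(\<Sum>t\<in>S. q ^ (nat \<bar>t - t0\<bar> - 2)) \<le> 4 * q\<^sup>2"
proof -
  have half: "(\<Sum>t\<in>S'. q ^ (nat \<bar>t - t0\<bar> - 2)) \<le> 2 * q\<^sup>2"
    if "S' \<subseteq> S" "inj_on (\<lambda>t. nat \<bar>t - t0\<bar> - 2) S'" for S'
  proof -
    have "(\<Sum>t\<in>S'. q ^ (nat \<bar>t - t0\<bar> - 2)) = (\<Sum>d\<in>(\<lambda>t. nat \<bar>t - t0\<bar> - 2) ` S'. q ^ d)"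
      by (simp add: sum.reindex[OF that(2)])
    also have "\<dots> \<le> 2 * q\<^sup>2"
      using S that by (intro geometric_tail_finite q) (auto dest: finite_subset, fastforce)
    finally show ?thesis .
  qed
  let ?P = "{t \<in> S. t0 < t}" and ?N = "{t \<in> S. t < t0}"
  have P: "inj_on (\<lambda>t. nat \<bar>t - t0\<bar> - 2) ?P" and N: "inj_on (\<lambda>t. nat \<bar>t - t0\<bar> - 2) ?N"
    using S(2) by (fastforce simp: inj_on_def)+
  have "S = ?P \<union> ?N" using S(2) by (force simp: neq_iff)
  then have "(\<Sum>t\<in>S. q ^ (nat \<bar>t - t0\<bar> - 2)) = (\<Sum>t\<in>?P \<union> ?N. q ^ (nat \<bar>t - t0\<bar> - 2))"
    by simp
  also have "\<dots> = (\<Sum>t\<in>?P. q ^ (nat \<bar>t - t0\<bar> - 2)) + (\<Sum>t\<in>?N. q ^ (nat \<bar>t - t0\<bar> - 2))"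
    using S(1) by (intro sum.union_disjoint) auto
  also have "\<dots> \<le> 2 * q\<^sup>2 + 2 * q\<^sup>2"
    using half[OF _ P] half[OF _ N] by (intro add_mono) auto
  finally show ?thesis by simp
qed

text \<open>The reference output is the lattice point \<open>t0\<close> just below \<open>f\<close>,
  at distance at most \<delta>; \<open>\<bar>f - c\<bar> \<le> \<tau>\<close> keeps it in the grid.
  A point \<open>d\<close> lattice steps from \<open>t0\<close> has score lower by at least
  \<open>\<kappa> * \<delta> * (d - 2)\<close>, and distance above \<open>5 * \<delta>\<close> from
  \<open>f\<close> forces \<open>d \<ge> 4\<close>, whence the square on the right.\<close>

lemma softmax_lattice_tail:
  fixes f c \<delta> \<kappa> :: real
  assumes \<tau>: "0 < \<tau>" "0 < \<delta>" "\<bar>f - c\<bar> \<le> \<tau>" and \<kappa>: "0 \<le> \<kappa>" "exp (- (\<kappa> * \<delta>)) \<le> 1 / 2"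
  shows "(\<Sum>t\<in>{t \<in> fine_grid \<tau> \<delta>. 5 * \<delta> < \<bar>c + t * \<delta> - f\<bar>}.
      softmax (fine_grid \<tau> \<delta>) (\<lambda>t. - \<kappa> * \<bar>c + t * \<delta> - f\<bar>) t) \<le> 4 * (exp (- (\<kappa> * \<delta>)))\<^sup>2"
    (is "sum _ ?S \<le> _")
proof -
  let ?J = "fine_grid \<tau> \<delta>"
  define t0 where "t0 = \<lfloor>(f - c) / \<delta>\<rfloor>"
  have fin: "finite ?J" by (simp add: fine_grid_def)
  have "- (\<tau> / \<delta>) \<le> (f - c) / \<delta>" "(f - c) / \<delta> \<le> \<tau> / \<delta>"
    using \<tau> by (auto simp: divide_simps)
  then have t0: "t0 \<in> ?J"
    unfolding fine_grid_def t0_def by (auto intro: order_trans[OF floor_mono floor_le_ceiling] simp: ceiling_def; linarith)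
  have "t0 * \<delta> \<le> f - c" "f - c < (t0 + 1) * \<delta>"
    unfolding t0_def
    using \<tau> floor_divide_lower[of \<delta> "f - c"] floor_divide_upper[of \<delta> "f - c"] by (auto simp: mult_ac)
  then have near: "\<bar>c + t0 * \<delta> - f\<bar> \<le> \<delta>" by (simp add: algebra_simps)
  have shift: "\<bar>c + t * \<delta> - (c + t0 * \<delta>)\<bar> = \<delta> * \<bar>t - t0\<bar>" for t :: int
  proof -
    have eq: "c + t * \<delta> - (c + t0 * \<delta>) = \<delta> * (real_of_int (t - t0))" by (simp add: algebra_simps)
    have "\<bar>\<delta>\<bar> = \<delta>" using \<tau>(2) by (rule abs_of_pos)
    then show ?thesis unfolding eq abs_mult of_int_abs by (rule arg_cong)
  qed
  define e where "e t = \<bar>c + real_of_int t * \<delta> - f\<bar>" for t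
  have e_t0: "e t0 \<le> \<delta>" using near by (simp add: e_def)
  have tri: "\<bar>y - f\<bar> \<le> \<bar>y - z\<bar> + \<bar>z - f\<bar>" "\<bar>y - z\<bar> \<le> \<bar>y - f\<bar> + \<bar>z - f\<bar>" for y z :: real
    by linarith+
  have e_le: "e t \<le> \<delta> * real_of_int \<bar>t - t0\<bar> + e t0" "\<delta> * real_of_int \<bar>t - t0\<bar> \<le> e t + e t0" for t
    using tri[of "c + t * \<delta>" "c + t0 * \<delta>"] unfolding shift e_def by auto
  have far: "4 \<le> \<bar>t - t0\<bar>" if "t \<in> ?S" for t
  proof -
    have "5 * \<delta> < e t" using that by (simp add: e_def)
    then have "\<delta> * 4 < \<delta> * real_of_int \<bar>t - t0\<bar>" using e_le(1)[of t] e_t0 by linarith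
    then have "4 < real_of_int \<bar>t - t0\<bar>" using \<tau>(2) mult_less_cancel_left_pos by blast
    then show ?thesis by linarith
  qed
  have le: "softmax ?J (\<lambda>t. - \<kappa> * \<bar>c + t * \<delta> - f\<bar>) t \<le> exp (- (\<kappa> * \<delta>)) ^ (nat \<bar>t - t0\<bar> - 2)"
    if "t \<in> ?S" for t
  proof -
    have n: "real (nat \<bar>t - t0\<bar> - 2) = real_of_int \<bar>t - t0\<bar> - 2"
      using far[OF that] by (simp add: of_nat_diff)
    have "\<delta> * (real_of_int \<bar>t - t0\<bar> - 2) \<le> e t - e t0"
      using e_le(2)[of t] e_t0 unfolding right_diff_distrib by linarith
    then have "\<kappa> * (\<delta> * (real_of_int \<bar>t - t0\<bar> - 2)) \<le> \<kappa> * (e t - e t0)"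
      using \<kappa> by (intro mult_left_mono) auto
    then have "- \<kappa> * e t - - \<kappa> * e t0 \<le> real (nat \<bar>t - t0\<bar> - 2) * (- (\<kappa> * \<delta>))"
      unfolding n by (simp add: algebra_simps)
    then have "exp (- \<kappa> * e t - - \<kappa> * e t0) \<le> exp (- (\<kappa> * \<delta>)) ^ (nat \<bar>t - t0\<bar> - 2)"
      unfolding exp_of_nat_mult[symmetric] by (simp only: exp_le_cancel_iff)
    then show ?thesis
      using softmax_le[OF fin t0, of "\<lambda>t. - \<kappa> * e t" t] unfolding e_def by (rule order_trans[rotated])
  qed
  have "sum (softmax ?J (\<lambda>t. - \<kappa> * \<bar>c + t * \<delta> - f\<bar>)) ?S \<le> (\<Sum>t\<in>?S. exp (- (\<kappa> * \<delta>)) ^ (nat \<bar>t - t0\<bar> - 2))"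
    by (intro sum_mono le)
  also have "\<dots> \<le> 4 * (exp (- (\<kappa> * \<delta>)))\<^sup>2"
    using fin far \<kappa> by (intro geometric_tail_int) auto
  finally show ?thesis .
qed

lemma square_le_two_exp: "0 \<le> x \<Longrightarrow> x\<^sup>2 \<le> 2 * exp (x::real)"
  using exp_lower_Taylor_quadratic[of x] by simp

context bounded_moment
begin

text \<open>Where clipping acts, \<open>\<bar>x - \<mu>\<bar>\<close> is at least
  \<open>b / 2\<close>, so the error, at most \<open>\<bar>x - \<mu>\<bar>\<close>, can be traded
  for \<open>(2 / b) powr (k - 1)\<close> times the \<open>k\<close>-th power and then
  averaged.\<close>

lemma clip_bias:
  assumes b: "b > 0" "\<bar>c - \<mu>\<bar> \<le> b / 2"
  shows "integrable D (clip c b)" "\<bar>expectation (clip c b) - \<mu>\<bar> \<le> (2 / b) powr (k - 1)"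
proof -
  have m: "clip c b \<in> borel_measurable D" by simp
  have "integrable D (\<lambda>x. (clip c b x - \<mu>)\<^sup>2)"
    using b by (intro integrable_contraction clip_contraction) auto
  then show i: "integrable D (clip c b)"
    using centered_second_moment_le(1)[OF m] by blast
  have pt: "\<bar>clip c b x - x\<bar> \<le> (2 / b) powr (k - 1) * \<bar>x - \<mu>\<bar> powr k" for x
  proof (cases "\<bar>x - c\<bar> \<le> b")
    case True
    then show ?thesis using b by (simp add: abs_clip_error)
  next
    case False
    then have z: "b / 2 \<le> \<bar>x - \<mu>\<bar>" and e: "\<bar>clip c b x - x\<bar> \<le> \<bar>x - \<mu>\<bar>"
      using b abs_clip_error[of b c x] by linarith+
    have "\<bar>x - \<mu>\<bar> = (2 / b) powr (k - 1) * (b / 2) powr (k - 1) * \<bar>x - \<mu>\<bar>"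
      using b by (simp flip: powr_mult)
    also have "\<dots> \<le> (2 / b) powr (k - 1) * \<bar>x - \<mu>\<bar> powr (k - 1) * \<bar>x - \<mu>\<bar>"
      using b z k by (intro mult_right_mono mult_left_mono powr_mono2) auto
    also have "\<dots> = (2 / b) powr (k - 1) * \<bar>x - \<mu>\<bar> powr k"
    proof -
      have "\<bar>x - \<mu>\<bar> * \<bar>x - \<mu>\<bar> powr (k - 1) = \<bar>x - \<mu>\<bar> powr k"
        by (subst powr_mult_base) auto
      then show ?thesis by (simp add: mult_ac)
    qed
    finally show ?thesis using e by linarith
  qed
  have "\<bar>expectation (clip c b) - \<mu>\<bar> = \<bar>expectation (\<lambda>x. clip c b x - x)\<bar>"
    using i integrable_id by (simp add: expectation_id)
  also have "\<dots> \<le> expectation (\<lambda>x. \<bar>clip c b x - x\<bar>)"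
    by (rule integral_abs_bound)
  also have "\<dots> \<le> expectation (\<lambda>x. (2 / b) powr (k - 1) * \<bar>x - \<mu>\<bar> powr k)"
    using i integrable_id integrable_moment by (intro integral_mono pt) auto
  also have "\<dots> \<le> (2 / b) powr (k - 1) * 1"
    by (subst integral_mult_right_zero) (intro mult_left_mono moment_le, simp)
  finally show "\<bar>expectation (clip c b) - \<mu>\<bar> \<le> (2 / b) powr (k - 1)" by simp
qed

text \<open>The tilt is the largest, up to constants, with a bounded exponential moment. A centered
  clipped sample has range \<open>2 * b\<close>, so with per-sample tilt
  \<open>\<theta> / (2 * b)\<close> the exponential factor is
  \<open>exp \<theta> = b / sqrt m\<close>. Writing \<open>u\<close> for it, the Bennett exponent is
  \<open>\<theta>\<^sup>2 / (2 * u)\<close>, at most 1. The sign \<sigma> covers both tails.\<close>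

lemma sample_avg_mgf:
  assumes m: "m \<ge> 1" and b: "sqrt m < b" "\<bar>c - \<mu>\<bar> \<le> b" and \<sigma>: "\<bar>\<sigma>\<bar> = 1"
  defines "\<theta> \<equiv> ln (b / sqrt m)"
  shows "integrable (person m) (\<lambda>x. exp (\<sigma> * (\<theta> * m / (2 * b)) * (sample_avg m (clip c b) x - expectation (clip c b))))" (is ?I)
    and "(\<integral>x. exp (\<sigma> * (\<theta> * m / (2 * b)) * (sample_avg m (clip c b) x - expectation (clip c b))) \<partial>person m) \<le> exp 1" (is ?L)
proof -
  define f where "f x = clip c b x - expectation (clip c b)" for x
  have sm: "sqrt m > 0" using m by simp
  have b0: "b > 0" using b sm by linarith
  define u where "u = b / sqrt m"
  have u: "u > 1" using b sm by (simp add: u_def)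
  have \<theta>: "\<theta> > 0" "exp \<theta> = u" using u by (auto simp: \<theta>_def u_def)
  have m': "clip c b \<in> borel_measurable D" by simp
  have cm: "integrable D (\<lambda>x. (clip c b x - \<mu>)\<^sup>2)" "expectation (\<lambda>x. (clip c b x - \<mu>)\<^sup>2) \<le> 2"
    using b by (intro integrable_contraction second_moment_contraction clip_contraction; simp)+
  note c2 = centered_second_moment_le[OF m' cm(1)]
  have fm: "f \<in> borel_measurable D" by (simp add: f_def[abs_def])
  have f0: "expectation f = 0" using c2(1) by (simp add: f_def[abs_def])
  have f2: "expectation (\<lambda>x. (f x)\<^sup>2) \<le> 2" using c2(3) cm(2) by (simp add: f_def)
  have fb: "\<bar>f x\<bar> \<le> 2 * b" for x
  proof -
    have r: "c - b \<le> clip c b y" "clip c b y \<le> c + b" for y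
      using abs_clip_center_le[of b c y] b0 by linarith+
    have "c - b \<le> expectation (clip c b)" "expectation (clip c b) \<le> c + b"
      using c2(1) r by (auto intro!: integral_ge_const integral_le_const)
    then show ?thesis using r[of x] by (simp add: f_def)
  qed
  have eq: "\<sigma> * (\<theta> * m / (2 * b)) * (sample_avg m (clip c b) x - expectation (clip c b))
      = (\<sigma> * \<theta> / (2 * b)) * (\<Sum>j<m. f (x j))" for x
    using m b0 by (simp add: sample_avg_def f_def sum_subtractf field_simps)
  note mgf = iid_sum_mgf_le[OF finite_lessThan fm f0 fb f2, of m "\<sigma> * \<theta> / (2 * b)"]
  show ?I unfolding eq by (rule mgf)
  have abs: "\<bar>\<sigma> * \<theta> / (2 * b)\<bar> = \<theta> / (2 * b)"
    using \<sigma> \<theta> b0 by (simp add: abs_mult)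
  have sq: "(\<sigma> * \<theta> / (2 * b))\<^sup>2 = \<theta>\<^sup>2 / (4 * b\<^sup>2)"
    using arg_cong[OF abs, of "\<lambda>x. x\<^sup>2"] by (simp add: power_divide power_mult_distrib)
  have "card {..<m} * (2 * (\<sigma> * \<theta> / (2 * b))\<^sup>2 * exp (\<bar>\<sigma> * \<theta> / (2 * b)\<bar> * (2 * b)))
      = m * (2 * (\<theta>\<^sup>2 / (4 * b\<^sup>2)) * u)"
    unfolding abs sq using b0 \<theta> by simp
  also have "\<dots> = \<theta>\<^sup>2 / (2 * u)"
    using b0 sm by (simp add: u_def power2_eq_square field_simps)
  also have "\<dots> \<le> 1"
    using square_le_two_exp[of \<theta>] \<theta> u by simp
  finally have "exp (card {..<m} * (2 * (\<sigma> * \<theta> / (2 * b))\<^sup>2 * exp (\<bar>\<sigma> * \<theta> / (2 * b)\<bar> * (2 * b)))) \<le> exp 1"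
    by simp
  then show ?L unfolding eq using mgf(2) by (rule order_trans[rotated])
qed

text \<open>With \<open>w\<close> the deviation of the unclipped average, the error is at most
  \<open>max 0 (w - \<tau> / 2)\<close>, and \<open>y \<le> exp y\<close> bounds this by
  \<open>exp (l * (w - \<tau> / 2)) / l\<close>. The tilt \<open>l\<close> and \<tau> are matched so
  that \<open>l * \<tau> / 2 = s * ln (b / sqrt m)\<close>; the constant part is then the power with
  exponent \<open>- s\<close>, and the rest is the exponential moment.\<close>

lemma person_stat_bias:
  assumes m: "m \<ge> 1" and b: "sqrt m < b" "\<bar>c - \<mu>\<bar> \<le> b"
    and \<tau>: "\<tau> = 4 * s * b / m" "0 < \<tau>" "\<bar>c - expectation (clip c b)\<bar> \<le> \<tau> / 2"
  shows "\<bar>(\<integral>x. person_stat m c b \<tau> x \<partial>person m) - expectation (clip c b)\<bar>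
    \<le> 4 * exp 1 * b / (m * ln (b / sqrt m)) * (b / sqrt m) powr (- s)"
proof -
  interpret Q: prob_space "person m" by (rule prob_space_iid)
  let ?Y = "sample_avg m (clip c b)" and ?a = "expectation (clip c b)"
  have sm: "sqrt m > 0" using m by simp
  have b0: "b > 0" using b sm by linarith
  define \<theta> where "\<theta> = ln (b / sqrt m)"
  have u: "b / sqrt m > 1" using b sm by simp
  then have \<theta>: "\<theta> > 0" by (simp add: \<theta>_def)
  define l where "l = \<theta> * m / (2 * b)"
  have l: "l > 0" using \<theta> m b0 by (simp add: l_def)
  have lt: "l * (\<tau> / 2) = \<theta> * s" using b0 m by (simp add: l_def \<tau>(1) field_simps)
  have i: "integrable (person m) (\<lambda>x. exp (l * (?Y x - ?a)))" "integrable (person m) (\<lambda>x. exp (- l * (?Y x - ?a)))"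
    and e: "(\<integral>x. exp (l * (?Y x - ?a)) \<partial>person m) \<le> exp 1" "(\<integral>x. exp (- l * (?Y x - ?a)) \<partial>person m) \<le> exp 1"
    using sample_avg_mgf[OF m b, of 1] sample_avg_mgf[OF m b, of "-1"] by (simp_all add: l_def \<theta>_def)
  have iY: "integrable (person m) ?Y" and eY: "(\<integral>x. ?Y x \<partial>person m) = ?a"
  proof -
    have "integrable D (\<lambda>x. (clip c b x - \<mu>)\<^sup>2)"
      using b by (intro integrable_contraction clip_contraction) auto
    then have ic: "integrable D (clip c b)"
      by (rule centered_second_moment_le(1)[rotated]) simp
    show "integrable (person m) ?Y"
      unfolding sample_avg_def[abs_def]
      by (intro integrable_divide_zero Bochner_Integration.integrable_sum integrable_iid_component ic) auto
    have "(\<integral>x. ?Y x \<partial>person m) = (\<Sum>j<m. \<integral>x. clip c b (x j) \<partial>person m) / m"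
      unfolding sample_avg_def[abs_def]
      by (subst integral_divide_zero, subst Bochner_Integration.integral_sum)
         (auto intro!: integrable_iid_component ic)
    also have "\<dots> = (\<Sum>j<m. ?a) / m"
      by (intro arg_cong[where f="\<lambda>x. x / m"] sum.cong refl integral_iid_component) auto
    finally show "(\<integral>x. ?Y x \<partial>person m) = ?a" using m by simp
  qed
  let ?K = "(b / sqrt m) powr (- s) / l"
  have pt: "\<bar>person_stat m c b \<tau> x - ?Y x\<bar> \<le> ?K * (exp (l * (?Y x - ?a)) + exp (- l * (?Y x - ?a)))" for x
  proof -
    let ?w = "\<bar>?Y x - ?a\<bar>"
    have "\<bar>person_stat m c b \<tau> x - ?Y x\<bar> \<le> max 0 (?w - \<tau> / 2)"
    proof -
      have "\<bar>?Y x - c\<bar> - \<tau> \<le> ?w - \<tau> / 2" using \<tau>(3) by linarith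
      then show ?thesis
        using abs_clip_error[of \<tau> c "?Y x"] \<tau>(2) max.mono[OF order_refl] by (simp add: person_stat_def)
    qed
    also have "\<dots> \<le> exp (l * (?w - \<tau> / 2)) / l"
    proof -
      have "l * (?w - \<tau> / 2) \<le> exp (l * (?w - \<tau> / 2))"
        using exp_ge_add_one_self[of "l * (?w - \<tau> / 2)"] by linarith
      then have "?w - \<tau> / 2 \<le> exp (l * (?w - \<tau> / 2)) / l"
        using l by (simp add: pos_le_divide_eq mult_ac)
      then show ?thesis using l by (auto simp: max_def)
    qed
    also have "\<dots> = ?K * exp (l * ?w)"
    proof -
      have "l * (?w - \<tau> / 2) = l * ?w + - s * \<theta>"
        using lt by (simp add: right_diff_distrib)
      moreover have "exp (- s * \<theta>) = (b / sqrt m) powr (- s)"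
        using u b0 sm by (simp add: powr_def \<theta>_def)
      ultimately show ?thesis by (simp only: exp_add) simp
    qed
    also have "\<dots> \<le> ?K * (exp (l * (?Y x - ?a)) + exp (- l * (?Y x - ?a)))"
    proof -
      have "exp (l * \<bar>y\<bar>) \<le> exp (l * y) + exp (- l * y)" for y
        by (simp add: abs_if)
      then show ?thesis using l by (intro mult_left_mono) auto
    qed
    finally show ?thesis .
  qed
  have iS: "integrable (person m) (person_stat m c b \<tau>)"
  proof (rule Q.integrable_const_bound[where B = "\<bar>c\<bar> + \<tau>"])
    have "\<bar>person_stat m c b \<tau> x\<bar> \<le> \<bar>c\<bar> + \<tau>" for x
      using abs_clip_center_le[of \<tau> c "?Y x"] \<tau>(2) by (simp add: person_stat_def)
    then show "AE x in person m. norm (person_stat m c b \<tau> x) \<le> \<bar>c\<bar> + \<tau>" by simp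
  qed (simp add: measurable_person_iff measurable_person_stat)
  have "\<bar>(\<integral>x. person_stat m c b \<tau> x \<partial>person m) - ?a\<bar>
      = \<bar>\<integral>x. person_stat m c b \<tau> x - ?Y x \<partial>person m\<bar>"
    using iS iY by (simp add: eY)
  also have "\<dots> \<le> (\<integral>x. \<bar>person_stat m c b \<tau> x - ?Y x\<bar> \<partial>person m)"
    by (rule integral_abs_bound)
  also have "\<dots> \<le> (\<integral>x. ?K * (exp (l * (?Y x - ?a)) + exp (- l * (?Y x - ?a))) \<partial>person m)"
    using iS iY i by (intro integral_mono pt) auto
  also have "\<dots> = ?K * ((\<integral>x. exp (l * (?Y x - ?a)) \<partial>person m) + (\<integral>x. exp (- l * (?Y x - ?a)) \<partial>person m))"
    by (subst integral_mult_right_zero, subst Bochner_Integration.integral_add) (use i in auto)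
  also have "\<dots> \<le> ?K * (exp 1 + exp 1)"
    using l by (intro mult_left_mono add_mono e) auto
  also have "\<dots> = 4 * exp 1 * b / (m * ln (b / sqrt m)) * (b / sqrt m) powr (- s)"
    using b0 m \<theta> by (simp add: l_def \<theta>_def[symmetric] field_simps)
  finally show ?thesis .
qed

end

text \<open>The clipping radius of a single sample makes the clipping bias at most \<open>\<alpha> / 16\<close>; its second
  term forces \<open>b / \<surd>m \<ge> 24\<close>, so that the exponential moment at \<open>ln (b / \<surd>m)\<close> is controlled. The
  radius for a person's mean exceeds \<open>b / m\<close> by a factor \<open>O(log m)\<close>, which is enough because the
  tail decays like \<open>(b / \<surd>m) powr (- s)\<close>, a power of \<open>\<alpha>\<close>; no factor \<open>log (1 / \<alpha>)\<close> is lost.\<close>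

definition clip_radius :: "real \<Rightarrow> nat \<Rightarrow> real \<Rightarrow> real" where
  "clip_radius k m \<alpha> = 2 * (16 / \<alpha>) powr (1 / (k - 1)) + 24 * sqrt m"

definition person_radius :: "real \<Rightarrow> nat \<Rightarrow> real \<Rightarrow> real" where
  "person_radius k m \<alpha> = 4 * (k * (1 + ln m) + 1) * clip_radius k m \<alpha> / m"

lemma clip_radius_sqrt: "24 * sqrt m \<le> clip_radius k m \<alpha>"
  by (simp add: clip_radius_def)

lemma clip_radius_sqrt_less: "m \<ge> 1 \<Longrightarrow> sqrt m < clip_radius k m \<alpha>"
  using clip_radius_sqrt[of m k \<alpha>] real_sqrt_gt_zero[of m] by linarith

lemma clip_radius_bias:
  assumes "2 \<le> k" "0 < \<alpha>" "m \<ge> 1"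
  shows "(2 / clip_radius k m \<alpha>) powr (k - 1) \<le> \<alpha> / 16"
proof -
  let ?z = "(16 / \<alpha>) powr (1 / (k - 1))"
  have z: "?z > 0" using assms by simp
  have "2 / clip_radius k m \<alpha> \<le> 2 / (2 * ?z)"
    using z by (intro divide_left_mono mult_pos_pos) (auto simp: clip_radius_def add_pos_nonneg)
  then have "(2 / clip_radius k m \<alpha>) powr (k - 1) \<le> (1 / ?z) powr (k - 1)"
    using assms z by (intro powr_mono2) (auto simp: clip_radius_def add_pos_nonneg)
  also have "\<dots> = 1 / (?z powr (k - 1))"
    using z by (simp add: powr_divide)
  also have "?z powr (k - 1) = 16 / \<alpha>"
    using assms by (simp add: powr_powr)
  finally show ?thesis by simp
qed

lemma person_radius_ge:
  assumes "2 \<le> k" "m \<ge> 1"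
  shows "96 / sqrt m \<le> person_radius k m \<alpha>"
proof -
  have s: "sqrt m > 0" using assms by simp
  have "0 \<le> k * (1 + ln m)" using assms by simp
  then have "4 * 1 * (24 * sqrt m) \<le> 4 * (k * (1 + ln m) + 1) * clip_radius k m \<alpha>"
    using clip_radius_sqrt[of m k \<alpha>] s by (intro mult_mono) auto
  then have "4 * 1 * (24 * sqrt m) / m \<le> person_radius k m \<alpha>"
    unfolding person_radius_def using assms by (intro divide_right_mono) auto
  moreover have "sqrt m / m = 1 / sqrt m"
    using assms by (simp add: real_div_sqrt field_simps)
  ultimately show ?thesis by simp
qed

text \<open>This explains the exponent \<open>s\<close>. Since \<open>b = u * sqrt m\<close> and
  \<open>m \<le> u powr ln m\<close>, the exponent \<open>k * (1 + ln m)\<close> makes the power of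
  \<open>u\<close> exceed \<open>b powr k\<close>, and the extra 1 absorbs the factor 3. The bias of
  the second clip thus falls below \<open>(2 / b) powr (k - 1)\<close>, the bound for the first
  clip.\<close>

lemma person_radius_bias:
  assumes k: "2 \<le> k" and \<alpha>: "0 < \<alpha>" and m: "m \<ge> 1"
  defines "b \<equiv> clip_radius k m \<alpha>" and "s \<equiv> k * (1 + ln m) + 1"
  shows "4 * exp 1 * b / (m * ln (b / sqrt m)) * (b / sqrt m) powr (- s) \<le> \<alpha> / 16"
proof -
  define u where "u = b / sqrt m"
  have sm: "sqrt m > 0" using m by simp
  have b0: "b > 0" using clip_radius_sqrt_less[OF m, of k \<alpha>] sm unfolding b_def by linarith
  have u: "24 \<le> u"
    using clip_radius_sqrt[of m k \<alpha>] sm by (simp add: u_def b_def pos_le_divide_eq)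
  have e: "exp (1::real) \<le> 3" by (rule exp_le)
  have "exp (2::real) = exp 1 * exp 1" by (simp flip: exp_add)
  also have "\<dots> \<le> 3 * 3" using e by (intro mult_mono) auto
  finally have "exp 2 \<le> u" using u by simp
  then have \<theta>: "2 \<le> ln u" using u by (simp add: ln_ge_iff)
  have "exp 1 \<le> u" using e u by simp
  then have lnu: "1 \<le> ln u" using \<theta> by simp
  have m1: "real m \<ge> 1" using m by simp
  have u_ln: "m \<le> u powr ln m"
  proof -
    have "real m = exp (ln m)" using m by simp
    also have "\<dots> \<le> exp (ln m * ln u)"
      using mult_left_mono[OF lnu, of "ln m"] m1 unfolding exp_le_cancel_iff by simp
    also have "\<dots> = u powr ln m" using u by (simp add: powr_def)
    finally show ?thesis .
  qed
  have key: "3 * b powr k \<le> m * u powr s"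
  proof -
    have "b = u * sqrt m" using sm by (simp add: u_def)
    then have "b powr k = u powr k * sqrt m powr k"
      using u sm by (simp add: powr_mult)
    also have "sqrt m powr k \<le> real m powr k"
      using k m1 by (intro powr_mono2) (auto simp: real_le_lsqrt power2_eq_square)
    also have "real m powr k \<le> (u powr ln m) powr k"
      using k u_ln by (intro powr_mono2) auto
    also have "(u powr ln m) powr k = u powr (k * ln m)"
      by (simp add: powr_powr mult.commute)
    finally have "b powr k \<le> u powr k * u powr (k * ln m)"
      using u by simp
    then have "3 * b powr k \<le> u * (u powr k * u powr (k * ln m))"
      using u by (intro mult_mono) auto
    also have "\<dots> = u powr s"
    proof -
      have "s = 1 + (k + k * ln m)" by (simp add: s_def algebra_simps)
      then show ?thesis using u by (simp only: powr_add) simp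
    qed
    also have "\<dots> \<le> m * u powr s"
      using m1 mult_right_mono[of 1 "real m" "u powr s"] by simp
    finally show ?thesis .
  qed
  have us: "u powr s > 0" using u by simp
  have bk: "b powr k > 0" using b0 by simp
  have "4 * exp 1 * b / (m * ln u) * u powr (- s) \<le> 4 * 3 * b / (m * 2) * u powr (- s)"
    using b0 e m \<theta> by (intro mult_right_mono frac_le mult_left_mono mult_mono) auto
  also have "\<dots> = 6 * b / (m * u powr s)"
    using us by (simp add: powr_minus divide_simps)
  also have "\<dots> \<le> 6 * b / (3 * b powr k)"
    using key b0 bk m us by (intro divide_left_mono mult_pos_pos) auto
  also have "\<dots> = 2 * (1 / b) powr (k - 1)"
  proof -
    have "b powr k = b * b powr (k - 1)" using b0 by (subst powr_mult_base) auto
    then show ?thesis using b0 by (simp add: powr_divide)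
  qed
  also have "\<dots> \<le> 2 powr (k - 1) * (1 / b) powr (k - 1)"
    using k powr_mono[of 1 "k - 1" "2::real"] by (intro mult_right_mono) auto
  also have "\<dots> = (2 / b) powr (k - 1)"
    using b0 by (simp flip: powr_mult)
  also have "\<dots> \<le> \<alpha> / 16"
    unfolding b_def by (rule clip_radius_bias[OF k \<alpha> m])
  finally show ?thesis by (simp add: u_def)
qed

lemma sum_square_le: "(x + y)\<^sup>2 \<le> 2 * x\<^sup>2 + 2 * (y::real)\<^sup>2"
proof -
  have "0 \<le> (x - y)\<^sup>2" by (rule zero_le_power2)
  then show ?thesis unfolding power2_sum power2_diff by linarith
qed

context bounded_moment
begin

text \<open>Error budget: \<alpha>/16 for clipping samples, \<alpha>/16 for clipping the person's
  mean and \<alpha>/8 for fluctuation over people, so the average is within \<alpha>/4 of \<mu>. The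
  lattice noise adds at most 5\<alpha>/8, for a total of 7\<alpha>/8. The number 384 is 6 times 64,
  from person variance \<open>6 / m\<close> and deviation \<alpha>/8.\<close>

lemma fine_accuracy:
  assumes m: "m \<ge> 1" and n: "n \<ge> 1" and \<alpha>: "0 < \<alpha>" "\<alpha> < 12 / sqrt m" and c: "\<bar>c - \<mu>\<bar> \<le> 12 / sqrt m"
    and \<epsilon>: "\<epsilon> > 0" and \<beta>: "\<beta> < 1"
  defines "b \<equiv> clip_radius k m \<alpha>" and "\<tau> \<equiv> person_radius k m \<alpha>"
  assumes noise: "exp (- (\<epsilon> * n / (8 * \<tau>) * (\<alpha> / 8))) \<le> \<beta> / 16"
  shows "\<exists>B\<in>sets (iid_dataset n m D). measure (iid_dataset n m D) B \<le> 384 / (real n * real m * \<alpha>\<^sup>2) \<and>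
    (\<forall>X\<in>space (iid_dataset n m D) - B.
      (\<Sum>t\<in>{t \<in> fine_grid \<tau> (\<alpha> / 8). \<alpha> < \<bar>c + t * (\<alpha> / 8) - \<mu>\<bar>}. fine_prob n m \<epsilon> b \<tau> (\<alpha> / 8) c X t)
        \<le> \<beta> / 4)"
proof -
  interpret Q: prob_space "person m" by (rule prob_space_iid)
  let ?a = "expectation (clip c b)" and ?Y = "sample_avg m (clip c b)" and ?S = "person_stat m c b \<tau>"
  have sm: "sqrt m \<ge> 1" using m by simp
  have b: "sqrt m < b" unfolding b_def by (rule clip_radius_sqrt_less[OF m])
  then have b0: "b > 0" using sm by linarith
  have \<tau>: "96 / sqrt m \<le> \<tau>" unfolding \<tau>_def by (rule person_radius_ge[OF k m])
  have i0: "1 / sqrt m > 0" using sm by simp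
  have \<alpha>': "\<alpha> < 12 * (1 / sqrt m)" and c': "\<bar>c - \<mu>\<bar> \<le> 12 * (1 / sqrt m)" and \<tau>': "96 * (1 / sqrt m) \<le> \<tau>"
    using \<alpha> c \<tau> by simp_all
  have \<tau>0: "\<tau> > 0" using \<tau>' i0 by linarith
  have "1 / sqrt m \<le> sqrt m" using sm by (simp add: divide_simps)
  then have cb: "\<bar>c - \<mu>\<bar> \<le> b / 2"
    using c' clip_radius_sqrt[of m k \<alpha>] unfolding b_def by linarith
  have bias1: "\<bar>?a - \<mu>\<bar> \<le> \<alpha> / 16"
    using clip_bias(2)[OF b0 cb] clip_radius_bias[OF k \<alpha>(1) m] by (simp add: b_def)
  have c\<tau>: "\<bar>c - ?a\<bar> \<le> \<tau> / 2"
    using bias1 \<alpha>' c' \<tau>' by linarith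
  have cb': "\<bar>c - \<mu>\<bar> \<le> b" using cb b0 by linarith
  have bias2: "\<bar>(\<integral>x. ?S x \<partial>person m) - ?a\<bar> \<le> \<alpha> / 16"
    using person_stat_bias[OF m b cb' _ \<tau>0 c\<tau>, of "k * (1 + ln m) + 1"] person_radius_bias[OF k \<alpha>(1) m]
    by (simp add: \<tau>_def person_radius_def b_def)
  have Sm: "?S \<in> borel_measurable (PiM {..<m} (\<lambda>_. borel))" by (rule measurable_person_stat)
  have iY: "integrable (person m) (\<lambda>x. (?Y x - ?a)\<^sup>2)" and vY: "(\<integral>x. (?Y x - ?a)\<^sup>2 \<partial>person m) \<le> 2 / m"
    using integrable_sample_avg[OF measurable_clip clip_contraction[OF cb'] m]
      variance_sample_avg[OF measurable_clip clip_contraction[OF cb'] m] by simp_all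
  have pt: "(?S x - \<mu>)\<^sup>2 \<le> 2 * (?Y x - ?a)\<^sup>2 + 2 * (\<alpha> / 16)\<^sup>2" for x
  proof -
    \<comment> \<open>Measuring from \<mu> rather than from the statistic's own mean lets the outer
      clip be discarded as a contraction; only the small bias of the inner clip remains.\<close>
    have "\<bar>c - \<mu>\<bar> \<le> \<tau>" using c' \<tau>' i0 by linarith
    then have "\<bar>?S x - \<mu>\<bar> \<le> \<bar>?Y x - \<mu>\<bar>"
      unfolding person_stat_def by (rule clip_contraction)
    then have "(?S x - \<mu>)\<^sup>2 \<le> ((?Y x - ?a) + (?a - \<mu>))\<^sup>2"
      by (simp add: abs_le_square_iff[symmetric])
    also have "\<dots> \<le> 2 * (?Y x - ?a)\<^sup>2 + 2 * (?a - \<mu>)\<^sup>2"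
      by (rule sum_square_le)
    also have "(?a - \<mu>)\<^sup>2 \<le> (\<alpha> / 16)\<^sup>2"
      using bias1 \<alpha>(1) by (simp add: abs_le_square_iff[symmetric])
    finally show ?thesis by simp
  qed
  have i_bound: "integrable (person m) (\<lambda>x. 2 * (?Y x - ?a)\<^sup>2 + 2 * (\<alpha> / 16)\<^sup>2)"
    using iY by simp
  have iS: "integrable (person m) (\<lambda>x. (?S x - \<mu>)\<^sup>2)"
    by (rule Bochner_Integration.integrable_bound[OF i_bound])
       (use Sm pt in \<open>auto simp: measurable_person_iff\<close>)
  have vS: "(\<integral>x. (?S x - \<mu>)\<^sup>2 \<partial>person m) \<le> 6 / m"
  proof -
    have "(\<integral>x. (?S x - \<mu>)\<^sup>2 \<partial>person m) \<le> (\<integral>x. 2 * (?Y x - ?a)\<^sup>2 + 2 * (\<alpha> / 16)\<^sup>2 \<partial>person m)"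
      by (intro integral_mono iS i_bound pt)
    also have "\<dots> = 2 * (\<integral>x. (?Y x - ?a)\<^sup>2 \<partial>person m) + 2 * (\<alpha> / 16)\<^sup>2"
      using iY Q.prob_space by simp
    also have "\<dots> \<le> 2 * (2 / m) + 2 * (\<alpha> / 16)\<^sup>2"
      using vY by simp
    also have "(\<alpha> / 16)\<^sup>2 \<le> 1 / m"
    proof -
      have "(\<alpha> / 16)\<^sup>2 \<le> (1 / sqrt m)\<^sup>2"
        using \<alpha>' \<alpha>(1) i0 by (intro power_mono) auto
      then show ?thesis by (simp add: power_divide)
    qed
    finally show ?thesis by (simp add: field_simps)
  qed
  let ?\<mu>S = "\<integral>x. ?S x \<partial>person m"
  define B where "B = {X \<in> space (iid_dataset n m D). n * (\<alpha> / 8) \<le> \<bar>(\<Sum>i<n. ?S (X i)) - n * ?\<mu>S\<bar>}"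
  have "B \<in> sets (iid_dataset n m D)" "measure (iid_dataset n m D) B \<le> (6 / m) / (n * (\<alpha> / 8)\<^sup>2)"
    unfolding B_def by (rule person_sum_Chebyshev[OF Sm iS vS _ n]; use \<alpha> in simp)+
  then have B: "B \<in> sets (iid_dataset n m D)" "measure (iid_dataset n m D) B \<le> 384 / (real n * real m * \<alpha>\<^sup>2)"
    by (simp_all add: power2_eq_square mult_ac)
  have good: "(\<Sum>t\<in>{t \<in> fine_grid \<tau> (\<alpha> / 8). \<alpha> < \<bar>c + t * (\<alpha> / 8) - \<mu>\<bar>}. fine_prob n m \<epsilon> b \<tau> (\<alpha> / 8) c X t)
        \<le> \<beta> / 4" if X: "X \<in> space (iid_dataset n m D)" "X \<notin> B" for X
  proof -
    let ?f = "(\<Sum>i<n. ?S (X i)) / n" and ?\<kappa> = "\<epsilon> * n / (8 * \<tau>)"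
    have n0: "real n > 0" using n by simp
    have "\<bar>(\<Sum>i<n. ?S (X i)) - n * ?\<mu>S\<bar> < n * (\<alpha> / 8)"
      using X by (auto simp: B_def)
    then have "\<bar>(\<Sum>i<n. ?S (X i)) - n * ?\<mu>S\<bar> / n < \<alpha> / 8"
      using n0 by (simp add: pos_divide_less_eq mult_ac)
    moreover have "\<bar>(\<Sum>i<n. ?S (X i)) - n * ?\<mu>S\<bar> / n = \<bar>?f - ?\<mu>S\<bar>"
    proof -
      have "?f - ?\<mu>S = ((\<Sum>i<n. ?S (X i)) - n * ?\<mu>S) / n" using n0 by (simp add: diff_divide_distrib)
      then show ?thesis using n0 by (simp add: abs_divide)
    qed
    ultimately have close: "\<bar>?f - \<mu>\<bar> \<le> \<alpha> / 4"
      using bias1 bias2 by linarith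
    have "\<bar>(\<Sum>i<n. ?S (X i)) - n * c\<bar> \<le> n * \<tau>"
    proof -
      have "(\<Sum>i<n. ?S (X i)) - n * c = (\<Sum>i<n. ?S (X i) - c)" by (simp add: sum_subtractf)
      also have "\<bar>\<dots>\<bar> \<le> (\<Sum>i<n. \<bar>?S (X i) - c\<bar>)" by (rule sum_abs)
      also have "\<dots> \<le> (\<Sum>i<n. \<tau>)"
        using \<tau>0 by (intro sum_mono) (simp add: person_stat_def abs_clip_center_le)
      finally show ?thesis by simp
    qed
    then have "\<bar>(\<Sum>i<n. ?S (X i)) - n * c\<bar> / n \<le> \<tau>"
      using n0 by (simp add: pos_divide_le_eq mult_ac)
    moreover have "\<bar>(\<Sum>i<n. ?S (X i)) - n * c\<bar> / n = \<bar>?f - c\<bar>"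
    proof -
      have "?f - c = ((\<Sum>i<n. ?S (X i)) - n * c) / n" using n0 by (simp add: diff_divide_distrib)
      then show ?thesis using n0 by (simp add: abs_divide)
    qed
    ultimately have f\<tau>: "\<bar>?f - c\<bar> \<le> \<tau>" by simp
    have \<kappa>: "0 \<le> ?\<kappa>" using \<epsilon> \<tau>0 by simp
    have q: "exp (- (?\<kappa> * (\<alpha> / 8))) \<le> 1 / 2" using noise \<beta> by linarith
    have "(\<Sum>t\<in>{t \<in> fine_grid \<tau> (\<alpha> / 8). \<alpha> < \<bar>c + t * (\<alpha> / 8) - \<mu>\<bar>}. fine_prob n m \<epsilon> b \<tau> (\<alpha> / 8) c X t)
      \<le> (\<Sum>t\<in>{t \<in> fine_grid \<tau> (\<alpha> / 8). 5 * (\<alpha> / 8) < \<bar>c + t * (\<alpha> / 8) - ?f\<bar>}. fine_prob n m \<epsilon> b \<tau> (\<alpha> / 8) c X t)"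
    proof (rule sum_mono2)
      have "finite (fine_grid \<tau> (\<alpha> / 8))" by (simp add: fine_grid_def)
      then show "finite {t \<in> fine_grid \<tau> (\<alpha> / 8). 5 * (\<alpha> / 8) < \<bar>c + t * (\<alpha> / 8) - ?f\<bar>}"
        by (rule finite_subset[rotated]) blast
      have tri: "\<bar>h - \<mu>\<bar> \<le> \<bar>h - ?f\<bar> + \<bar>?f - \<mu>\<bar>" for h by linarith
      show "{t \<in> fine_grid \<tau> (\<alpha> / 8). \<alpha> < \<bar>c + t * (\<alpha> / 8) - \<mu>\<bar>}
          \<subseteq> {t \<in> fine_grid \<tau> (\<alpha> / 8). 5 * (\<alpha> / 8) < \<bar>c + t * (\<alpha> / 8) - ?f\<bar>}"
      proof safe
        fix t :: int assume "\<alpha> < \<bar>c + t * (\<alpha> / 8) - \<mu>\<bar>"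
        then show "5 * (\<alpha> / 8) < \<bar>c + t * (\<alpha> / 8) - ?f\<bar>"
          using tri[of "c + t * (\<alpha> / 8)"] close \<alpha>(1) by argo
      qed
      show "0 \<le> fine_prob n m \<epsilon> b \<tau> (\<alpha> / 8) c X t" for t
        by (simp add: fine_prob_def softmax_def sum_nonneg)
    qed
    also have "\<dots> \<le> 4 * (exp (- (?\<kappa> * (\<alpha> / 8))))\<^sup>2"
      unfolding fine_prob_def using \<alpha> by (intro softmax_lattice_tail \<tau>0 f\<tau> \<kappa> q) simp
    also have "\<dots> \<le> \<beta> / 4"
    proof -
      let ?q = "exp (- (?\<kappa> * (\<alpha> / 8)))"
      have "?q * ?q \<le> (1 / 2) * (\<beta> / 16)" using q noise by (intro mult_mono) auto
      moreover have "0 \<le> \<beta>" using noise exp_ge_zero[of "- (?\<kappa> * (\<alpha> / 8))"] by linarith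
      ultimately show ?thesis by (simp add: power2_eq_square)
    qed
    finally show ?thesis .
  qed
  show ?thesis
    by (rule bexI[OF _ B(1)]) (use B(2) good in blast)
qed

end

lemma card_near_grid:
  fixes r \<mu> :: real
  assumes r: "r > 0"
  shows "card {j \<in> coarse_grid R r. \<bar>j * r - \<mu>\<bar> \<le> 3 * r} \<le> 7"
proof -
  let ?x = "\<mu> / r"
  have "{j \<in> coarse_grid R r. \<bar>j * r - \<mu>\<bar> \<le> 3 * r} \<subseteq> {\<lceil>?x - 3\<rceil>..\<lfloor>?x + 3\<rfloor>}"
  proof safe
    fix j :: int assume j: "\<bar>j * r - \<mu>\<bar> \<le> 3 * r"
    then have "?x - 3 \<le> j" "j \<le> ?x + 3" using r by (auto simp: field_simps abs_le_iff)
    then show "j \<in> {\<lceil>?x - 3\<rceil>..\<lfloor>?x + 3\<rfloor>}"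
      unfolding atLeastAtMost_iff ceiling_le_iff le_floor_iff by simp
  qed
  then have "card {j \<in> coarse_grid R r. \<bar>j * r - \<mu>\<bar> \<le> 3 * r} \<le> card {\<lceil>?x - 3\<rceil>..\<lfloor>?x + 3\<rfloor>}"
    by (intro card_mono) auto
  also have "\<dots> \<le> 7"
  proof -
    have "\<lfloor>?x + 3\<rfloor> - \<lceil>?x - 3\<rceil> \<le> 6" by linarith
    then show ?thesis unfolding card_atLeastAtMost_int by linarith
  qed
  finally show ?thesis .
qed

text \<open>No sample splitting is needed between the two stages: the coarse stage outputs one of at most
  seven grid points near the mean, and a union bound over these replaces independence.\<close>

lemma (in bounded_moment) two_stage_accuracy:
  fixes \<alpha> \<beta> \<epsilon> r b \<tau> :: real
  assumes m: "m \<ge> 1" and n: "n \<ge> 1" and R: "R > 0" and \<alpha>: "0 < \<alpha>" "\<alpha> < 12 / sqrt m"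
    and \<epsilon>: "\<epsilon> > 0" and \<beta>: "0 < \<beta>" "\<beta> < 1"
    and variance: "10752 \<le> real n * real m * \<alpha>\<^sup>2 * \<beta>"
  defines "r \<equiv> 4 / sqrt m" and "b \<equiv> clip_radius k m \<alpha>" and "\<tau> \<equiv> person_radius k m \<alpha>"
  assumes coarse: "card (coarse_grid R r) * exp (- (\<epsilon> * n / 8)) \<le> \<beta> / 4"
    and noise: "exp (- (\<epsilon> * n / (8 * \<tau>) * (\<alpha> / 8))) \<le> \<beta> / 16"
  shows "1 - \<beta> \<le> success_prob n m D (coarse_grid R r \<times> fine_grid \<tau> (\<alpha> / 8))
    (\<lambda>(j, t). real_of_int j * r + real_of_int t * (\<alpha> / 8))
    (\<lambda>X (j, t). coarse_prob n m \<epsilon> R r X j * fine_prob n m \<epsilon> b \<tau> (\<alpha> / 8) (j * r) X t) \<alpha>"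
proof -
  interpret P: prob_space "iid_dataset n m D" by (rule prob_space_iid_dataset[OF prob_space_axioms])
  let ?M = "iid_dataset n m D" and ?C = "coarse_grid R r" and ?T = "fine_grid \<tau> (\<alpha> / 8)"
  let ?p = "coarse_prob n m \<epsilon> R r" and ?q = "\<lambda>j. fine_prob n m \<epsilon> b \<tau> (\<alpha> / 8) (j * r)"
  have sm: "sqrt m > 0" using m by simp
  have r: "r > 0" "3 * r = 12 / sqrt m" "16 \<le> m * r\<^sup>2"
    using sm m by (auto simp: r_def power_divide)
  have \<tau>0: "\<tau> > 0"
    unfolding \<tau>_def by (rule less_le_trans[OF _ person_radius_ge[OF k m]]) (use sm in simp)
  have p: "finite_mechanism n m (\<epsilon> / 2) ?C ?p" by (rule finite_mechanism_coarse[OF R r(1) \<epsilon>])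
  have q: "finite_mechanism n m (\<epsilon> / 2) ?T (?q j)" for j
    by (rule finite_mechanism_fine[OF \<tau>0 _ \<epsilon> n]) (use \<alpha> in simp)
  have pq: "finite_mechanism n m (\<epsilon> / 2 + \<epsilon> / 2) (?C \<times> ?T) (\<lambda>X (j, t). ?p X j * ?q j X t)"
    by (rule finite_mechanism_compose[OF p q])
  have fin: "finite ?C" "finite ?T" by (simp_all add: coarse_grid_def fine_grid_def)
  have nn: "0 \<le> ?p X j" "0 \<le> ?q j X t" for X j t
    by (simp_all add: coarse_prob_def fine_prob_def softmax_def sum_nonneg)
  have nm: "0 < real n * real m * \<alpha>\<^sup>2" using n m \<alpha> by simp
  obtain B0 where B0: "B0 \<in> sets ?M" "measure ?M B0 \<le> 128 / (real n * real m * r\<^sup>2)"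
    and good0: "\<forall>X\<in>space ?M - B0.
      (\<Sum>j\<in>{j \<in> ?C. 3 * r < \<bar>j * r - \<mu>\<bar>}. ?p X j) \<le> card ?C * exp (- (\<epsilon> * n / 8))"
    using coarse_accuracy[OF m r(1) r(3) \<epsilon> n] by (elim bexE conjE) (rule that)
  let ?G = "{j \<in> ?C. \<bar>j * r - \<mu>\<bar> \<le> 3 * r}" and ?F = "{j \<in> ?C. 3 * r < \<bar>j * r - \<mu>\<bar>}"
  let ?bad = "\<lambda>j. {t \<in> ?T. \<alpha> < \<bar>j * r + t * (\<alpha> / 8) - \<mu>\<bar>}"
  have "\<forall>j\<in>?G. \<exists>B. B \<in> sets ?M \<and> measure ?M B \<le> 384 / (real n * real m * \<alpha>\<^sup>2) \<and>
    (\<forall>X\<in>space ?M - B. (\<Sum>t\<in>?bad j. ?q j X t) \<le> \<beta> / 4)"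
  proof
    fix j assume "j \<in> ?G"
    then have "\<bar>j * r - \<mu>\<bar> \<le> 12 / sqrt m" using r(2) by simp
    from fine_accuracy[OF m n \<alpha> this \<epsilon> \<beta>(2) noise[unfolded \<tau>_def]]
    show "\<exists>B. B \<in> sets ?M \<and> measure ?M B \<le> 384 / (real n * real m * \<alpha>\<^sup>2) \<and>
      (\<forall>X\<in>space ?M - B. (\<Sum>t\<in>?bad j. ?q j X t) \<le> \<beta> / 4)"
      unfolding \<tau>_def b_def Bex_def .
  qed
  from bchoice[OF this] obtain B :: "int \<Rightarrow> (nat \<Rightarrow> nat \<Rightarrow> real) set" where B':
    "\<forall>j\<in>?G. B j \<in> sets ?M \<and> measure ?M (B j) \<le> 384 / (real n * real m * \<alpha>\<^sup>2) \<and>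
      (\<forall>X\<in>space ?M - B j. (\<Sum>t\<in>?bad j. ?q j X t) \<le> \<beta> / 4)" ..
  have B: "B j \<in> sets ?M" "measure ?M (B j) \<le> 384 / (real n * real m * \<alpha>\<^sup>2)" if "j \<in> ?G" for j
    using bspec[OF B' that] by auto
  have good: "(\<Sum>t\<in>?bad j. ?q j X t) \<le> \<beta> / 4" if "j \<in> ?G" "X \<in> space ?M" "X \<notin> B j" for j X
    using bspec[OF B' that(1)] that(2,3) by auto
  let ?U = "\<Union>j\<in>?G. B j"
  have U: "?U \<in> sets ?M" using fin B by (intro sets.finite_UN) auto
  \<comment> \<open>This fixes the constant 10752 = 384 * 28: at most seven near grid points share a
    failure budget of \<beta>/4.\<close>
  have small: "384 / (real n * real m * \<alpha>\<^sup>2) \<le> \<beta> / 28"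
    using variance nm by (simp add: pos_divide_le_eq mult_ac)
  have mU: "measure ?M ?U \<le> \<beta> / 4"
  proof -
    have "measure ?M ?U \<le> (\<Sum>j\<in>?G. measure ?M (B j))"
      using fin B by (intro P.finite_measure_subadditive_finite) auto
    also have "\<dots> \<le> of_nat (card ?G) * (\<beta> / 28)"
      by (rule sum_bounded_above) (rule order_trans[OF B(2) small])
    also have "\<dots> \<le> 7 * (\<beta> / 28)"
      using card_near_grid[OF r(1), of R \<mu>] \<beta> by (intro mult_right_mono) auto
    finally show ?thesis by simp
  qed
  have m0: "measure ?M B0 \<le> \<beta> / 4"
  proof -
    \<comment> \<open>As \<alpha> is below \<open>3 * r\<close>, the variance hypothesis at scale
      \<alpha> also controls the coarse stage at scale \<open>r\<close>.\<close>
    have "\<alpha>\<^sup>2 \<le> (3 * r)\<^sup>2" using \<alpha> r by (intro power_mono) auto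
    then have "\<alpha>\<^sup>2 \<le> 9 * r\<^sup>2" by (simp add: power_mult_distrib)
    then have "real n * real m * \<alpha>\<^sup>2 \<le> 9 * (real n * real m * r\<^sup>2)"
      using mult_left_mono[of "\<alpha>\<^sup>2" "9 * r\<^sup>2" "real n * real m"] by simp
    then have "128 / (real n * real m * r\<^sup>2) \<le> 128 / (real n * real m * \<alpha>\<^sup>2 / 9)"
      using nm n m r by (intro divide_left_mono) auto
    also have "\<dots> \<le> \<beta> / 4" using variance nm \<beta> by (simp add: pos_divide_le_eq mult_ac)
    finally show ?thesis using B0(2) by simp
  qed
  have "1 - \<beta> / 2 - \<beta> / 2 \<le> success_prob n m D (?C \<times> ?T) (\<lambda>(j, t). real_of_int j * r + real_of_int t * (\<alpha> / 8))
      (\<lambda>X (j, t). ?p X j * ?q j X t) \<alpha>"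
  proof (rule success_prob_ge[OF pq prob_space_axioms sets_D, of "B0 \<union> ?U"])
    show "B0 \<union> ?U \<in> sets ?M" using B0 U by blast
    show "measure ?M (B0 \<union> ?U) \<le> \<beta> / 2"
      using measure_Un_le[OF B0(1) U] m0 mU by linarith
    show "0 \<le> \<beta> / 2" using \<beta> by simp
    fix X assume X: "X \<in> space ?M" "X \<notin> B0 \<union> ?U"
    have "(\<Sum>x\<in>{x \<in> ?C \<times> ?T. \<alpha> < \<bar>(case x of (j, t) \<Rightarrow> real_of_int j * r + real_of_int t * (\<alpha> / 8)) - \<mu>\<bar>}.
        case x of (j, t) \<Rightarrow> ?p X j * ?q j X t) = (\<Sum>x\<in>Sigma ?C ?bad. case x of (j, t) \<Rightarrow> ?p X j * ?q j X t)"
      by (intro sum.cong) auto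
    also have "\<dots> = (\<Sum>j\<in>?C. ?p X j * (\<Sum>t\<in>?bad j. ?q j X t))"
      using fin by (subst sum.Sigma[symmetric]) (auto simp: sum_distrib_left)
    also have "\<dots> = (\<Sum>j\<in>?F \<union> ?G. ?p X j * (\<Sum>t\<in>?bad j. ?q j X t))"
      by (intro sum.cong) auto
    also have "\<dots> = (\<Sum>j\<in>?F. ?p X j * (\<Sum>t\<in>?bad j. ?q j X t)) + (\<Sum>j\<in>?G. ?p X j * (\<Sum>t\<in>?bad j. ?q j X t))"
      using fin by (intro sum.union_disjoint) auto
    \<comment> \<open>A far choice counts as failure whatever the fine stage does; at a near choice
      the fine stage fails with probability at most \<beta>/4.\<close>
    also have "\<dots> \<le> (\<Sum>j\<in>?F. ?p X j * 1) + (\<Sum>j\<in>?G. ?p X j * (\<beta> / 4))"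
      using X good nn by (intro add_mono sum_mono mult_left_mono finite_mechanism_le_1[OF q]) auto
    also have "\<dots> \<le> \<beta> / 4 + 1 * (\<beta> / 4)"
    proof (intro add_mono)
      show "(\<Sum>j\<in>?F. ?p X j * 1) \<le> \<beta> / 4" using bspec[OF good0, of X] X coarse by simp
      show "(\<Sum>j\<in>?G. ?p X j * (\<beta> / 4)) \<le> 1 * (\<beta> / 4)"
        unfolding sum_distrib_right[symmetric] using \<beta>
        by (intro mult_right_mono finite_mechanism_le_1[OF p]) auto
    qed
    finally show "(\<Sum>x\<in>{x \<in> ?C \<times> ?T. \<alpha> < \<bar>(case x of (j, t) \<Rightarrow> real_of_int j * r + real_of_int t * (\<alpha> / 8)) - \<mu>\<bar>}.
        case x of (j, t) \<Rightarrow> ?p X j * ?q j X t) \<le> \<beta> / 2"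
      by simp
  qed
  then show ?thesis by simp
qed

text \<open>Grid width \<alpha>/3 makes the coarse error \<open>3 * r\<close> equal to \<alpha>, and
  \<open>12 / sqrt m \<le> \<alpha>\<close> is the resolution condition
  \<open>16 \<le> m * r\<^sup>2\<close>.\<close>

lemma (in bounded_moment) coarse_stage_accuracy:
  fixes \<alpha> \<beta> \<epsilon> :: real
  assumes m: "m \<ge> 1" and n: "n \<ge> 1" and R: "R > 0" and \<alpha>: "0 < \<alpha>" "12 / sqrt m \<le> \<alpha>"
    and \<epsilon>: "\<epsilon> > 0" and \<beta>: "0 < \<beta>" "\<beta> < 1"
    and variance: "10752 \<le> real n * real m * \<alpha>\<^sup>2 * \<beta>"
    and coarse: "card (coarse_grid R (\<alpha> / 3)) * exp (- (\<epsilon> * n / 8)) \<le> \<beta> / 4"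
  shows "1 - \<beta> \<le> success_prob n m D (coarse_grid R (\<alpha> / 3)) (\<lambda>j. real_of_int j * (\<alpha> / 3))
    (coarse_prob n m \<epsilon> R (\<alpha> / 3)) \<alpha>"
proof -
  have r: "\<alpha> / 3 > 0" using \<alpha> by simp
  have "4 / sqrt m \<le> \<alpha> / 3" using \<alpha> by simp
  then have "(4 / sqrt m)\<^sup>2 \<le> (\<alpha> / 3)\<^sup>2" by (intro power_mono) auto
  then have r2: "16 \<le> m * (\<alpha> / 3)\<^sup>2" using m by (simp add: power_divide field_simps)
  obtain B where B: "B \<in> sets (iid_dataset n m D)"
      "measure (iid_dataset n m D) B \<le> 128 / (real n * real m * (\<alpha> / 3)\<^sup>2)"
    and good: "\<forall>X\<in>space (iid_dataset n m D) - B.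
      (\<Sum>j\<in>{j \<in> coarse_grid R (\<alpha> / 3). 3 * (\<alpha> / 3) < \<bar>j * (\<alpha> / 3) - \<mu>\<bar>}. coarse_prob n m \<epsilon> R (\<alpha> / 3) X j)
        \<le> card (coarse_grid R (\<alpha> / 3)) * exp (- (\<epsilon> * n / 8))"
    using coarse_accuracy[OF m r r2 \<epsilon> n] by (elim bexE conjE) (rule that)
  have "0 < real n * real m * \<alpha>\<^sup>2" using n m \<alpha> by simp
  then have "128 / (real n * real m * (\<alpha> / 3)\<^sup>2) \<le> \<beta> / 4"
    using variance \<beta> by (simp add: power_divide pos_divide_le_eq mult_ac)
  then have "measure (iid_dataset n m D) B \<le> \<beta> / 4" using B by linarith
  then have "1 - \<beta> / 4 - \<beta> / 4 \<le> success_prob n m D (coarse_grid R (\<alpha> / 3)) (\<lambda>j. real_of_int j * (\<alpha> / 3))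
      (coarse_prob n m \<epsilon> R (\<alpha> / 3)) \<alpha>"
  proof (rule success_prob_ge[OF finite_mechanism_coarse[OF R r \<epsilon>] prob_space_axioms sets_D B(1)])
    fix X assume "X \<in> space (iid_dataset n m D)" "X \<notin> B"
    then show "(\<Sum>j\<in>{j \<in> coarse_grid R (\<alpha> / 3). \<alpha> < \<bar>j * (\<alpha> / 3) - \<mu>\<bar>}. coarse_prob n m \<epsilon> R (\<alpha> / 3) X j) \<le> \<beta> / 4"
      using bspec[OF good, of X] coarse by simp
  qed (use \<beta> in simp)
  then show ?thesis using \<beta> by linarith
qed

lemma card_coarse_grid_le:
  fixes R r :: real and m :: nat
  assumes "R > 0" "m \<ge> 1" "4 / sqrt m \<le> r"
  shows "card (coarse_grid R r) \<le> R * m + 3"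
proof -
  have sm: "1 \<le> sqrt m" using assms by simp
  then have "0 < 4 / sqrt m" by simp
  then have r: "0 < r" using assms(3) by (rule less_le_trans)
  have "R / r \<le> R / (4 / sqrt m)"
    using assms sm r by (intro divide_left_mono mult_pos_pos) auto
  also have "\<dots> = R * sqrt m / 4" by simp
  also have "sqrt m \<le> m" using sm mult_right_mono[of 1 "sqrt m" "sqrt m"] by simp
  finally have "R / r \<le> R * m / 4" using assms by simp
  moreover have "0 \<le> R * m" using assms by simp
  ultimately show ?thesis using card_coarse_grid[OF assms(1) r] by linarith
qed

section \<open>Combining the one-stage and two-stage regimes\<close>

lemma mean_estimation_mechanism:
  fixes k R \<alpha> \<beta> \<epsilon> :: real
  assumes k: "2 \<le> k" and m: "m \<ge> 1" and n: "n \<ge> 1" and R: "R > 0" and \<alpha>: "0 < \<alpha>"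
    and \<epsilon>: "\<epsilon> > 0" and \<beta>: "0 < \<beta>" "\<beta> < 1"
    and variance: "10752 \<le> real n * real m * \<alpha>\<^sup>2 * \<beta>"
    and coarse: "(R * m + 3) * exp (- (\<epsilon> * n / 8)) \<le> \<beta> / 4"
    and noise: "exp (- (\<epsilon> * n / (8 * person_radius k m \<alpha>) * (\<alpha> / 8))) \<le> \<beta> / 16"
  obtains J :: "(int \<times> int) set" and g p where "finite_mechanism n m \<epsilon> J p"
    "\<And>D. bounded_moment_distribution k R D \<Longrightarrow> 1 - \<beta> \<le> success_prob n m D J g p \<alpha>"
proof (cases "\<alpha> < 12 / sqrt m")
  case True
  let ?r = "4 / sqrt m" and ?\<tau> = "person_radius k m \<alpha>"
  have sm: "sqrt m > 0" using m by simp
  then have r: "?r > 0" by simp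
  have \<tau>0: "?\<tau> > 0"
    by (rule less_le_trans[OF _ person_radius_ge[OF k m]]) (use sm in simp)
  have card: "card (coarse_grid R ?r) * exp (- (\<epsilon> * n / 8)) \<le> \<beta> / 4"
    using mult_right_mono[OF card_coarse_grid_le[OF R m order_refl] exp_ge_zero[of "- (\<epsilon> * n / 8)"]] coarse
    by linarith
  have "finite_mechanism n m (\<epsilon> / 2 + \<epsilon> / 2) (coarse_grid R ?r \<times> fine_grid ?\<tau> (\<alpha> / 8))
    (\<lambda>X (j, t). coarse_prob n m \<epsilon> R ?r X j * fine_prob n m \<epsilon> (clip_radius k m \<alpha>) ?\<tau> (\<alpha> / 8) (j * ?r) X t)"
    using \<alpha> by (intro finite_mechanism_compose finite_mechanism_coarse[OF R r \<epsilon>] finite_mechanism_fine[OF \<tau>0 _ \<epsilon> n]) simp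
  then have mech: "finite_mechanism n m \<epsilon> (coarse_grid R ?r \<times> fine_grid ?\<tau> (\<alpha> / 8))
    (\<lambda>X (j, t). coarse_prob n m \<epsilon> R ?r X j * fine_prob n m \<epsilon> (clip_radius k m \<alpha>) ?\<tau> (\<alpha> / 8) (j * ?r) X t)"
    by simp
  show ?thesis
  proof (rule that[OF mech, where g = "\<lambda>(j, t). real_of_int j * ?r + real_of_int t * (\<alpha> / 8)"])
    fix D assume "bounded_moment_distribution k R D"
    then interpret bounded_moment k R D using k by unfold_locales
    show "1 - \<beta> \<le> success_prob n m D (coarse_grid R ?r \<times> fine_grid ?\<tau> (\<alpha> / 8)) (\<lambda>(j, t). real_of_int j * ?r + real_of_int t * (\<alpha> / 8))
      (\<lambda>X (j, t). coarse_prob n m \<epsilon> R ?r X j * fine_prob n m \<epsilon> (clip_radius k m \<alpha>) ?\<tau> (\<alpha> / 8) (j * ?r) X t) \<alpha>"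
      by (rule two_stage_accuracy[OF m n R \<alpha> True \<epsilon> \<beta> variance card noise])
  qed
next
  case False
  let ?r = "\<alpha> / 3"
  have r: "?r > 0" "4 / sqrt m \<le> ?r" "12 / sqrt m \<le> \<alpha>" using \<alpha> False by (auto simp: not_less)
  have card: "card (coarse_grid R ?r) * exp (- (\<epsilon> * n / 8)) \<le> \<beta> / 4"
    using mult_right_mono[OF card_coarse_grid_le[OF R m r(2)] exp_ge_zero[of "- (\<epsilon> * n / 8)"]] coarse
    by linarith
  \<comment> \<open>A dummy second index gives both regimes the same index type.\<close>
  have pair: "success_prob n m D (coarse_grid R ?r \<times> {0::int}) (\<lambda>(j, t). real_of_int j * ?r)
      (\<lambda>X (j, t). coarse_prob n m \<epsilon> R ?r X j * 1) \<alpha>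
    = success_prob n m D (coarse_grid R ?r) (\<lambda>j. real_of_int j * ?r) (coarse_prob n m \<epsilon> R ?r) \<alpha>" for D
  proof -
    have "(\<Sum>x\<in>A \<times> {0::int}. h x) = (\<Sum>j\<in>A. h (j, 0))" for A :: "int set" and h :: "int \<times> int \<Rightarrow> real"
      by (rule sum.reindex_bij_witness[of _ "\<lambda>j. (j, 0)" fst]) auto
    then show ?thesis unfolding success_prob_def by simp
  qed
  have "finite_mechanism n m (\<epsilon> / 2 + 0) (coarse_grid R ?r \<times> {0::int}) (\<lambda>X (j, t). coarse_prob n m \<epsilon> R ?r X j * 1)"
    by (intro finite_mechanism_compose finite_mechanism_coarse[OF R r(1) \<epsilon>]) (simp add: finite_mechanism_def)
  then have mech: "finite_mechanism n m \<epsilon> (coarse_grid R ?r \<times> {0::int}) (\<lambda>X (j, t). coarse_prob n m \<epsilon> R ?r X j * 1)"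
    by (rule finite_mechanism_mono) (use \<epsilon> in simp)
  show ?thesis
  proof (rule that[OF mech, where g = "\<lambda>(j, t). real_of_int j * ?r"])
    fix D assume "bounded_moment_distribution k R D"
    then interpret bounded_moment k R D using k by unfold_locales
    show "1 - \<beta> \<le> success_prob n m D (coarse_grid R ?r \<times> {0::int}) (\<lambda>(j, t). real_of_int j * ?r)
      (\<lambda>X (j, t). coarse_prob n m \<epsilon> R ?r X j * 1) \<alpha>"
      unfolding pair by (rule coarse_stage_accuracy[OF m n R \<alpha> r(3) \<epsilon> \<beta> variance card])
  qed
qed

section \<open>The sample rate\<close>

text \<open>The factor that multiplies \<open>ln (1 / \<beta>) / \<epsilon>\<close> in the two
  middle terms of \<open>sample_rate\<close>.\<close>

definition noise_scale :: "real \<Rightarrow> nat \<Rightarrow> real \<Rightarrow> real" where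
  "noise_scale k m \<alpha> = 1 / (\<alpha> * sqrt m) + 1 / (\<alpha> powr (k / (k - 1)) * m)"

lemma noise_scale_pos: "\<alpha> > 0 \<Longrightarrow> m \<ge> 1 \<Longrightarrow> noise_scale k m \<alpha> > 0"
  by (simp add: noise_scale_def add_pos_pos)

lemma conjugate_exponent_bounds:
  fixes k :: real
  assumes "2 \<le> k"
  shows "1 \<le> k / (k - 1)" "k / (k - 1) \<le> 2" "k / (k - 1) = 1 + 1 / (k - 1)" "1 / (k - 1) \<le> 1"
  using assms by (auto simp: field_simps)

text \<open>Here the exponent of the rate appears: the radius is of order
  \<open>(\<alpha> powr (- 1 / (k - 1)) + sqrt m) / m\<close> up to \<open>1 + ln m\<close>, and
  dividing by \<alpha> turns \<open>1 / (k - 1)\<close> into \<open>k / (k - 1)\<close>.\<close>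

lemma person_radius_le:
  assumes k: "2 \<le> k" and m: "m \<ge> 1" and \<alpha>: "\<alpha> > 0"
  shows "person_radius k m \<alpha> \<le> 128 * (k + 1) * (1 + ln m) * (noise_scale k m \<alpha> * \<alpha>)"
proof -
  have sm: "sqrt m > 0" using m by simp
  let ?e = "1 / (k - 1)"
  have "(16::real) powr ?e \<le> 16 powr 1"
    using conjugate_exponent_bounds[OF k] by (intro powr_mono) auto
  then have "(16 / \<alpha>) powr ?e \<le> 16 * (1 / \<alpha> powr ?e)"
    using \<alpha> by (simp add: powr_divide divide_right_mono)
  then have b: "clip_radius k m \<alpha> \<le> 32 * (1 / \<alpha> powr ?e + sqrt m)"
    using sm unfolding clip_radius_def distrib_left by linarith
  have ns: "noise_scale k m \<alpha> * \<alpha> = (1 / \<alpha> powr ?e + sqrt m) / m"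
  proof -
    have "\<alpha> powr (k / (k - 1)) = \<alpha> * \<alpha> powr ?e"
      using \<alpha> by (simp add: conjugate_exponent_bounds(3)[OF k] powr_add)
    moreover have "1 / sqrt m = sqrt m / m"
      using m by (simp add: real_div_sqrt field_simps)
    ultimately show ?thesis
      using \<alpha> by (simp add: noise_scale_def distrib_right add_divide_distrib)
  qed
  have lm: "0 \<le> ln m" using m by simp
  have "k * (1 + ln m) + 1 \<le> (k + 1) * (1 + ln m)" using lm by (simp add: algebra_simps)
  moreover have "0 \<le> clip_radius k m \<alpha>" using clip_radius_sqrt[of m k \<alpha>] sm by linarith
  ultimately have "4 * (k * (1 + ln m) + 1) * clip_radius k m \<alpha>
      \<le> 4 * ((k + 1) * (1 + ln m)) * (32 * (1 / \<alpha> powr ?e + sqrt m))"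
    using b k lm by (intro mult_mono) auto
  then have "person_radius k m \<alpha> \<le> 4 * ((k + 1) * (1 + ln m)) * (32 * (1 / \<alpha> powr ?e + sqrt m)) / m"
    unfolding person_radius_def by (intro divide_right_mono) auto
  also have "\<dots> = 128 * (k + 1) * (1 + ln m) * (noise_scale k m \<alpha> * \<alpha>)"
  proof -
    have "4 * (u * v) * (32 * w) / z = 128 * u * v * (w / z)" for u v w z :: real by simp
    then show ?thesis unfolding ns .
  qed
  finally show ?thesis .
qed

lemma mean_estimation_mechanism_log:
  fixes k R \<alpha> \<beta> \<epsilon> :: real
  assumes k: "2 \<le> k" and m: "m \<ge> 1" and R: "R > 0" and \<alpha>: "0 < \<alpha>"
    and \<epsilon>: "\<epsilon> > 0" and \<beta>: "0 < \<beta>" "\<beta> < 1"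
    and variance: "10752 \<le> real n * real m * \<alpha>\<^sup>2 * \<beta>"
    and noise: "8192 * (k + 1) * (1 + ln m) * (noise_scale k m \<alpha> * ln (16 / \<beta>)) \<le> \<epsilon> * n"
    and coarse: "8 * ln (4 * (R * m + 3) / \<beta>) \<le> \<epsilon> * n"
  obtains J :: "(int \<times> int) set" and g p where "finite_mechanism n m \<epsilon> J p"
    "\<And>D. bounded_moment_distribution k R D \<Longrightarrow> 1 - \<beta> \<le> success_prob n m D J g p \<alpha>"
proof (rule mean_estimation_mechanism[OF k m _ R \<alpha> \<epsilon> \<beta> variance])
  show "n \<ge> 1" using variance by (cases n) auto
  have Rm: "0 \<le> R * m" using R by simp
  have "ln (4 * (R * m + 3) / \<beta>) \<le> \<epsilon> * n / 8" using coarse by simp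
  then have "exp (- (\<epsilon> * n / 8)) \<le> exp (- ln (4 * (R * m + 3) / \<beta>))" by simp
  also have "\<dots> = \<beta> / (4 * (R * m + 3))"
    using Rm \<beta> by (simp add: exp_minus)
  finally have "(R * m + 3) * exp (- (\<epsilon> * n / 8)) \<le> (R * m + 3) * (\<beta> / (4 * (R * m + 3)))"
    using Rm by (intro mult_left_mono) auto
  also have "\<dots> = \<beta> / 4" using Rm by (simp add: field_simps)
  finally show "(R * m + 3) * exp (- (\<epsilon> * n / 8)) \<le> \<beta> / 4" .
  let ?\<tau> = "person_radius k m \<alpha>"
  have sm: "sqrt m > 0" using m by simp
  have \<tau>0: "?\<tau> > 0"
    by (rule less_le_trans[OF _ person_radius_ge[OF k m]]) (use sm in simp)
  have l16: "0 \<le> ln (16 / \<beta>)" using \<beta> by simp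
  \<comment> \<open>64 combines the 8 in the slope with the lattice width \<alpha>/8; with the 128
    of \<open>person_radius_le\<close> it gives 8192.\<close>
  have "64 * ?\<tau> * ln (16 / \<beta>) \<le> 64 * (128 * (k + 1) * (1 + ln m) * (noise_scale k m \<alpha> * \<alpha>)) * ln (16 / \<beta>)"
    using l16 person_radius_le[OF k m \<alpha>] by (intro mult_right_mono mult_left_mono) auto
  also have "\<dots> = (8192 * (k + 1) * (1 + ln m) * (noise_scale k m \<alpha> * ln (16 / \<beta>))) * \<alpha>"
    by simp
  also have "\<dots> \<le> (\<epsilon> * n) * \<alpha>"
    using \<alpha> by (intro mult_right_mono noise) simp
  finally have "ln (16 / \<beta>) \<le> \<epsilon> * n / (8 * ?\<tau>) * (\<alpha> / 8)"
    using \<tau>0 by (simp add: pos_le_divide_eq mult_ac)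
  then have "exp (- (\<epsilon> * n / (8 * ?\<tau>) * (\<alpha> / 8))) \<le> exp (- ln (16 / \<beta>))" by simp
  also have "\<dots> = \<beta> / 16" using \<beta> by (simp add: exp_minus)
  finally show "exp (- (\<epsilon> * n / (8 * ?\<tau>) * (\<alpha> / 8))) \<le> \<beta> / 16" .
qed (rule that)

text \<open>The term \<open>ln (R m / \<beta>)\<close> is negative for small \<open>R\<close>. Since \<open>\<alpha> < R\<close>, it is compensated
  by the terms containing \<open>1 / \<alpha>\<close>.\<close>

lemma log_terms_lower_bound:
  fixes k R \<alpha> \<beta> :: real
  assumes k: "2 \<le> k" and m: "m \<ge> 1" and \<alpha>: "0 < \<alpha>" "\<alpha> < R" and \<beta>: "0 < \<beta>" "\<beta> < 1"
    and R: "\<alpha> \<le> 4 * R * ln (1 / \<beta>)"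
  defines "a \<equiv> ln (1 / \<beta>) * noise_scale k m \<alpha>" and "S \<equiv> ln (1 / \<beta>) * noise_scale k m \<alpha> + ln (R * m / \<beta>)"
  shows "a / 10 + ln (1 / \<beta>) \<le> S" "(1 + max 0 (ln (R * m))) / 20 + ln (1 / \<beta>) \<le> S"
proof -
  let ?L = "ln (1 / \<beta>)"
  define y where "y = R * m"
  have m1: "1 \<le> real m" "1 \<le> sqrt m" using m by simp_all
  have y: "y > 0" "R \<le> y" using \<alpha> m1 by (simp_all add: y_def)
  have L: "?L > 0" using \<beta> by simp
  have S: "S = a + ln y + ?L"
    using y \<beta> by (simp add: S_def a_def y_def[symmetric] ln_div)
  have z: "1 / (4 * y) \<le> ?L / (\<alpha> * m)"
  proof -
    have "\<alpha> * real m \<le> (4 * R * ?L) * real m" using R by (intro mult_right_mono) auto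
    then show ?thesis using y \<alpha> m1 by (simp add: y_def field_simps)
  qed
  have t1: "?L / (\<alpha> * m) \<le> ?L * (1 / (\<alpha> * sqrt m))"
  proof -
    have "sqrt m \<le> m" using m1 mult_right_mono[of 1 "sqrt m" "sqrt m"] by simp
    then have "?L / (\<alpha> * m) \<le> ?L / (\<alpha> * sqrt m)"
      using L \<alpha> m1 by (intro divide_left_mono mult_left_mono mult_pos_pos) auto
    then show ?thesis by simp
  qed
  have t2: "0 \<le> ?L * (1 / (\<alpha> powr (k / (k - 1)) * m))"
    using L by simp
  have a_eq: "a = ?L * (1 / (\<alpha> * sqrt m)) + ?L * (1 / (\<alpha> powr (k / (k - 1)) * m))"
    by (simp add: a_def noise_scale_def distrib_left)
  have a4: "1 / (4 * y) \<le> a" using z t1 t2 unfolding a_eq by linarith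
  have a0: "a \<ge> 0" using a4 y by (auto intro: order_trans[rotated])
  have key: "a / 10 \<le> a + ln y \<and> (1 + max 0 (ln y)) / 20 \<le> a + ln y"
  proof (cases "y < 1")
    case True
    \<comment> \<open>For \<alpha> below 1 the second summand of \<open>a\<close> obeys the same
      lower bound as the first, so \<open>a \<ge> 1 / (2 * y)\<close>. This doubling is essential:
      \<open>- ln y\<close> can reach \<open>exp (- 1) / y\<close>, which exceeds
      \<open>1 / (4 * y)\<close> but not \<open>1 / (2 * y)\<close>.\<close>
    then have "\<alpha> < 1" using \<alpha> y by linarith
    then have "\<alpha> powr (k / (k - 1)) \<le> \<alpha> powr 1"
      using \<alpha> conjugate_exponent_bounds[OF k] by (intro powr_mono') auto
    then have "?L / (\<alpha> * m) \<le> ?L / (\<alpha> powr (k / (k - 1)) * m)"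
      using L \<alpha> m1 by (intro divide_left_mono mult_right_mono mult_pos_pos) auto
    then have a2: "1 / (2 * y) \<le> a" using z t1 unfolding a_eq by simp
    \<comment> \<open>9/20 lies between 1/e and 1/2; the gap to 1/2 leaves the share
      \<open>a / 10\<close>.\<close>
    have e: "9 / 20 \<ge> exp (- 1 :: real)"
    proof -
      have "(20 / 9 :: real) \<le> 1 + 1 + 1\<^sup>2 / 2" by simp
      also have "\<dots> \<le> exp 1" by (rule exp_lower_Taylor_quadratic) simp
      finally show ?thesis by (simp add: exp_minus field_simps)
    qed
    have "- ln y \<le> (9 / 20) / y"
    proof -
      have "ln ((9 / 20) / y) \<le> (9 / 20) / y - 1" using y by (intro ln_le_minus_one) simp
      moreover have "ln ((9 / 20) / y) = ln (9 / 20) - ln y" using y by (subst ln_div) auto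
      moreover have "- 1 \<le> ln (9 / 20 :: real)" using e by (subst ln_ge_iff) auto
      ultimately show ?thesis by linarith
    qed
    also have "\<dots> = (9 / 10) * (1 / (2 * y))" by simp
    also have "\<dots> \<le> (9 / 10) * a" using a2 by (intro mult_left_mono) auto
    finally have A: "a / 10 \<le> a + ln y" by simp
    have "1 / 2 \<le> 1 / (2 * y)" using True y by (simp add: field_simps)
    then have "1 / 20 \<le> a / 10" using a2 by linarith
    moreover have "ln y \<le> 0" using True y by simp
    ultimately show ?thesis using A by (simp add: max_def)
  next
    case False
    then have l: "0 \<le> ln y" by simp
    have "ln (1 / y) \<le> 1 / y - 1" using y by (intro ln_le_minus_one) simp
    then have "1 - 1 / y \<le> ln y" using y by (simp add: ln_div)
    moreover have "1 / y \<le> 1" using False by simp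
    moreover have "1 / (4 * y) = (1 / 4) * (1 / y)" by simp
    ultimately have "1 / 4 \<le> a + ln y" using a4 by linarith
    then show ?thesis using l a0 by (simp add: max_def)
  qed
  then show "a / 10 + ?L \<le> S" "(1 + max 0 (ln (R * m))) / 20 + ?L \<le> S"
    by (simp_all add: S y_def)
qed

lemma ln_grid_size_le:
  fixes y c :: real
  assumes "y > 0" "c > 0"
  shows "ln (c * (y + 3)) \<le> ln (4 * c) + max 0 (ln y)"
proof -
  have "c * (y + 3) \<le> 4 * c * max 1 y"
    using assms by (auto simp: max_def)
  then have "ln (c * (y + 3)) \<le> ln (4 * c * max 1 y)"
    using assms by (subst ln_le_cancel_iff) (auto simp: max_def)
  also have "\<dots> = ln (4 * c) + ln (max 1 y)"
    using assms by (subst ln_mult) (auto simp: max_def)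
  also have "ln (max 1 y) = max 0 (ln y)"
    using assms by (auto simp: max_def not_le)
  finally show ?thesis by simp
qed

lemma guess_offset_accurate:
  fixes g :: "'i \<Rightarrow> real"
  assumes p: "finite_mechanism n m \<epsilon> J p"
    and v: "\<And>D. bounded_moment_distribution k R D \<Longrightarrow> v \<le> success_prob n m D J g p \<alpha>'"
    and N: "N \<ge> 1" "\<alpha>' \<le> real N * \<alpha>" and \<beta>: "(1 - \<beta>) * N \<le> v"
  shows "\<exists>A. randomized_algorithm n m A \<and> person_level_DP n m \<epsilon> 0 A \<and>
           (\<forall>D. bounded_moment_distribution k R D \<longrightarrow> accurate_for n m \<alpha> \<beta> D A)"
proof (rule finite_mechanism_accurate[OF finite_mechanism_guess_offset(1)[OF p N]])
  fix D assume D: "bounded_moment_distribution k R D"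
  then have D': "prob_space D" "sets D = sets borel"
    by (auto simp: bounded_moment_distribution_def)
  have "1 - \<beta> \<le> v / N" using \<beta> N by (simp add: pos_le_divide_eq)
  also have "\<dots> \<le> success_prob n m D J g p \<alpha>' / N"
    by (intro divide_right_mono v[OF D]) simp
  also note finite_mechanism_guess_offset(2)[OF p N D']
  finally show "1 - \<beta> \<le> success_prob n m D (J \<times> {..<N})
      (\<lambda>(j, t). g j + (- \<alpha>' + (2 * real t + 1) * \<alpha>' / real N)) (\<lambda>X (j, t). p X j * (1 / real N)) \<alpha>" .
qed

text \<open>The constant answer 0 is accurate to within \<open>R\<close>; guessing one of
  \<open>N\<close> offsets refines it to \<alpha>.\<close>

lemma data_free_accurate:
  fixes N :: nat and \<alpha> \<beta> \<epsilon> R :: real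
  assumes \<epsilon>: "\<epsilon> > 0" and N: "N \<ge> 1" "R \<le> real N * \<alpha>" and \<beta>: "(1 - \<beta>) * N \<le> 1"
  shows "\<exists>A. randomized_algorithm n m A \<and> person_level_DP n m \<epsilon> 0 A \<and>
           (\<forall>D. bounded_moment_distribution k R D \<longrightarrow> accurate_for n m \<alpha> \<beta> D A)"
proof (rule guess_offset_accurate[OF _ _ N \<beta>])
  have "1 \<le> exp \<epsilon>" using \<epsilon> by simp
  then show "finite_mechanism n m \<epsilon> {0 :: nat} (\<lambda>_ _. 1)"
    by (simp add: finite_mechanism_def)
  fix D assume D: "bounded_moment_distribution k R D"
  then interpret P: prob_space "iid_dataset n m D"
    by (intro prob_space_iid_dataset) (simp add: bounded_moment_distribution_def)
  have "\<bar>mean D\<bar> \<le> R" using D by (auto simp: bounded_moment_distribution_def)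
  then show "1 \<le> success_prob n m D {0 :: nat} (\<lambda>_. 0) (\<lambda>_ _. 1) R"
    using P.prob_space by (simp add: success_prob_def)
qed

lemma sample_rate_eq:
  "sample_rate k R m \<alpha> \<epsilon> \<beta> = 1 / (\<alpha>\<^sup>2 * real m * \<beta>)
    + (ln (1 / \<beta>) * noise_scale k m \<alpha> + ln (R * m / \<beta>)) / \<epsilon>"
  by (simp add: sample_rate_def noise_scale_def add_divide_distrib distrib_left)

text \<open>Extracts each requirement separately from the sum. Since one summand may be negative,
  dropping the others is not legitimate by itself; \<open>log_terms_lower_bound\<close> supplies the
  losses 10 and 20.\<close>

lemma sample_rate_consequences:
  fixes k R \<alpha> \<beta> \<epsilon> :: real
  assumes k: "2 \<le> k" and m: "m \<ge> 1" and \<alpha>: "0 < \<alpha>" "\<alpha> < R" and \<epsilon>: "\<epsilon> > 0" and \<beta>: "0 < \<beta>" "\<beta> < 1"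
    and R: "\<alpha> \<le> 4 * R * ln (1 / \<beta>)" and C: "C \<ge> 0"
    and n: "C * (1 + ln m) * sample_rate k R m \<alpha> \<epsilon> \<beta> \<le> n"
  shows "C \<le> real n * real m * \<alpha>\<^sup>2 * \<beta>"
    and "C * (1 + ln m) * (ln (1 / \<beta>) * noise_scale k m \<alpha>) \<le> 10 * (\<epsilon> * n)"
    and "C * (1 + max 0 (ln (R * m))) \<le> 20 * (\<epsilon> * n)"
    and "C * ln (1 / \<beta>) \<le> \<epsilon> * n"
proof -
  let ?L = "ln (1 / \<beta>)" and ?M = "1 + ln m"
  define a where "a = ?L * noise_scale k m \<alpha>"
  define S where "S = a + ln (R * m / \<beta>)"
  define T where "T = 1 / (\<alpha>\<^sup>2 * real m * \<beta>)"
  define e where "e = \<epsilon> * n"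
  have L: "?L > 0" using \<beta> by simp
  have a: "a \<ge> 0" using L noise_scale_pos[OF \<alpha>(1) m, of k] by (simp add: a_def)
  have S: "a / 10 + ?L \<le> S" "(1 + max 0 (ln (R * m))) / 20 + ?L \<le> S"
    using log_terms_lower_bound[OF k m \<alpha> \<beta> R] by (simp_all add: S_def a_def)
  have S0: "S \<ge> 0" using S(1) a L by linarith
  have T0: "T \<ge> 0" using \<beta> by (simp add: T_def)
  have M: "1 \<le> ?M" using m by simp
  have CM: "C \<le> C * ?M" "0 \<le> C * ?M" using C M mult_left_mono[OF M C] by simp_all
  have rate: "C * ?M * (T + S / \<epsilon>) \<le> n"
    using n by (simp add: sample_rate_eq T_def S_def a_def)
  have "C * T \<le> C * ?M * (T + S / \<epsilon>)"
    using CM C T0 S0 \<epsilon> by (intro mult_mono) auto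
  then have "C * T \<le> n" using rate by linarith
  then have "C * T * (\<alpha>\<^sup>2 * real m * \<beta>) \<le> n * (\<alpha>\<^sup>2 * real m * \<beta>)"
    using \<beta> by (intro mult_right_mono) auto
  moreover have "T * (\<alpha>\<^sup>2 * real m * \<beta>) = 1" using \<alpha> m \<beta> by (simp add: T_def)
  ultimately show "C \<le> real n * real m * \<alpha>\<^sup>2 * \<beta>" by (simp add: mult_ac)
  have "C * ?M * (S / \<epsilon>) \<le> C * ?M * (T + S / \<epsilon>)"
    using CM T0 by (intro mult_left_mono) auto
  then have "C * ?M * S / \<epsilon> \<le> n" using rate by simp
  then have CMS: "C * ?M * S \<le> e" using \<epsilon> by (simp add: pos_divide_le_eq mult_ac e_def)
  have CS: "C * S \<le> e" using CMS mult_right_mono[OF CM(1) S0] by linarith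
  have "C * ?M * (a / 10) \<le> C * ?M * S" using S(1) L CM by (intro mult_left_mono) auto
  then show "C * ?M * (?L * noise_scale k m \<alpha>) \<le> 10 * (\<epsilon> * n)"
    using CMS by (simp add: a_def e_def)
  have "(1 + max 0 (ln (R * m))) / 20 \<le> S" using S(2) L by linarith
  then have "C * ((1 + max 0 (ln (R * m))) / 20) \<le> C * S" using C by (rule mult_left_mono)
  then show "C * (1 + max 0 (ln (R * m))) \<le> 20 * (\<epsilon> * n)" using CS by (simp add: e_def)
  have "C * ?L \<le> C * S" using S(1) a C by (intro mult_left_mono) auto
  then show "C * ?L \<le> \<epsilon> * n" using CS by (simp add: e_def)
qed

text \<open>Coarsening the accuracy by \<open>1 / (4 * \<eta>)\<close> gains a factor of order
  \<eta>, which replaces a vanishing \<open>ln (1 / \<beta>)\<close>. The exponent lies in [1, 2]: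
  for \<open>4 * \<eta> \<le> 1\<close> it may be lowered to 1, otherwise raised to 2.\<close>

lemma noise_scale_guess_le:
  assumes k: "2 \<le> k" and m: "m \<ge> 1" and \<alpha>: "0 < \<alpha>" and \<eta>: "0 < \<eta>" "\<eta> \<le> 1 / 2"
  shows "noise_scale k m (\<alpha> / (4 * \<eta>)) \<le> 16 * \<eta> * noise_scale k m \<alpha>"
proof -
  let ?q = "k / (k - 1)"
  note q = conjugate_exponent_bounds[OF k]
  have "(4 * \<eta>) powr ?q \<le> 16 * \<eta>"
  proof (cases "4 * \<eta> \<le> 1")
    case True
    then have "(4 * \<eta>) powr ?q \<le> (4 * \<eta>) powr 1" using q \<eta> by (intro powr_mono') auto
    then show ?thesis using \<eta> by simp
  next
    case False
    then have "(4 * \<eta>) powr ?q \<le> (4 * \<eta>) powr 2" using q by (intro powr_mono) auto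
    also have "\<dots> = 16 * \<eta> * \<eta>" using \<eta> by (simp add: power2_eq_square)
    also have "\<dots> \<le> 16 * \<eta> * 1" using \<eta> by (intro mult_left_mono) auto
    finally show ?thesis by simp
  qed
  then have "(4 * \<eta>) powr ?q * (1 / (\<alpha> powr ?q * m)) \<le> 16 * \<eta> * (1 / (\<alpha> powr ?q * m))"
    by (intro mult_right_mono) auto
  moreover have "1 / ((\<alpha> / (4 * \<eta>)) powr ?q * m) = (4 * \<eta>) powr ?q * (1 / (\<alpha> powr ?q * m))"
    using \<alpha> \<eta> by (simp add: powr_divide)
  moreover have "1 / (\<alpha> / (4 * \<eta>) * sqrt m) = 4 * \<eta> * (1 / (\<alpha> * sqrt m))" by simp
  moreover have "4 * \<eta> * (1 / (\<alpha> * sqrt m)) \<le> 16 * \<eta> * (1 / (\<alpha> * sqrt m))"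
    using \<alpha> \<eta> by (intro mult_right_mono) auto
  ultimately show ?thesis unfolding noise_scale_def distrib_left by linarith
qed

text \<open>For \<beta> at most 1/2 the factor \<open>ln (1 / \<beta>)\<close> is at least
  \<open>ln 2\<close>, so fixed logarithms such as \<open>ln 16\<close> are absorbed into multiples
  of it.\<close>

lemma accurate_algorithm_small_failure:
  fixes k R \<alpha> \<beta> \<epsilon> :: real
  assumes k: "2 \<le> k" and m: "m \<ge> 1" and \<alpha>: "0 < \<alpha>" "\<alpha> < R" and \<epsilon>: "\<epsilon> > 0" and \<beta>: "0 < \<beta>" "\<beta> \<le> 1 / 2"
    and n: "6553600 * (k + 1) * (1 + ln m) * sample_rate k R m \<alpha> \<epsilon> \<beta> \<le> n"
  shows "\<exists>A. randomized_algorithm n m A \<and> person_level_DP n m \<epsilon> 0 A \<and>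
           (\<forall>D. bounded_moment_distribution k R D \<longrightarrow> accurate_for n m \<alpha> \<beta> D A)"
proof -
  let ?L = "ln (1 / \<beta>)" and ?C = "6553600 * (k + 1)"
  define e where "e = \<epsilon> * n"
  have \<beta>1: "\<beta> < 1" using \<beta> by simp
  have "ln 2 \<le> ?L" using \<beta> by (subst ln_le_cancel_iff) (auto simp: field_simps)
  then have L: "2 / 3 \<le> ?L" "ln 2 \<le> ?L" using ln2_ge_two_thirds by linarith+
  have "4 * R * (2 / 3) \<le> 4 * R * ?L" using L \<alpha> by (intro mult_left_mono) auto
  then have R: "\<alpha> \<le> 4 * R * ?L" using \<alpha> by linarith
  have C: "0 \<le> ?C" "19660800 \<le> ?C" using k by simp_all
  note c = sample_rate_consequences[OF k m \<alpha> \<epsilon> \<beta>(1) \<beta>1 R C(1) n, folded e_def]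
  have M: "0 \<le> ln m" using m by simp
  have ns: "noise_scale k m \<alpha> \<ge> 0" using noise_scale_pos[OF \<alpha>(1) m] by (simp add: less_imp_le)
  have ln16: "ln (16::real) = 4 * ln 2"
    using ln_realpow[of "2::real" 4] by simp
  have "ln (16 / \<beta>) = ln 16 + ?L" using \<beta> by (simp add: ln_div)
  then have l16: "ln (16 / \<beta>) \<le> 5 * ?L" using L ln16 by linarith
  have "8192 * (k + 1) * (1 + ln m) * (noise_scale k m \<alpha> * ln (16 / \<beta>))
      \<le> 8192 * (k + 1) * (1 + ln m) * (noise_scale k m \<alpha> * (5 * ?L))"
    using k M ns l16 by (intro mult_left_mono) auto
  also have "\<dots> = ?C * (1 + ln m) * (?L * noise_scale k m \<alpha>) / 160" by simp
  also have "\<dots> \<le> e"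
  proof -
    have "0 \<le> e" using \<epsilon> by (simp add: e_def)
    then show ?thesis using c(2) by linarith
  qed
  finally have noise: "8192 * (k + 1) * (1 + ln m) * (noise_scale k m \<alpha> * ln (16 / \<beta>)) \<le> \<epsilon> * n"
    by (simp only: e_def)
  have y: "R * m > 0" using \<alpha> m by simp
  have coarse: "8 * ln (4 * (R * m + 3) / \<beta>) \<le> \<epsilon> * n"
  proof -
    let ?l = "max 0 (ln (R * m))"
    have "ln (4 * (R * m + 3) / \<beta>) = ln (4 * (R * m + 3)) + ?L"
      using y \<beta> by (simp add: ln_div)
    also have "\<dots> \<le> ln 16 + ?l + ?L" using ln_grid_size_le[OF y, of 4] by simp
    also have "\<dots> \<le> 3 * (1 + ?l) + ?L" using ln16 ln2_le_25_over_36 by simp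
    finally have "8 * ln (4 * (R * m + 3) / \<beta>) \<le> 24 * (1 + ?l) + 8 * ?L" by simp
    moreover have "19660800 * (1 + ?l) \<le> ?C * (1 + ?l)" "19660800 * ?L \<le> ?C * ?L"
      using C L by (intro mult_right_mono; simp)+
    ultimately have "8 * ln (4 * (R * m + 3) / \<beta>) \<le> e" using c(3,4) L by linarith
    then show ?thesis by (simp add: e_def)
  qed
  show ?thesis
  proof (rule mean_estimation_mechanism_log[OF k m _ \<alpha>(1) \<epsilon> \<beta>(1) \<beta>1 _ noise coarse])
    show "R > 0" using \<alpha> by simp
    show "10752 \<le> real n * real m * \<alpha>\<^sup>2 * \<beta>" using c(1) C(2) by linarith
  qed (rule finite_mechanism_accurate)
qed

text \<open>Rounding up the number of guesses is affordable:
  \<open>\<eta> * (1 / (4 * \<eta>) + 1)\<close> is at most 3/4, the success probability of the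
  inner algorithm. If \<open>R\<close> is at most the coarser accuracy, guessing around 0 suffices;
  otherwise \<open>\<alpha> < 4 * \<eta> * R\<close>, and
  \<open>\<eta> \<le> ln (1 / \<beta>)\<close> yields the inequality needed to use the rate.\<close>

lemma accurate_algorithm_large_failure:
  fixes k R \<alpha> \<beta> \<epsilon> :: real
  assumes k: "2 \<le> k" and m: "m \<ge> 1" and \<alpha>: "0 < \<alpha>" "\<alpha> < R" and \<epsilon>: "\<epsilon> > 0" and \<beta>: "1 / 2 < \<beta>" "\<beta> < 1"
    and n: "6553600 * (k + 1) * (1 + ln m) * sample_rate k R m \<alpha> \<epsilon> \<beta> \<le> n"
  shows "\<exists>A. randomized_algorithm n m A \<and> person_level_DP n m \<epsilon> 0 A \<and>
           (\<forall>D. bounded_moment_distribution k R D \<longrightarrow> accurate_for n m \<alpha> \<beta> D A)"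
proof -
  define \<eta> where "\<eta> = 1 - \<beta>"
  have \<eta>: "0 < \<eta>" "\<eta> \<le> 1 / 2" using \<beta> by (auto simp: \<eta>_def)
  have R0: "R > 0" using \<alpha> by simp
  have ceil: "(1 - \<beta>) * nat \<lceil>x\<rceil> \<le> 3 / 4" "1 \<le> nat \<lceil>x\<rceil>" "x \<le> real (nat \<lceil>x\<rceil>)"
    if x: "0 < x" "x \<le> 1 / (4 * \<eta>)" for x :: real
  proof -
    have "real (nat \<lceil>x\<rceil>) = of_int \<lceil>x\<rceil>" using x by simp
    also have "\<dots> \<le> 1 / (4 * \<eta>) + 1" using x of_int_ceiling_le_add_one[of x] by linarith
    finally have "\<eta> * real (nat \<lceil>x\<rceil>) \<le> \<eta> * (1 / (4 * \<eta>) + 1)" using \<eta> by (intro mult_left_mono) auto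
    also have "\<dots> = 1 / 4 + \<eta>" using \<eta> by (simp add: field_simps)
    finally show "(1 - \<beta>) * nat \<lceil>x\<rceil> \<le> 3 / 4" using \<eta> by (simp add: \<eta>_def)
    show "1 \<le> nat \<lceil>x\<rceil>" using x by (simp add: Suc_le_eq)
    show "x \<le> real (nat \<lceil>x\<rceil>)" using x by (simp add: le_of_int_ceiling)
  qed
  show ?thesis
  proof (cases "R \<le> \<alpha> / (4 * \<eta>)")
    case True
    then have x: "0 < R / \<alpha>" "R / \<alpha> \<le> 1 / (4 * \<eta>)" using \<alpha> R0 by (auto simp: field_simps)
    show ?thesis
    proof (rule data_free_accurate[OF \<epsilon> ceil(2)[OF x]])
      show "R \<le> real (nat \<lceil>R / \<alpha>\<rceil>) * \<alpha>"
        using ceil(3)[OF x] \<alpha> by (simp only: pos_divide_le_eq)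
      show "(1 - \<beta>) * real (nat \<lceil>R / \<alpha>\<rceil>) \<le> 1" using ceil(1)[OF x] by linarith
    qed
  next
    case False
    let ?L = "ln (1 / \<beta>)" and ?C = "6553600 * (k + 1)" and ?\<alpha> = "\<alpha> / (4 * \<eta>)"
    define e where "e = \<epsilon> * n"
    have \<beta>0: "0 < \<beta>" using \<beta> by simp
    have "ln \<beta> \<le> \<beta> - 1" using \<beta>0 by (rule ln_le_minus_one)
    then have L: "\<eta> \<le> ?L" using \<beta>0 by (simp add: ln_div \<eta>_def)
    have "\<alpha> \<le> 4 * \<eta> * R" using False \<eta> by (simp add: not_le pos_divide_less_eq mult_ac)
    also have "\<dots> \<le> 4 * ?L * R" using L R0 by (intro mult_right_mono mult_left_mono) auto
    finally have R: "\<alpha> \<le> 4 * R * ?L" by (simp add: mult_ac)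
    have C: "0 \<le> ?C" "19660800 \<le> ?C" using k by simp_all
    note c = sample_rate_consequences[OF k m \<alpha> \<epsilon> \<beta>0 \<beta>(2) R C(1) n, folded e_def]
    have M: "0 \<le> ln m" using m by simp
    have ns: "noise_scale k m \<alpha> \<ge> 0" using noise_scale_pos[OF \<alpha>(1) m] by (simp add: less_imp_le)
    have \<alpha>': "0 < ?\<alpha>" using \<alpha> \<eta> by simp
    have e0: "0 \<le> e" using \<epsilon> by (simp add: e_def)
    have ln64: "ln (64::real) \<le> 5"
      using ln_realpow[of "2::real" 6] ln2_le_25_over_36 by simp
    have "8192 * (k + 1) * (1 + ln m) * (noise_scale k m ?\<alpha> * ln (16 / (1 / 4)))
        \<le> 8192 * (k + 1) * (1 + ln m) * ((16 * ?L * noise_scale k m \<alpha>) * 5)"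
    proof (intro mult_left_mono mult_mono)
      show "noise_scale k m ?\<alpha> \<le> 16 * ?L * noise_scale k m \<alpha>"
        using noise_scale_guess_le[OF k m \<alpha>(1) \<eta>] mult_right_mono[OF L ns] by linarith
    qed (use k M ns L \<eta> ln64 in auto)
    also have "\<dots> = ?C * (1 + ln m) * (?L * noise_scale k m \<alpha>) / 10" by simp
    also have "\<dots> \<le> e" using c(2) by linarith
    finally have noise: "8192 * (k + 1) * (1 + ln m) * (noise_scale k m ?\<alpha> * ln (16 / (1 / 4))) \<le> \<epsilon> * n"
      by (simp only: e_def)
    have y: "R * m > 0" using R0 m by simp
    have coarse: "8 * ln (4 * (R * m + 3) / (1 / 4)) \<le> \<epsilon> * n"
    proof -
      let ?l = "max 0 (ln (R * m))"
      have "ln (4 * (R * m + 3) / (1 / 4)) = ln (16 * (R * m + 3))" by simp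
      also have "\<dots> \<le> ln 64 + ?l" using ln_grid_size_le[OF y, of 16] by simp
      also have "\<dots> \<le> 5 * (1 + ?l)" using ln64 by simp
      finally have "8 * ln (4 * (R * m + 3) / (1 / 4)) \<le> 40 * (1 + ?l)" by simp
      moreover have "19660800 * (1 + ?l) \<le> ?C * (1 + ?l)"
        using C by (intro mult_right_mono; simp)
      ultimately have "8 * ln (4 * (R * m + 3) / (1 / 4)) \<le> e" using c(3) e0 by linarith
      then show ?thesis by (simp add: e_def)
    qed
    have variance: "10752 \<le> real n * real m * ?\<alpha>\<^sup>2 * (1 / 4)"
    proof -
      have "\<alpha> / 2 \<le> ?\<alpha>" using \<alpha> \<eta> by (intro divide_left_mono) auto
      then have "(\<alpha> / 2)\<^sup>2 \<le> ?\<alpha>\<^sup>2" using \<alpha> by (intro power_mono) auto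
      then have "real n * real m * (\<alpha>\<^sup>2 / 4) \<le> real n * real m * ?\<alpha>\<^sup>2"
        by (intro mult_left_mono) (auto simp: power_divide)
      moreover have "real n * real m * \<alpha>\<^sup>2 * \<beta> \<le> real n * real m * \<alpha>\<^sup>2 * 1"
        using \<beta> by (intro mult_left_mono) auto
      ultimately show ?thesis using c(1) C(2) by simp
    qed
    obtain J :: "(int \<times> int) set" and g p where mech: "finite_mechanism n m \<epsilon> J p"
      "\<And>D. bounded_moment_distribution k R D \<Longrightarrow> 1 - 1 / 4 \<le> success_prob n m D J g p ?\<alpha>"
      by (rule mean_estimation_mechanism_log[OF k m R0 \<alpha>' \<epsilon> _ _ variance noise coarse]) auto
    have x: "0 < 1 / (4 * \<eta>)" "1 / (4 * \<eta>) \<le> 1 / (4 * \<eta>)" using \<eta> by simp_all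
    show ?thesis
    proof (rule guess_offset_accurate[OF mech ceil(2)[OF x]])
      show "?\<alpha> \<le> real (nat \<lceil>1 / (4 * \<eta>)\<rceil>) * \<alpha>"
        using mult_right_mono[OF ceil(3)[OF x], of \<alpha>] \<alpha> by simp
      show "(1 - \<beta>) * real (nat \<lceil>1 / (4 * \<eta>)\<rceil>) \<le> 1 - 1 / 4" using ceil(1)[OF x] by linarith
    qed
  qed
qed

theorem theorem3p14:
  fixes k :: real
  assumes "k \<ge> 2"
  shows "\<exists>C>0. \<exists>p::nat. \<forall>R>0. \<forall>\<alpha>>0. \<forall>\<epsilon>>0. \<forall>\<beta>\<in>{0<..<1}. \<forall>m\<ge>1. \<forall>n::nat.
           real n \<ge> C * (1 + ln (real m)) ^ p * sample_rate k R m \<alpha> \<epsilon> \<beta> \<longrightarrow>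
           (\<exists>A. randomized_algorithm n m A \<and> person_level_DP n m \<epsilon> 0 A \<and>
                (\<forall>D. bounded_moment_distribution k R D \<longrightarrow> accurate_for n m \<alpha> \<beta> D A))"
proof (intro exI[of _ "6553600 * (k + 1)"] exI[of _ "1::nat"] conjI allI ballI impI)
  \<comment> \<open>The constant is 8192 * 16 * 5 * 10: the noise requirement, the factor in
    \<open>noise_scale_guess_le\<close>, the bound \<open>ln 64 \<le> 5\<close> and the loss in
    \<open>sample_rate_consequences\<close>. The case \<beta> > 1/2 is the binding one.\<close>
  show "0 < 6553600 * (k + 1)" using assms by simp
  fix R \<alpha> \<epsilon> \<beta> :: real and m n :: nat
  assume R: "R > 0" and \<alpha>: "\<alpha> > 0" and \<epsilon>: "\<epsilon> > 0" and \<beta>: "\<beta> \<in> {0<..<1}" and m: "m \<ge> 1"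
    and "6553600 * (k + 1) * (1 + ln (real m)) ^ 1 * sample_rate k R m \<alpha> \<epsilon> \<beta> \<le> real n"
  then have n: "6553600 * (k + 1) * (1 + ln (real m)) * sample_rate k R m \<alpha> \<epsilon> \<beta> \<le> real n"
    by simp
  \<comment> \<open>When \<open>R \<le> \<alpha>\<close> the rate can be negative and
    \<open>n\<close> may be 0, so the answer 0 must do without data.\<close>
  consider "R \<le> \<alpha>" | "\<alpha> < R" "\<beta> \<le> 1 / 2" | "\<alpha> < R" "1 / 2 < \<beta>" by linarith
  then show "\<exists>A. randomized_algorithm n m A \<and> person_level_DP n m \<epsilon> 0 A \<and>
      (\<forall>D. bounded_moment_distribution k R D \<longrightarrow> accurate_for n m \<alpha> \<beta> D A)"
  proof cases
    case 1
    then show ?thesis using \<beta> by (intro data_free_accurate[OF \<epsilon>, of 1]) auto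
  next
    case 2
    then show ?thesis
      using \<beta> by (intro accurate_algorithm_small_failure[OF assms m \<alpha> _ \<epsilon> _ _ n]) auto
  next
    case 3
    then show ?thesis
      using \<beta> by (intro accurate_algorithm_large_failure[OF assms m \<alpha> _ \<epsilon> _ _ n]) auto
  qed
qed

end
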